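(* Let $G$ be a finite, simple, connected $K_{1,4}$-free graph and let $k\geq 3$ be an integer. If $\sigma_{2k+3}(G) \geq |G| - k + 1$, then $G$ has a spanning tree whose reducible stem has at most $k$ leaves.
   Context: All graphs are finite and simple; $|G|$ denotes the number of vertices of $G$ and $\deg_G(v)$ the degree of $v$ in $G$. A graph is $K_{1,4}$-free if it contains no induced subgraph isomorphic to the star $K_{1,4}$. For an integer $p\geq 2$, $\sigma_p(G)$ is the minimum of $\sum_{x\in S}\deg_G(x)$ over all independent sets $S\subseteq V(G)$ with $|S|=p$; by convention $\sigma_p(G)=+\infty$ if $G$ has no independent set of size $p$. For a tree $T$, a leaf is a vertex of degree one and a branch vertex is a vertex of degree at least three. For a leaf $x$ of $T$, let $y_x$ be the branch vertex of $T$ nearest to $x$, and let $P_T[x,y_x)$ be the path in $T$ from $x$ to $y_x$ not including $y_x$ (the leaf-branch path incident to $x$). The reducible stem of $T$ is the subtree obtained from $T$ by deleting $P_T[x,y_x)$ for every leaf $x$ of $T$; equivalently, it is the smallest subtree of $T$ containing all branch vertices of $T$. Its leaves are its vertices of degree one (in the reducible stem). *)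

theory Defs
  imports "Graph_Theory.Graph_Theory" "HOL-Library.Extended_Real"
begin

text \<open>
  Finite simple graphs are the symmetric, loop-free digraphs without parallel arcs of
  \<^locale>\<open>graph\<close> and \<^locale>\<open>pair_graph\<close>: an undirected edge is a pair of opposite arcs, so the
  undirected degree of a vertex is its \<^const>\<open>out_degree\<close>.
\<close>

definition K14_free :: "('a, 'b) pre_digraph \<Rightarrow> bool" where
  "K14_free G \<longleftrightarrow> \<not> (\<exists>H. induced_subgraph H G \<and> K\<^bsub>1,4\<^esub> H)"

definition independent_set :: "('a, 'b) pre_digraph \<Rightarrow> 'a set \<Rightarrow> bool" where
  "independent_set G S \<longleftrightarrow> S \<subseteq> verts G \<and> (\<forall>u\<in>S. \<forall>v\<in>S. \<not> u \<rightarrow>\<^bsub>G\<^esub> v)"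

text \<open>If there is no independent set of size \<open>p\<close>, this infimum over the empty set is \<open>\<infinity>\<close>.\<close>

definition sigma :: "nat \<Rightarrow> ('a, 'b) pre_digraph \<Rightarrow> enat" where
  "sigma p G = (INF S \<in> {S. independent_set G S \<and> card S = p}. enat (\<Sum>x\<in>S. out_degree G x))"

text \<open>
  The library's \<^const>\<open>tree\<close> is unsuitable for undirected graphs: every edge of a symmetric digraph
  gives a \<^const>\<open>pre_digraph.cycle\<close> of length 2. The cycles of length at least 3 are exactly the
  cycles of the undirected graph.
\<close>

definition undirected_tree :: "('a, 'b) pre_digraph \<Rightarrow> bool" where
  "undirected_tree T \<longleftrightarrow>
     graph T \<and> Digraph_Component.connected T \<and> \<not> (\<exists>p. pre_digraph.cycle T p \<and> length p \<ge> 3)"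

definition undirected_spanning_tree :: "('a, 'b) pre_digraph \<Rightarrow> ('a, 'b) pre_digraph \<Rightarrow> bool" where
  "undirected_spanning_tree T G \<longleftrightarrow> undirected_tree T \<and> spanning T G"

definition leaves :: "('a, 'b) pre_digraph \<Rightarrow> 'a set" where
  "leaves T = {v \<in> verts T. out_degree T v = 1}"

definition branch_vertices :: "('a, 'b) pre_digraph \<Rightarrow> 'a set" where
  "branch_vertices T = {v \<in> verts T. out_degree T v \<ge> 3}"

definition tree_path :: "('a, 'b) pre_digraph \<Rightarrow> 'a \<Rightarrow> 'a \<Rightarrow> 'b awalk" where
  "tree_path T x y = (THE p. pre_digraph.apath T x p y)"

definition nearest_branch_vertex :: "('a, 'b) pre_digraph \<Rightarrow> 'a \<Rightarrow> 'a" where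
  "nearest_branch_vertex T x = arg_min_on (\<lambda>y. length (tree_path T x y)) (branch_vertices T)"

text \<open>
  The vertices of \<open>P\<^sub>T[x, y\<^sub>x)\<close>, for a leaf \<open>x\<close> of a tree that has a branch vertex.
\<close>

definition leaf_branch_path :: "('a, 'b) pre_digraph \<Rightarrow> 'a \<Rightarrow> 'a set" where
  "leaf_branch_path T x =
     (let y = nearest_branch_vertex T x
      in set (pre_digraph.awalk_verts T x (tree_path T x y)) - {y})"

text \<open>
  If \<open>T\<close> has no branch vertex, then \<open>y\<^sub>x\<close> does not exist; in that case the reducible stem is the empty
  graph, the smallest subtree containing all (that is, no) branch vertices.
\<close>

definition reducible_stem :: "('a, 'b) pre_digraph \<Rightarrow> ('a, 'b) pre_digraph" where
  "reducible_stem T =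
     T \<restriction> (if branch_vertices T = {} then {}
          else verts T - (\<Union>x\<in>leaves T. leaf_branch_path T x))"

end

theory Submission
  imports Defs
begin

text \<open>
  Deleting an edge \<open>ab\<close> of a spanning tree and adding an edge \<open>cd\<close> of the graph that joins the two
  components gives a spanning tree again. Every step of the proof is such an exchange, compared with
  a tree that is optimal in some respect.

  In a spanning tree with the fewest leaves, say \<open>L\<close>, let the leaf \<open>u\<close> be adjacent to \<open>p\<close>, and let \<open>q\<close> be
  the tree neighbour of \<open>p\<close> towards \<open>u\<close>. Exchanging \<open>qp\<close> for \<open>up\<close> shows that \<open>q\<close> has degree at most 2
  and that no other leaf is adjacent to \<open>q\<close>. Add up, for a vertex \<open>v\<close>, the leaves adjacent to \<open>v\<close> and the
  arcs \<open>vn\<close> such that some leaf behind \<open>v\<close> is adjacent to \<open>n\<close>: this is at most 2, and at most 1 at a leaf,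
  except at branch vertices adjacent to three leaves, where \<open>K\<^sub>1\<^sub>,\<^sub>4\<close>-freeness provides a compensation
  elsewhere. Hence twice the degree sum of the leaves is at most \<open>2|V| - L\<close>. For a largest subtree
  with at most \<open>2k + 3\<close> leaves this contradicts the hypothesis, so there is a spanning tree with at most
  \<open>2k + 2\<close> leaves.

  If all reducible stems had more than \<open>k\<close> leaves, then in such a tree the stem has exactly \<open>k + 1\<close>
  leaves \<open>x\<close>, each of degree 3, and each lies on a path \<open>P\<^sub>x\<close> (its arm) formed by the two leaf-branch
  paths at \<open>x\<close>; these are all the leaf-branch paths. With the fewest inner stem vertices, the ends of
  \<open>P\<^sub>x\<close> have all their neighbours on \<open>P\<^sub>x\<close>. Some inner stem vertex \<open>w\<close> has neighbours on at most two of
  the arms. It forms with the leaves an independent set of size \<open>2k + 3\<close>, to whose degree sum an arm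
  contributes at most \<open>|P\<^sub>x| - 1\<close>, or \<open>|P\<^sub>x|\<close> if \<open>w\<close> has neighbours on it; the total is at most \<open>|V| - k\<close>.
\<close>

section \<open>Trees and edge exchanges\<close>

text \<open>Directions replace paths: the tree neighbour of \<open>p\<close> towards
  \<open>u\<close> is the \<open>q\<close> with \<open>(q, p) \<in> E\<close> and
  \<open>u \<in> side E q p\<close>. Both halves rest on the same exchange lemmas. If every stem has
  more than k leaves, each of them carries at least two leaf-branch paths, so no spanning tree has
  fewer than 2k + 2 leaves; the trees with 2k + 2 leaves obtained from the degree count thus have
  the fewest leaves. Equality makes them rigid: a branch vertex with a leaf-branch path is a stem
  leaf of degree 3. Nearly every later contradiction is an exchange that violates this. The size 2k
  + 3 stands for the 2k + 2 leaves and one inner stem vertex \<open>w\<close>. The deficit k in the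
  last sum is (k + 1) - 2 + 1: every arm saves one, except at most two, and \<open>w\<close> saves
  one among the inner stem vertices because it is not its own neighbour. The bound k >= 3 provides
  four stem leaves, which cannot all be tree neighbours of one inner stem vertex without forming a
  K_{1,4}; this is what makes a suitable \<open>w\<close> available.\<close>

definition side :: "('a \<times> 'a) set \<Rightarrow> 'a \<Rightarrow> 'a \<Rightarrow> 'a set" where
  "side E a b = {u. (a, u) \<in> (E - {(a, b), (b, a)})\<^sup>*}"

text \<open>
  \<open>side E a b\<close> is the component of \<open>a\<close> after deleting the edge \<open>ab\<close>, so the last conjunct below says
  that every edge is a bridge.
\<close>

definition tree_on :: "'a set \<Rightarrow> ('a \<times> 'a) set \<Rightarrow> bool" where
  "tree_on V E \<longleftrightarrow> finite V \<and> E \<subseteq> V \<times> V \<and> sym E \<and> V \<times> V \<subseteq> E\<^sup>* \<and> (\<forall>(a, b)\<in>E. b \<notin> side E a b)"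

definition deg :: "('a \<times> 'a) set \<Rightarrow> 'a \<Rightarrow> nat" where
  "deg E v = card (E `` {v})"

definition tleaves :: "('a \<times> 'a) set \<Rightarrow> 'a set" where
  "tleaves E = {v. deg E v = 1}"

definition exch :: "('a \<times> 'a) set \<Rightarrow> 'a \<Rightarrow> 'a \<Rightarrow> 'a \<Rightarrow> 'a \<Rightarrow> ('a \<times> 'a) set" where
  "exch E a b c d = (E - {(a, b), (b, a)}) \<union> {(c, d), (d, c)}"

lemma side_self [simp]: "a \<in> side E a b"
  by (simp add: side_def)

lemma side_step:
  assumes "x \<in> side E a b" "(x, y) \<in> E" "(x, y) \<noteq> (a, b)" "(x, y) \<noteq> (b, a)"
  shows "y \<in> side E a b"
  using assms unfolding side_def by (auto intro: rtrancl_into_rtrancl)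

lemma side_induct [consumes 1, case_names self step]:
  assumes "u \<in> side E a b" "P a"
    and "\<And>x y. x \<in> side E a b \<Longrightarrow> P x \<Longrightarrow> (x, y) \<in> E \<Longrightarrow> (x, y) \<noteq> (a, b) \<Longrightarrow> (x, y) \<noteq> (b, a)
      \<Longrightarrow> y \<in> side E a b \<Longrightarrow> P y"
  shows "P u"
proof -
  have "(a, u) \<in> (E - {(a, b), (b, a)})\<^sup>*" using assms(1) by (simp add: side_def)
  then have "P u \<and> u \<in> side E a b"
  proof (induction rule: rtrancl_induct)
    case base
    then show ?case using assms(2) by simp
  next
    case (step y z)
    have yz: "(y, z) \<in> E" "(y, z) \<noteq> (a, b)" "(y, z) \<noteq> (b, a)" using step(2) by simp_all
    have "z \<in> side E a b" using side_step[OF conjunct2[OF step(3)] yz] .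
    moreover have "P z" using assms(3)[OF conjunct2[OF step(3)] conjunct1[OF step(3)] yz calculation] .
    ultimately show ?case by blast
  qed
  then show ?thesis ..
qed

lemma side_subset:
  assumes "a \<in> Q" "\<And>x y. x \<in> Q \<Longrightarrow> (x, y) \<in> E \<Longrightarrow> (x, y) \<noteq> (a, b) \<Longrightarrow> (x, y) \<noteq> (b, a) \<Longrightarrow> y \<in> Q"
  shows "side E a b \<subseteq> Q"
proof
  fix u assume "u \<in> side E a b"
  then show "u \<in> Q" by (induct rule: side_induct) (use assms in auto)
qed

lemma side_mono:
  assumes "\<And>x y. x \<in> side E a b \<Longrightarrow> y \<in> side E a b \<Longrightarrow> (x, y) \<in> E \<Longrightarrow> (x, y) \<in> E'"
  shows "side E a b \<subseteq> side E' a b"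
proof
  fix u assume "u \<in> side E a b"
  then show "u \<in> side E' a b"
  proof (induct rule: side_induct)
    case (step x y)
    then show ?case using assms[of x y] side_step[of x E' a b y] by auto
  qed simp
qed

lemma side_cong:
  assumes "\<And>x y. x \<in> side E a b \<Longrightarrow> (x, y) \<in> E' \<longleftrightarrow> (x, y) \<in> E"
  shows "side E' a b = side E a b"
proof
  show "side E a b \<subseteq> side E' a b" using assms by (intro side_mono) auto
  show "side E' a b \<subseteq> side E a b"
  proof (rule side_subset)
    fix x y assume x: "x \<in> side E a b" and "(x, y) \<in> E'" and ne: "(x, y) \<noteq> (a, b)" "(x, y) \<noteq> (b, a)"
    then have "(x, y) \<in> E" using assms by blast
    then show "y \<in> side E a b" using side_step[OF x _ ne] by blast
  qed simp
qed

text \<open>Lets a fact about the side of \<open>a\<close> be reused for the side of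
  \<open>b\<close>.\<close>

lemma exch_sym: "exch E a b c d = exch E b a d c"
  by (auto simp: exch_def)

locale utree =
  fixes V :: "'a set" and E :: "('a \<times> 'a) set"
  assumes tree: "tree_on V E"
begin

lemma finV: "finite V" and E_sub: "E \<subseteq> V \<times> V" and symE: "sym E"
  and conn: "u \<in> V \<Longrightarrow> v \<in> V \<Longrightarrow> (u, v) \<in> E\<^sup>*"
  and bridge: "(a, b) \<in> E \<Longrightarrow> b \<notin> side E a b"
  using tree unfolding tree_on_def by auto

lemma E_sym: "(a, b) \<in> E \<Longrightarrow> (b, a) \<in> E"
  using symE by (auto dest: symD)

lemma E_verts: "(a, b) \<in> E \<Longrightarrow> a \<in> V" "(a, b) \<in> E \<Longrightarrow> b \<in> V"
  using E_sub by auto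

lemma E_irrefl: "(a, b) \<in> E \<Longrightarrow> a \<noteq> b"
  using bridge[of a b] by auto

lemma fin_nbrs [simp]: "finite (E `` {v})"
  by (rule finite_subset[OF _ finV]) (use E_sub in auto)

lemma side_sub_V: "(a, b) \<in> E \<Longrightarrow> side E a b \<subseteq> V"
  by (rule side_subset) (use E_verts in auto)

lemma fin_side: "(a, b) \<in> E \<Longrightarrow> finite (side E a b)"
  using side_sub_V finV finite_subset by blast

lemma side_rev: "(x, y) \<in> (E - {(a, b), (b, a)})\<^sup>* \<Longrightarrow> (y, x) \<in> (E - {(a, b), (b, a)})\<^sup>*"
proof -
  have "sym (E - {(a, b), (b, a)})" using symE by (auto simp: sym_def)
  then show "(x, y) \<in> (E - {(a, b), (b, a)})\<^sup>* \<Longrightarrow> (y, x) \<in> (E - {(a, b), (b, a)})\<^sup>*"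
    using sym_rtrancl by (auto dest: symD)
qed

lemma side_disj:
  assumes "(a, b) \<in> E" shows "side E a b \<inter> side E b a = {}"
proof (rule ccontr)
  assume "\<not> ?thesis"
  then obtain u where u: "u \<in> side E a b" "u \<in> side E b a" by blast
  have "(a, u) \<in> (E - {(a, b), (b, a)})\<^sup>*" using u(1) by (simp add: side_def)
  moreover have "(u, b) \<in> (E - {(a, b), (b, a)})\<^sup>*"
    using u(2) side_rev[of b u a b] by (simp add: side_def insert_commute)
  ultimately have "(a, b) \<in> (E - {(a, b), (b, a)})\<^sup>*" by (rule rtrancl_trans)
  then show False using bridge[OF assms] by (simp add: side_def)
qed

lemma side_cover:
  assumes "(a, b) \<in> E" shows "side E a b \<union> side E b a = V"
proof
  show "side E a b \<union> side E b a \<subseteq> V" using side_sub_V assms E_sym by blast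
  show "V \<subseteq> side E a b \<union> side E b a"
  proof
    fix u assume "u \<in> V"
    then have "(a, u) \<in> E\<^sup>*" using conn E_verts assms by blast
    then show "u \<in> side E a b \<union> side E b a"
    proof (induction rule: rtrancl_induct)
      case (step y z)
      then show ?case
        by (metis Un_iff side_self side_step Pair_inject)
    qed simp
  qed
qed

lemma side_compl: "(a, b) \<in> E \<Longrightarrow> u \<in> V \<Longrightarrow> u \<notin> side E a b \<Longrightarrow> u \<in> side E b a"
  using side_cover by blast

lemma not_both: "(a, b) \<in> E \<Longrightarrow> u \<in> side E a b \<Longrightarrow> u \<in> side E b a \<Longrightarrow> False"
  using side_disj by blast

lemma side_step':
  assumes "(a, b) \<in> E" "x \<in> side E a b" "(x, y) \<in> E" "y \<noteq> b"
  shows "y \<in> side E a b"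
  using side_step[of x E a b y] assms bridge by auto

lemma cross:
  assumes "(a, b) \<in> E" "x \<in> side E a b" "y \<in> side E b a" "(x, y) \<in> E"
  shows "x = a \<and> y = b"
  using assms side_step[of x E a b y] bridge[of b a] E_sym not_both[of a b y] not_both[of a b x] by blast

text \<open>A walk inside \<open>side E m v\<close> never visits \<open>v\<close>, so it cannot use
  the edge \<open>nv\<close>. Together with bridges this makes the sides behind different neighbours
  of \<open>v\<close> disjoint.\<close>

lemma nbr_side_disj:
  assumes "(m, v) \<in> E" "(n, v) \<in> E" "m \<noteq> n"
  shows "side E m v \<subseteq> side E v n"
proof
  fix u assume "u \<in> side E m v"
  then show "u \<in> side E v n"
  proof (induct rule: side_induct)
    case self
    show ?case by (rule side_step[of v]) (use assms E_sym E_irrefl in auto)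
  next
    case (step x y)
    have "x \<noteq> v" using step(1) bridge[OF assms(1)] by auto
    moreover have "y \<noteq> v" using step(6) bridge[OF assms(1)] by auto
    ultimately show ?case using side_step[OF step(2,3)] by simp
  qed
qed

text \<open>Supports inductions on the size of a side: from \<open>n\<close> one can move on to a
  strictly smaller side, see \<open>card_side_less\<close>.\<close>

lemma side_split:
  assumes "(n, v) \<in> E"
  shows "side E n v = {n} \<union> (\<Union>m\<in>E `` {n} - {v}. side E m n)"
proof
  show "side E n v \<subseteq> {n} \<union> (\<Union>m\<in>E `` {n} - {v}. side E m n)"
  proof (rule side_subset)
    fix x y
    assume x: "x \<in> {n} \<union> (\<Union>m\<in>E `` {n} - {v}. side E m n)" and xy: "(x, y) \<in> E"
      and ne: "(x, y) \<noteq> (n, v)" "(x, y) \<noteq> (v, n)"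
    show "y \<in> {n} \<union> (\<Union>m\<in>E `` {n} - {v}. side E m n)"
    proof (cases "x = n")
      case True
      then show ?thesis using xy ne by (auto intro: side_self)
    next
      case False
      then obtain m where "(n, m) \<in> E" "m \<noteq> v" "x \<in> side E m n" using x by auto
      then show ?thesis using side_step'[OF E_sym[of n m], of x y] xy by blast
    qed
  qed simp
  show "{n} \<union> (\<Union>m\<in>E `` {n} - {v}. side E m n) \<subseteq> side E n v"
  proof -
    have "side E m n \<subseteq> side E n v" if "m \<in> E `` {n} - {v}" for m
      using nbr_side_disj[of m n v] that assms E_sym by blast
    then show ?thesis by auto
  qed
qed

lemma V_split:
  assumes "v \<in> V"
  shows "V = {v} \<union> (\<Union>m\<in>E `` {v}. side E m v)"
proof
  show "{v} \<union> (\<Union>m\<in>E `` {v}. side E m v) \<subseteq> V" using assms side_sub_V E_sym by auto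
  show "V \<subseteq> {v} \<union> (\<Union>m\<in>E `` {v}. side E m v)"
  proof
    fix u assume "u \<in> V"
    then have "(v, u) \<in> E\<^sup>*" using conn assms by auto
    then show "u \<in> {v} \<union> (\<Union>m\<in>E `` {v}. side E m v)"
    proof (induction rule: rtrancl_induct)
      case (step y z)
      show ?case
      proof (cases "y = v")
        case True
        then show ?thesis using step(2) side_self[of z E v] by blast
      next
        case False
        then obtain m where "(v, m) \<in> E" "y \<in> side E m v" using step by auto
        then show ?thesis using side_step'[OF E_sym[of v m], of y z] step(2) by blast
      qed
    qed simp
  qed
qed

lemma obtain_dir:
  assumes "v \<in> V" "u \<in> V" "u \<noteq> v"
  obtains m where "(m, v) \<in> E" "u \<in> side E m v"
  using V_split[OF assms(1)] assms E_sym that by auto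

lemma dir_unique:
  assumes "(m, v) \<in> E" "(n, v) \<in> E" "u \<in> side E m v" "u \<in> side E n v"
  shows "m = n"
  using nbr_side_disj[OF assms(1,2)] assms not_both[of n v u] by blast

lemma not_self_side: "(m, v) \<in> E \<Longrightarrow> v \<notin> side E m v"
  using bridge by blast

lemma card_side_less:
  assumes "(n, v) \<in> E" "(m, n) \<in> E" "m \<noteq> v"
  shows "side E m n \<subset> side E n v"
proof -
  have "side E m n \<subseteq> side E n v" using side_split[OF assms(1)] assms E_sym by blast
  moreover have "n \<notin> side E m n" using assms(2) bridge by blast
  moreover have "n \<in> side E n v" by simp
  ultimately show ?thesis by (metis psubsetI)
qed

text \<open>\<open>side E m p\<close> is connected and misses \<open>q\<close>, so it lies with
  \<open>u\<close> inside \<open>side E n q\<close>; its outer neighbour \<open>p\<close> would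
  follow, unless \<open>p = q\<close>. This yields injectivity in the counting arguments.\<close>

lemma beyond_antisym:
  assumes "(m, p) \<in> E" "(n, q) \<in> E" "u \<in> side E m p" "u \<in> side E n q"
    and "q \<notin> side E m p" "p \<notin> side E n q"
  shows "p = q"
proof (rule ccontr)
  assume ne: "p \<noteq> q"
  have "side E m p \<subseteq> {x. (u, x) \<in> (E - {(n, q), (q, n)})\<^sup>*}"
  proof
    fix x assume x: "x \<in> side E m p"
    have "(m, u) \<in> (E - {(n, q), (q, n)})\<^sup>* \<and> (m, x) \<in> (E - {(n, q), (q, n)})\<^sup>*"
    proof -
      have "y \<in> side E m p \<Longrightarrow> (m, y) \<in> (E - {(n, q), (q, n)})\<^sup>*" for y
      proof (induct rule: side_induct)
        case (step x y)
        have "x \<noteq> q" "y \<noteq> q" using step(1,6) assms(5) by blast+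
        then have "(x, y) \<in> E - {(n, q), (q, n)}" using step(3) by simp
        then show ?case using step(2) by (rule rtrancl_into_rtrancl[rotated])
      qed simp
      then show ?thesis using x assms by auto
    qed
    then show "x \<in> {x. (u, x) \<in> (E - {(n, q), (q, n)})\<^sup>*}"
      using side_rev[of m u n q] rtrancl_trans[of u m _ x] by simp
  qed
  then have "(u, m) \<in> (E - {(n, q), (q, n)})\<^sup>*" using side_self[of m E p] by blast
  then have "m \<in> side E n q" using assms(4) rtrancl_trans[of n u _ m] unfolding side_def by simp
  moreover have "m \<noteq> q" using assms(5) side_self[of m E p] by blast
  ultimately have "p \<in> side E n q" using side_step'[OF assms(2) _ assms(1)] ne by auto
  then show False using assms by auto
qed

lemma deg_pos_in_V: "deg E v > 0 \<Longrightarrow> v \<in> V"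
  unfolding deg_def using E_verts by (metis Image_singleton_iff card_gt_0_iff equals0I)

lemma deg_ge_2_other:
  assumes "deg E v \<ge> 2" obtains w where "(v, w) \<in> E" "w \<noteq> n"
proof -
  have "\<not> E `` {v} \<subseteq> {n}"
    using assms card_mono[of "{n}" "E `` {v}"] by (auto simp: deg_def)
  then show ?thesis using that by auto
qed

lemma deg_ge_3_other:
  assumes "deg E v \<ge> 3" obtains w where "(v, w) \<in> E" "w \<noteq> n" "w \<noteq> m"
proof -
  have "\<not> E `` {v} \<subseteq> {n, m}"
    using assms card_mono[of "{n, m}" "E `` {v}"] card_insert_le_m1[of 2 "{m}" n]
    by (auto simp: deg_def)
  then show ?thesis using that by auto
qed

lemma deg_ge_1:
  assumes "(v, n) \<in> E" shows "deg E v \<ge> 1"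
  using assms unfolding deg_def by (metis Image_singleton_iff One_nat_def Suc_leI card_gt_0_iff empty_iff fin_nbrs)

lemma deg_eq_1:
  assumes "(v, n) \<in> E" "deg E v = 1" shows "E `` {v} = {n}"
  using assms unfolding deg_def by (metis Image_singleton_iff card_1_singletonE singletonD)

lemma deg_le_2_nbr:
  assumes "deg E v \<le> 2" "(v, m) \<in> E" "(v, n) \<in> E" "m \<noteq> n" shows "E `` {v} = {m, n}"
proof -
  have "{m, n} \<subseteq> E `` {v}" using assms by auto
  moreover have "card (E `` {v}) \<le> card {m, n}" using assms by (simp add: deg_def)
  ultimately show ?thesis using card_seteq[OF fin_nbrs] by blast
qed

lemma leaf_side:
  assumes "deg E v = 1" "(v, n) \<in> E" shows "side E v n = {v}"
  using side_split[OF assms(2)] deg_eq_1[OF assms(2,1)] by auto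

end

section \<open>Exchanging one tree edge for another\<close>

lemma Image_exch:
  "exch E a b c d `` {v} = (E `` {v} - (if v = a then {b} else {}) - (if v = b then {a} else {}))
     \<union> (if v = c then {d} else {}) \<union> (if v = d then {c} else {})"
  by (auto simp: exch_def)

context utree begin

context
  fixes a b c d
  assumes ab: "(a, b) \<in> E" and c: "c \<in> side E a b" and d: "d \<in> side E b a"
begin

lemma cd_ne: "c \<noteq> d"
  using ab c d not_both by blast

lemma ba: "(b, a) \<in> E" using ab E_sym by blast

lemma cd_V: "c \<in> V" "d \<in> V"
  using c d ab side_sub_V E_sym by blast+

lemma cd_notin: "(c, d) \<in> E \<Longrightarrow> c = a \<and> d = b" "(d, c) \<in> E \<Longrightarrow> c = a \<and> d = b"
  using cross[OF ab c d] E_sym by blast+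

text \<open>The added edge is never another old edge, since only \<open>ab\<close> joins the two
  sides. The trivial exchange \<open>c = a\<close>, \<open>d = b\<close> is covered:
  \<open>a\<close> and \<open>b\<close> have positive degree, and the subtraction comes before the
  addition.\<close>

lemma deg_exch:
  "deg (exch E a b c d) v = deg E v - (if v = a \<or> v = b then 1 else 0) + (if v = c \<or> v = d then 1 else 0)"
proof -
  have ne: "a \<noteq> b" using ab E_irrefl by blast
  let ?X = "E `` {v} - (if v = a then {b} else {}) - (if v = b then {a} else {})"
  let ?Y = "(if v = c then {d} else {}) \<union> (if v = d then {c} else {})"
  have 1: "card ?X = deg E v - (if v = a \<or> v = b then 1 else 0)"
    using ab ba ne by (auto simp: deg_def card_Diff_singleton)
  have 2: "card ?Y = (if v = c \<or> v = d then 1 else 0)" using cd_ne by auto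
  have "?X \<inter> ?Y = {}" using cd_notin cd_ne by (auto split: if_splits)
  then have "card (?X \<union> ?Y) = card ?X + card ?Y" by (intro card_Un_disjoint) auto
  then show ?thesis using 1 2 unfolding deg_def Image_exch by (simp add: Un_assoc)
qed

text \<open>Why an old edge stays a bridge: in the new tree the side of \<open>a\<close> can be left
  only over \<open>cd\<close>. A walk that is on the other side has therefore passed
  \<open>c\<close>, which the second half of the invariant remembers for its return.\<close>

lemma exch_side_reach:
  assumes "(p, q) \<in> E" "(p, q) \<noteq> (a, b)" "(p, q) \<noteq> (b, a)" "p \<in> side E a b"
  shows "q \<notin> side (exch E a b c d) p q"
proof
  let ?A = "side E a b" and ?B = "side E b a"
  assume q: "q \<in> side (exch E a b c d) p q"
  have "r \<in> side (exch E a b c d) p q \<Longrightarrow>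
    (r \<in> ?A \<longrightarrow> r \<in> side E p q) \<and> (r \<in> ?B \<longrightarrow> c \<in> side E p q)" for r
  proof (induct rule: side_induct)
    case self
    then show ?case using assms(4) not_both[OF ab] by auto
  next
    case (step x y)
    have "x \<in> V \<and> y \<in> V" using step(3) E_verts cd_V by (auto simp: exch_def)
    then have y: "y \<in> ?A \<union> ?B" and x: "x \<in> ?A \<union> ?B" by (simp_all add: side_cover[OF ab])
    show ?case
    proof (cases "(x, y) = (c, d) \<or> (x, y) = (d, c)")
      case True
      then show ?thesis
      proof
        assume "(x, y) = (c, d)"
        then have xy: "x = c" "y = d" by simp_all
        have "c \<in> side E p q" using step(2) c xy by simp
        moreover have "d \<notin> ?A" using not_both[OF ab] d by blast
        ultimately show ?thesis using xy by simp
      next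
        assume "(x, y) = (d, c)"
        then have xy: "x = d" "y = c" by simp_all
        have "c \<in> side E p q" using step(2) d xy by simp
        moreover have "c \<notin> ?B" using not_both[OF ab] c by blast
        ultimately show ?thesis using xy by simp
      qed
    next
      case False
      then have xy: "(x, y) \<in> E" "(x, y) \<noteq> (a, b)" "(x, y) \<noteq> (b, a)"
        using step(3) by (auto simp: exch_def)
      show ?thesis
      proof (cases "x \<in> ?A")
        case True
        then have "y \<in> ?A" using side_step[OF _ xy] by simp
        moreover have "x \<in> side E p q" using True step(2) by blast
        then have "y \<in> side E p q" using side_step[of x E p q y] xy(1) step(4,5) by blast
        moreover have "y \<notin> ?B" using not_both[OF ab] calculation by blast
        ultimately show ?thesis by simp
      next
        case False
        then have "x \<in> ?B" using x by auto
        then have "y \<in> ?B" using side_step[OF _ xy(1,3,2)] by simp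
        then have "y \<notin> ?A" using not_both[OF ab] by blast
        moreover have "c \<in> side E p q" using \<open>x \<in> ?B\<close> step(2) by simp
        ultimately show ?thesis by simp
      qed
    qed
  qed
  from this[OF q] have "q \<in> ?A \<longrightarrow> q \<in> side E p q" by blast
  moreover have "q \<in> ?A" using side_step[OF assms(4,1,2,3)] .
  ultimately show False using bridge[OF assms(1)] by blast
qed

lemma exch_side_new_sup: "side E a b \<subseteq> side (exch E a b c d) c d"
proof -
  have "(c, u) \<in> (exch E a b c d - {(c, d), (d, c)})\<^sup>*" if "u \<in> side E a b" for u
  proof -
    have "(c, u) \<in> (E - {(a, b), (b, a)})\<^sup>*"
    proof (rule rtrancl_trans)
      show "(c, a) \<in> (E - {(a, b), (b, a)})\<^sup>*" by (rule side_rev) (use c in \<open>simp add: side_def\<close>)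
      show "(a, u) \<in> (E - {(a, b), (b, a)})\<^sup>*" using that by (simp add: side_def)
    qed
    moreover have "E - {(a, b), (b, a)} \<subseteq> exch E a b c d - {(c, d), (d, c)}"
    proof
      fix x assume x: "x \<in> E - {(a, b), (b, a)}"
      have "x \<noteq> (c, d)" "x \<noteq> (d, c)" using x cd_notin by blast+
      then show "x \<in> exch E a b c d - {(c, d), (d, c)}" using x by (simp add: exch_def)
    qed
    then have "(E - {(a, b), (b, a)})\<^sup>* \<subseteq> (exch E a b c d - {(c, d), (d, c)})\<^sup>*" by (rule rtrancl_mono)
    ultimately show ?thesis by blast
  qed
  then show ?thesis by (simp add: side_def subset_eq)
qed

text \<open>\<open>ab\<close> was the only edge between its two sides, and \<open>cd\<close> takes
  over that role. So the new edge is a bridge.\<close>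

lemma exch_side_new: "side (exch E a b c d) c d = side E a b"
proof
  show "side E a b \<subseteq> side (exch E a b c d) c d" by (rule exch_side_new_sup)
  show "side (exch E a b c d) c d \<subseteq> side E a b"
  proof (rule side_subset[OF c])
    fix x y assume x: "x \<in> side E a b" and "(x, y) \<in> exch E a b c d" "(x, y) \<noteq> (c, d)" "(x, y) \<noteq> (d, c)"
    then have "(x, y) \<in> E" "(x, y) \<noteq> (a, b)" "(x, y) \<noteq> (b, a)" unfolding exch_def by blast+
    then show "y \<in> side E a b" by (rule side_step[OF x])
  qed
qed

end

lemma tree_exch:
  assumes ab: "(a, b) \<in> E" and c: "c \<in> side E a b" and d: "d \<in> side E b a"
  shows "tree_on V (exch E a b c d)"
proof -
  let ?E = "exch E a b c d"
  have sub: "?E \<subseteq> V \<times> V" using E_sub cd_V[OF assms] by (auto simp: exch_def)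
  have sym: "sym ?E" using symE by (auto simp: exch_def sym_def)
  have n1: "side ?E c d = side E a b" by (rule exch_side_new[OF assms])
  have n2: "side ?E d c = side E b a"
    using exch_side_new[OF E_sym[OF ab] d c] exch_sym[of E a b c d] by simp
  have symr: "sym (?E\<^sup>*)" using sym by (rule sym_rtrancl)
  have cu: "(c, u) \<in> ?E\<^sup>*" if u: "u \<in> V" for u
  proof -
    have "u \<in> side ?E c d \<or> u \<in> side ?E d c" using u n1 n2 side_cover[OF ab] by blast
    then have "(c, u) \<in> ?E\<^sup>* \<or> (d, u) \<in> ?E\<^sup>*"
    proof
      assume "u \<in> side ?E c d"
      then show ?thesis using rtrancl_mono[of "?E - {(c, d), (d, c)}" ?E] by (simp add: side_def subset_eq)
    next
      assume "u \<in> side ?E d c"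
      then show ?thesis using rtrancl_mono[of "?E - {(d, c), (c, d)}" ?E] by (simp add: side_def subset_eq)
    qed
    moreover have "(c, d) \<in> ?E" by (auto simp: exch_def)
    ultimately show ?thesis by (meson converse_rtrancl_into_rtrancl)
  qed
  have "V \<times> V \<subseteq> ?E\<^sup>*"
  proof (intro subsetI)
    fix z assume "z \<in> V \<times> V"
    then obtain x y where z: "z = (x, y)" "x \<in> V" "y \<in> V" by blast
    have "(x, c) \<in> ?E\<^sup>*" using cu[OF z(2)] symr by (rule symD[rotated])
    then show "z \<in> ?E\<^sup>*" using cu[OF z(3)] z(1) rtrancl_trans by simp
  qed
  moreover have "q \<notin> side ?E p q" if pq: "(p, q) \<in> ?E" for p q
  proof (cases "(p, q) = (c, d) \<or> (p, q) = (d, c)")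
    case True
    then show ?thesis using n1 n2 c d not_both[OF ab] by blast
  next
    case False
    then have e: "(p, q) \<in> E" "(p, q) \<noteq> (a, b)" "(p, q) \<noteq> (b, a)"
      using pq unfolding exch_def by blast+
    have "p \<in> side E a b \<or> p \<in> side E b a" using side_cover[OF ab] E_verts(1)[OF e(1)] by blast
    then show ?thesis
    proof
      assume "p \<in> side E a b"
      then show ?thesis by (rule exch_side_reach[OF assms e])
    next
      assume "p \<in> side E b a"
      then show ?thesis
        using exch_side_reach[OF E_sym[OF ab] d c e(1,3,2)] by (simp add: exch_sym[of E a b c d])
    qed
  qed
  ultimately show ?thesis using finV sub sym unfolding tree_on_def by auto
qed

section \<open>Walking on to a branch vertex or to a leaf\<close>

text \<open>Walk from \<open>v\<close> through \<open>n\<close>. A vertex of degree at most 2 on the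
  way is no leaf, as a branch vertex lies behind it, so the continuation is unique. The walk stops
  at \<open>b\<close>, coming from \<open>m\<close>, and \<open>side E n v - side E b m\<close> is
  the stretch walked.\<close>

lemma nearest:
  assumes "(n, v) \<in> E" "\<exists>x\<in>side E n v. deg E x \<ge> 3"
  shows "\<exists>b m. deg E b \<ge> 3 \<and> (m, b) \<in> E \<and> v \<in> side E m b \<and> b \<in> side E n v
    \<and> side E b m \<subseteq> side E n v \<and> (\<forall>x \<in> side E n v - side E b m. deg E x = 2)
    \<and> (b \<noteq> n \<longrightarrow> n \<in> side E m b)"
  using assms
proof (induction "card (side E n v)" arbitrary: n v rule: less_induct)
  case less
  show ?case
  proof (cases "deg E n \<ge> 3")
    case True
    then show ?thesis using less(2) E_sym by (intro exI[of _ n] exI[of _ v]) auto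
  next
    case False
    obtain x where x: "x \<in> side E n v" "deg E x \<ge> 3" using less by auto
    obtain m where m: "(n, m) \<in> E" "m \<noteq> v" "x \<in> side E m n"
      using x False side_split[OF less(2)] by auto
    have nb: "E `` {n} = {m, v}" using deg_le_2_nbr[of n m v] m False less(2) by auto
    have deg: "deg E n = 2" using nb m by (simp add: deg_def)
    have sp: "side E n v = {n} \<union> side E m n" using side_split[OF less(2)] nb m by auto
    have "card (side E m n) < card (side E n v)"
      using card_side_less[OF less(2) E_sym[OF m(1)] m(2)] fin_side[OF less(2)] psubset_card_mono by blast
    from less(1)[OF this E_sym[OF m(1)]] m x obtain b k where b: "deg E b \<ge> 3" "(k, b) \<in> E"
      "n \<in> side E k b" "b \<in> side E m n" "side E b k \<subseteq> side E m n" 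
      "\<forall>x \<in> side E m n - side E b k. deg E x = 2" by blast
    have "v \<noteq> b" using b(4) sp not_self_side[OF less(2)] by auto
    then have "v \<in> side E k b" using side_step'[OF b(2,3) less(2)] by auto
    then show ?thesis using b sp deg by (intro exI[of _ b] exI[of _ k]) auto
  qed
qed

text \<open>The same walk as in \<open>nearest\<close>, which now can end only at a leaf.\<close>

lemma pendant_list:
  assumes "(n, v) \<in> E" "\<forall>x\<in>side E n v. deg E x \<le> 2"
  shows "\<exists>l. l \<noteq> [] \<and> hd l = n \<and> distinct l \<and> set l = side E n v \<and> successively (\<lambda>x y. (x, y) \<in> E) l
    \<and> tleaves E \<inter> side E n v = {last l}"
  using assms
proof (induction "card (side E n v)" arbitrary: n v rule: less_induct)
  case less
  show ?case
  proof (cases "deg E n = 1")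
    case True
    then have "side E n v = {n}" using leaf_side less by blast
    then show ?thesis using True by (intro exI[of _ "[n]"]) (auto simp: tleaves_def)
  next
    case False
    have "deg E n \<ge> 2" using False deg_ge_1[OF less(2)] by linarith
    then obtain m where m: "(n, m) \<in> E" "m \<noteq> v" using deg_ge_2_other[of n v] by auto
    have d2: "deg E n \<le> 2" using less(3) side_self[of n E v] by blast
    have nb: "E `` {n} = {m, v}" using deg_le_2_nbr[of n m v] m d2 less(2) by auto
    have sp: "side E n v = {n} \<union> side E m n" using side_split[OF less(2)] nb m by auto
    have "card (side E m n) < card (side E n v)"
      using card_side_less[OF less(2) E_sym[OF m(1)] m(2)] fin_side[OF less(2)] psubset_card_mono by blast
    from less(1)[OF this E_sym[OF m(1)]] less(3) sp obtain l where l: "l \<noteq> []" "hd l = m" "distinct l"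
      "set l = side E m n" "successively (\<lambda>x y. (x, y) \<in> E) l" "tleaves E \<inter> side E m n = {last l}" by auto
    have "n \<notin> side E m n" using not_self_side E_sym m by blast
    then show ?thesis using l sp m False
      by (intro exI[of _ "n # l"]) (auto simp: successively_Cons tleaves_def)
  qed
qed

end

section \<open>Degree sum of the leaves of a tree with fewest leaves\<close>

lemma tree_exch_utree:
  assumes "tree_on V E" "(a, b) \<in> E" "c \<in> side E a b" "d \<in> side E b a"
  shows "tree_on V (exch E a b c d)"
  using utree.tree_exch[OF utree.intro[OF assms(1)] assms(2-)] .

lemma side_exch_mono:
  assumes "a \<notin> side E m n \<or> b \<notin> side E m n"
  shows "side E m n \<subseteq> side (exch E a b c d) m n"
  by (rule side_mono) (use assms in \<open>auto simp: exch_def\<close>)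

lemma side_exch_eq:
  assumes "a \<notin> side E m n" "b \<notin> side E m n" "c \<notin> side E m n" "d \<notin> side E m n"
  shows "side (exch E a b c d) m n = side E m n"
  by (rule side_cong) (use assms in \<open>auto simp: exch_def\<close>)

locale k14_graph =
  fixes V :: "'a set" and A :: "('a \<times> 'a) set"
  assumes finV: "finite V" and A_sub: "A \<subseteq> V \<times> V" and symA: "sym A" and A_irrefl: "(x, y) \<in> A \<Longrightarrow> x \<noteq> y"
    and K14: "(p, a) \<in> A \<Longrightarrow> (p, b) \<in> A \<Longrightarrow> (p, c) \<in> A \<Longrightarrow> (p, d) \<in> A \<Longrightarrow> distinct [a, b, c, d]
      \<Longrightarrow> (a, b) \<in> A \<or> (a, c) \<in> A \<or> (a, d) \<in> A \<or> (b, c) \<in> A \<or> (b, d) \<in> A \<or> (c, d) \<in> A"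
begin

lemma A_sym: "(x, y) \<in> A \<Longrightarrow> (y, x) \<in> A"
  using symA by (auto dest: symD)

definition sptree :: "('a \<times> 'a) set \<Rightarrow> bool" where
  "sptree E \<longleftrightarrow> tree_on V E \<and> E \<subseteq> A"

lemma sptree_utree: "sptree E \<Longrightarrow> utree V E"
  by (simp add: sptree_def utree_def)

lemma sptree_exch:
  assumes "sptree E" "(a, b) \<in> E" "c \<in> side E a b" "d \<in> side E b a" "(c, d) \<in> A"
  shows "sptree (exch E a b c d)"
  using assms tree_exch_utree A_sym unfolding sptree_def by (auto simp: exch_def)

lemma fin_leaves: "sptree E \<Longrightarrow> finite (tleaves E)"
  using finV utree.deg_pos_in_V[OF sptree_utree] by (auto simp: tleaves_def intro: finite_subset[of _ V])

end

text \<open>\<open>L\<close> is only a lower bound, attained by the \<open>opt\<close> trees. This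
  form is used twice: on a largest subtree with \<open>2 * k + 3\<close> leaves, and on spanning
  trees with \<open>2 * k + 2\<close> leaves. \<open>L4\<close> excludes paths and subdivided stars
  with three leaves.\<close>

locale min_leaf_graph = k14_graph +
  fixes L :: nat
  assumes L_min: "sptree E \<Longrightarrow> L \<le> card (tleaves E)" and L4: "L \<ge> 4"
begin

definition opt :: "('a \<times> 'a) set \<Rightarrow> bool" where
  "opt E \<longleftrightarrow> sptree E \<and> card (tleaves E) = L"

lemma opt_sptree: "opt E \<Longrightarrow> sptree E" and opt_utree: "opt E \<Longrightarrow> utree V E"
  and opt_A: "opt E \<Longrightarrow> (x, y) \<in> E \<Longrightarrow> (x, y) \<in> A"
  and opt_fin: "opt E \<Longrightarrow> finite (tleaves E)" and opt_card: "opt E \<Longrightarrow> card (tleaves E) = L"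
  using sptree_utree fin_leaves by (auto simp: opt_def sptree_def)

text \<open>An inclusion is enough, because its right-hand side has at most \<open>L\<close>
  elements while \<open>E'\<close> has at least \<open>L\<close> leaves. This is how the leaves of
  an exchanged tree become known exactly.\<close>

lemma opt_replace:
  assumes "opt E" "sptree E'" "tleaves E' \<subseteq> tleaves E - {u} \<union> {q}" "u \<in> tleaves E"
  shows "opt E'" "tleaves E' = tleaves E - {u} \<union> {q}"
proof -
  have fin: "finite (tleaves E - {u} \<union> {q})" using opt_fin[OF assms(1)] by simp
  have "card (tleaves E - {u} \<union> {q}) \<le> card (tleaves E - {u}) + card {q}" by (rule card_Un_le)
  also have "\<dots> = L" using opt_card[OF assms(1)] assms(4) opt_fin[OF assms(1)] L4
    by (simp add: card_Diff_singleton)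
  finally have le: "card (tleaves E - {u} \<union> {q}) \<le> L" .
  have le2: "card (tleaves E') \<le> card (tleaves E - {u} \<union> {q})" using card_mono[OF fin assms(3)] .
  show "opt E'" using le le2 L_min[OF assms(2)] assms(2) by (simp add: opt_def)
  show "tleaves E' = tleaves E - {u} \<union> {q}"
    using card_seteq[OF fin assms(3)] le L_min[OF assms(2)] by simp
qed

lemma no_fewer_leaves:
  assumes "opt E" "sptree E'" "tleaves E' \<subseteq> tleaves E - {u}" "u \<in> tleaves E"
  shows False
proof -
  have "card (tleaves E') \<le> card (tleaves E - {u})" using card_mono assms(3) opt_fin[OF assms(1)] by blast
  also have "\<dots> = L - 1" using assms(1,4) by (simp add: opt_def card_Diff_singleton)
  finally show False using L_min[OF assms(2)] L4 by simp
qed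

lemma opt_same:
  assumes "opt E" "sptree E'" "tleaves E' \<subseteq> tleaves E"
  shows "opt E'" "tleaves E' = tleaves E"
proof -
  have "card (tleaves E') \<le> L" using card_mono[OF opt_fin[OF assms(1)] assms(3)] opt_card[OF assms(1)] by simp
  then show "opt E'" using L_min[OF assms(2)] assms(2) by (simp add: opt_def)
  then show "tleaves E' = tleaves E"
    using card_seteq[OF opt_fin[OF assms(1)] assms(3)] opt_card[OF assms(1)] opt_card[of E'] by simp
qed

lemma deg_pos:
  assumes "opt E" "v \<in> V" shows "deg E v \<ge> 1"
proof -
  interpret utree V E by (rule opt_utree[OF assms(1)])
  have "\<not> V \<subseteq> {v}"
  proof
    assume "V \<subseteq> {v}"
    moreover have "tleaves E \<subseteq> V" using deg_pos_in_V by (auto simp: tleaves_def)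
    ultimately have "tleaves E \<subseteq> {v}" by blast
    then have "card (tleaves E) \<le> 1" using card_mono[of "{v}" "tleaves E"] by simp
    then show False using opt_card[OF assms(1)] L4 by simp
  qed
  then obtain w where "w \<in> V" "w \<noteq> v" by blast
  then obtain m where "(m, v) \<in> E" using obtain_dir[OF assms(2)] by metis
  then show ?thesis using deg_ge_1 E_sym by blast
qed

lemma branch_beyond:
  assumes "opt E" "u \<in> tleaves E" "(n, u) \<in> E"
  shows "\<exists>x\<in>side E n u. deg E x \<ge> 3"
proof (rule ccontr)
  interpret utree V E by (rule opt_utree[OF assms(1)])
  assume "\<not> ?thesis"
  then have "\<forall>x\<in>side E n u. deg E x \<le> 2" by auto
  from pendant_list[OF assms(3) this] obtain l where "tleaves E \<inter> side E n u = {last l}" by blast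
  moreover have "E `` {u} = {n}" using deg_eq_1[of u n] assms E_sym by (simp add: tleaves_def)
  then have "V = {u} \<union> side E n u" using V_split[of u] E_verts(2)[OF assms(3)] by simp
  moreover have "tleaves E \<subseteq> V" using deg_pos_in_V by (auto simp: tleaves_def)
  ultimately have "tleaves E \<subseteq> {u, last l}" by blast
  then have "card (tleaves E) \<le> card {u, last l}" by (intro card_mono) auto
  also have "\<dots> \<le> 2" by (rule card_insert_le_m1) auto
  finally show False using opt_card[OF assms(1)] L4 by simp
qed

lemma nearest_branch:
  assumes "opt E" "u \<in> tleaves E"
  obtains b m where "deg E b \<ge> 3" "(m, b) \<in> E" "u \<in> side E m b"
    "\<And>x. x \<in> side E m b \<Longrightarrow> deg E x \<le> 2" "tleaves E \<inter> side E m b = {u}"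
proof -
  interpret utree V E by (rule opt_utree[OF assms(1)])
  have "card (E `` {u}) = 1" using assms(2) by (simp add: tleaves_def deg_def)
  then obtain n where nb: "E `` {u} = {n}" by (meson card_1_singletonE)
  then have n: "(n, u) \<in> E" using E_sym by blast
  from nearest[OF n branch_beyond[OF assms n]] obtain b m where bm: "deg E b \<ge> 3" "(m, b) \<in> E" "u \<in> side E m b"
    "\<forall>x \<in> side E n u - side E b m. deg E x = 2" by blast
  have V: "V = {u} \<union> side E n u" using V_split[of u] E_verts(2)[OF n] nb by simp
  have one: "deg E u = 1" using assms(2) by (simp add: tleaves_def)
  have d: "deg E x = 2" if "x \<in> side E m b" "x \<noteq> u" for x
  proof -
    have "x \<in> V" using that side_sub_V[OF bm(2)] by blast
    then have "x \<in> side E n u" using V that by blast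
    moreover have "x \<notin> side E b m" using not_both[OF bm(2)] that by blast
    ultimately show ?thesis using bm(4) by blast
  qed
  show ?thesis
  proof (rule that[OF bm(1-3)])
    show "deg E x \<le> 2" if "x \<in> side E m b" for x using d[OF that] one by (cases "x = u") auto
    have "x = u" if "x \<in> tleaves E \<inter> side E m b" for x using d[of x] that by (auto simp: tleaves_def)
    then show "tleaves E \<inter> side E m b = {u}" using bm(3) assms(2) by blast
  qed
qed

text \<open>Exchange the edge at the branch vertex nearest to \<open>u\<close> for
  \<open>uv\<close>: the branch vertex does not become a leaf, \<open>v\<close> ceases to be one,
  and at most \<open>m\<close> replaces \<open>u\<close>. That is one leaf too few.\<close>

lemma leaves_indep:
  assumes "opt E" "u \<in> tleaves E" "v \<in> tleaves E" "u \<noteq> v"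
  shows "(u, v) \<notin> A"
proof
  assume uv: "(u, v) \<in> A"
  interpret utree V E by (rule opt_utree[OF assms(1)])
  obtain b m where bm: "deg E b \<ge> 3" "(m, b) \<in> E" "u \<in> side E m b" "tleaves E \<inter> side E m b = {u}"
    using nearest_branch[OF assms(1,2)] by metis
  have "v \<in> V" using uv A_sub by auto
  moreover have "v \<notin> side E m b"
  proof
    assume "v \<in> side E m b"
    then have "v \<in> {u}" using bm(4) assms(3) by blast
    then show False using assms(4) by simp
  qed
  ultimately have v: "v \<in> side E b m" by (rule side_compl[OF bm(2)])
  let ?E = "exch E m b u v"
  have E': "sptree ?E" by (rule sptree_exch[OF opt_sptree[OF assms(1)] bm(2,3) v uv])
  have d: "deg ?E x = deg E x - (if x = m \<or> x = b then 1 else 0) + (if x = u \<or> x = v then 1 else 0)" for x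
    by (rule deg_exch[OF bm(2,3) v])
  have one: "deg E u = 1" "deg E v = 1" using assms by (auto simp: tleaves_def)
  have ne: "v \<noteq> m" using v bridge[OF E_sym[OF bm(2)]] by blast
  have "m \<noteq> b" using E_irrefl bm(2) by blast
  then have "tleaves ?E \<subseteq> (tleaves E - {v}) - {u} \<union> {m}"
    using one bm(1) ne assms(4) by (auto simp: tleaves_def d split: if_splits)
  then have sub: "tleaves ?E \<subseteq> tleaves E - {u} \<union> {m}" by blast
  have "tleaves ?E = tleaves E - {u} \<union> {m}" by (rule opt_replace(2)[OF assms(1) E' sub assms(2)])
  moreover have "v \<notin> tleaves ?E" using \<open>tleaves ?E \<subseteq> (tleaves E - {v}) - {u} \<union> {m}\<close> ne by blast
  ultimately show False using assms by blast
qed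

text \<open>\<open>p\<close> keeps its degree, \<open>u\<close> gains an edge and \<open>q\<close>
  loses one, so \<open>q\<close> must become a leaf to make up for \<open>u\<close>. The case
  \<open>q = u\<close>, where the exchange changes nothing, is included.\<close>

lemma swap:
  assumes "opt E" "u \<in> tleaves E" "(u, p) \<in> A" "(q, p) \<in> E" "u \<in> side E q p"
  shows "deg E q \<le> 2" "opt (exch E q p u p)" "tleaves (exch E q p u p) = tleaves E - {u} \<union> {q}"
    and "q \<noteq> u \<Longrightarrow> deg E q = 2"
proof -
  interpret utree V E by (rule opt_utree[OF assms(1)])
  let ?E = "exch E q p u p"
  have E': "sptree ?E" by (rule sptree_exch[OF opt_sptree[OF assms(1)] assms(4,5) side_self assms(3)])
  have d: "deg ?E x = deg E x - (if x = q \<or> x = p then 1 else 0) + (if x = u \<or> x = p then 1 else 0)" for x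
    by (rule deg_exch[OF assms(4,5) side_self])
  have one: "deg E u = 1" using assms by (auto simp: tleaves_def)
  have pq: "p \<noteq> q" "p \<noteq> u" using E_irrefl[OF assms(4)] A_irrefl[OF assms(3)] by auto
  have p1: "deg E p \<ge> 1" using deg_ge_1[OF E_sym[OF assms(4)]] .
  have q1: "deg E q \<ge> 1" using deg_ge_1[OF assms(4)] .
  have q2: "deg E q = 2" if "q \<noteq> u"
  proof -
    have "deg E q \<noteq> 1" using leaf_side[of q p] assms(4,5) that by auto
    moreover have "\<not> deg E q \<ge> 3"
    proof
      assume "deg E q \<ge> 3"
      then have "tleaves ?E \<subseteq> tleaves E - {u}" using one p1 that pq by (auto simp: tleaves_def d split: if_splits)
      then show False using no_fewer_leaves[OF assms(1) E' _ assms(2)] by blast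
    qed
    ultimately show ?thesis using q1 by linarith
  qed
  then show "q \<noteq> u \<Longrightarrow> deg E q = 2" .
  show "deg E q \<le> 2" using q2 one by (cases "q = u") auto
  have "tleaves ?E \<subseteq> tleaves E - {u} \<union> {q}" using one p1 pq by (auto simp: tleaves_def d split: if_splits)
  then show "opt ?E" "tleaves ?E = tleaves E - {u} \<union> {q}" using opt_replace[OF assms(1) E' _ assms(2)] by blast+
qed

text \<open>Here the edge at \<open>b\<close> moves away from a branch vertex, which can spare it.
  No leaf arises, so none may disappear either, and \<open>c\<close> was not a leaf.\<close>

lemma slide:
  assumes "opt E" "(a, b) \<in> E" "deg E a \<ge> 3" "c \<in> side E a b" "c \<noteq> a" "(c, b) \<in> A"
  shows "opt (exch E a b c b)" "tleaves (exch E a b c b) = tleaves E" "deg E c \<ge> 2"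
    and "deg (exch E a b c b) x = deg E x - (if x = a then 1 else 0) + (if x = c then 1 else 0)"
proof -
  interpret utree V E by (rule opt_utree[OF assms(1)])
  let ?E = "exch E a b c b"
  have E': "sptree ?E" by (rule sptree_exch[OF opt_sptree[OF assms(1)] assms(2,4) side_self assms(6)])
  have ne: "a \<noteq> b" "c \<noteq> b" using E_irrefl[OF assms(2)] A_irrefl[OF assms(6)] by auto
  have b1: "deg E b \<ge> 1" using deg_ge_1[OF E_sym[OF assms(2)]] .
  have d: "deg ?E x = deg E x - (if x = a then 1 else 0) + (if x = c then 1 else 0)" for x
    using deg_exch[OF assms(2,4) side_self, of x] ne b1 by (auto split: if_splits)
  then show "deg ?E x = deg E x - (if x = a then 1 else 0) + (if x = c then 1 else 0)" .
  have "c \<in> V" using side_sub_V assms by blast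
  then have c1: "deg E c \<ge> 1" by (rule deg_pos[OF assms(1)])
  have sub: "tleaves ?E \<subseteq> tleaves E" using assms(3) c1 by (auto simp: tleaves_def d split: if_splits)
  show "opt ?E" "tleaves ?E = tleaves E" using opt_same[OF assms(1) E' sub] by blast+
  have "deg E c \<noteq> 1"
  proof
    assume one: "deg E c = 1"
    then have "deg ?E c = 1" using \<open>tleaves ?E = tleaves E\<close> by (simp add: tleaves_def set_eq_iff)
    then show False using one assms(5) d[of c] by simp
  qed
  then show "deg E c \<ge> 2" using c1 by linarith
qed

text \<open>After \<open>swap\<close> the vertex \<open>q\<close> is a leaf in place of
  \<open>u\<close>, and leaves are independent.\<close>

lemma swap_indep:
  assumes "opt E" "u \<in> tleaves E" "(u, p) \<in> A" "(q, p) \<in> E" "u \<in> side E q p" "w \<in> tleaves E" "w \<noteq> u"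
  shows "(q, w) \<notin> A"
proof -
  interpret utree V E by (rule opt_utree[OF assms(1)])
  note s = swap[OF assms(1-5)]
  have "w \<noteq> q" using leaf_side[of w p] assms by (auto simp: tleaves_def)
  then show ?thesis using leaves_indep[OF s(2), of q w] s(3) assms by blast
qed

lemma nonleaf_nbr:
  assumes "opt E" "u \<in> tleaves E" "(u, p) \<in> A" shows "deg E p \<ge> 2"
proof -
  have "p \<notin> tleaves E" using leaves_indep[OF assms(1,2)] assms(3) A_irrefl by blast
  moreover have "deg E p \<ge> 1" using deg_pos[OF assms(1)] assms(3) A_sub by blast
  ultimately show ?thesis by (simp add: tleaves_def)
qed

text \<open>For two such leaves \<open>u\<close>, \<open>w\<close> and a further tree neighbour
  \<open>r\<close> of \<open>p\<close>, K_{1,4}-freeness at \<open>p\<close> leaves only the edge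
  \<open>qr\<close>. If \<open>p\<close> is a branch vertex, sliding \<open>pr\<close> to
  \<open>qr\<close> gives \<open>q\<close> degree 3, which \<open>swap\<close> forbids. Otherwise
  \<open>p\<close> itself can be made a leaf, although it is adjacent to \<open>w\<close>.\<close>

lemma one_leaf_per_side:
  assumes "opt E" "(q, p) \<in> E" "u \<in> tleaves E" "w \<in> tleaves E" "u \<in> side E q p" "w \<in> side E q p"
    and "(u, p) \<in> A" "(w, p) \<in> A"
  shows "u = w"
proof (rule ccontr)
  assume ne: "u \<noteq> w"
  interpret utree V E by (rule opt_utree[OF assms(1)])
  have one: "deg E u = 1" "deg E w = 1" using assms by (auto simp: tleaves_def)
  have qu: "q \<noteq> u" "q \<noteq> w" using leaf_side[OF _ assms(2)] one assms ne by auto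
  have q2: "deg E q = 2" using swap(4)[OF assms(1,3,7,2,5)] qu by blast
  obtain r where r: "(p, r) \<in> E" "r \<noteq> q" using deg_ge_2_other nonleaf_nbr[OF assms(1,3,7)] by metis
  have rp: "(r, p) \<in> E" using r E_sym by blast
  have sub: "side E q p \<subseteq> side E p r" using nbr_side_disj[OF assms(2) rp] r by blast
  have "r \<notin> side E q p" using dir_unique[OF assms(2) rp, of r] r by auto
  then have ru: "r \<noteq> u" "r \<noteq> w" using assms by auto
  have "(r, u) \<notin> A" using swap_indep[OF assms(1,3) _ r(1) _ assms(4)] sub assms ne A_sym by blast
  moreover have "(r, w) \<notin> A" using swap_indep[OF assms(1,4) _ r(1) _ assms(3)] sub assms ne A_sym by blast
  moreover have "(q, w) \<notin> A" using swap_indep[OF assms(1,3,7,2,5,4)] ne by blast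
  moreover have "(q, u) \<notin> A" using swap_indep[OF assms(1,4,8,2,6,3)] ne by blast
  moreover have "(u, w) \<notin> A" using leaves_indep[OF assms(1,3,4) ne] .
  moreover have "distinct [u, w, q, r]" using ne qu ru r by auto
  moreover have "(p, u) \<in> A" "(p, w) \<in> A" "(p, q) \<in> A" "(p, r) \<in> A"
    using assms opt_A[OF assms(1)] r E_sym A_sym by blast+
  ultimately have qr: "(q, r) \<in> A" using K14[of p u w q r] A_sym by blast
  have qside: "q \<in> side E p r" using sub side_self[of q E p] by blast
  have pq: "q \<noteq> p" "r \<noteq> p" using E_irrefl assms(2) r(1) by blast+
  have psq: "p \<notin> side E q p" by (rule not_self_side[OF assms(2)])
  let ?E = "exch E p r q r"
  have qpE: "(q, p) \<in> ?E" using assms(2) r pq by (simp add: exch_def)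
  have us: "u \<in> side ?E q p" using side_exch_mono[of p E q p r q r] psq assms(5) by blast
  show False
  proof (cases "deg E p \<ge> 3")
    case True
    note s = slide[OF assms(1) r(1) True qside pq(1) qr]
    have "deg ?E q = 3" using s(4)[of q] q2 pq by simp
    then show False using swap(1)[OF s(1) _ assms(7) qpE us] s(2) assms(3) by simp
  next
    case False
    have E1: "sptree ?E" by (rule sptree_exch[OF opt_sptree[OF assms(1)] r(1) qside side_self qr])
    interpret E1: utree V ?E by (rule sptree_utree[OF E1])
    have d1: "deg ?E x = deg E x - (if x = p \<or> x = r then 1 else 0) + (if x = q \<or> x = r then 1 else 0)" for x
      by (rule deg_exch[OF r(1) qside side_self])
    \<comment> \<open>The first exchange left \<open>p\<close> hanging at \<open>q\<close> alone;
      the second hangs it on \<open>u\<close> instead, so \<open>p\<close> replaces \<open>u\<close>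
      as a leaf.\<close>
    let ?F = "exch ?E p q p u"
    have pqE: "(p, q) \<in> ?E" using qpE E1.E_sym by blast
    have F: "sptree ?F" by (rule sptree_exch[OF E1 pqE side_self us]) (use assms A_sym in blast)
    have d2: "deg ?F x = deg ?E x - (if x = p \<or> x = q then 1 else 0) + (if x = p \<or> x = u then 1 else 0)" for x
      by (rule E1.deg_exch[OF pqE side_self us])
    have r1: "deg E r \<ge> 1" using deg_ge_1[OF rp] .
    have "tleaves ?F \<subseteq> tleaves E - {u} \<union> {p}"
      using one q2 qu ru r r1 by (auto simp: tleaves_def d1 d2 split: if_splits)
    note s = opt_replace[OF assms(1) F this assms(3)]
    have "w \<noteq> p" using assms(6) psq by blast
    then show False using leaves_indep[OF s(1), of w p] s(2) assms ne by blast
  qed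
qed

text \<open>\<open>u\<close> gets a second neighbour, the branch vertex \<open>c\<close> keeps at
  least two, and only \<open>e\<close> can become a leaf. Hence \<open>e\<close> is not adjacent to
  the other leaves.\<close>

lemma cut_before_branch:
  assumes "opt E" "u \<in> tleaves E" "(u, p) \<in> A" "(e, c) \<in> E" "p \<in> side E e c" "u \<in> side E c e"
    and "deg E e \<le> 2" "deg E c \<ge> 3"
  shows "opt (exch E e c p u)" "tleaves (exch E e c p u) = tleaves E - {u} \<union> {e}"
proof -
  interpret utree V E by (rule opt_utree[OF assms(1)])
  let ?E = "exch E e c p u"
  have E': "sptree ?E" by (rule sptree_exch[OF opt_sptree[OF assms(1)] assms(4-6) A_sym[OF assms(3)]])
  have d: "deg ?E x = deg E x - (if x = e \<or> x = c then 1 else 0) + (if x = p \<or> x = u then 1 else 0)" for x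
    by (rule deg_exch[OF assms(4-6)])
  have one: "deg E u = 1" using assms by (auto simp: tleaves_def)
  have ue: "u \<noteq> e" using assms(6) not_self_side[OF E_sym[OF assms(4)]] by blast
  have uc: "u \<noteq> c" using one assms by auto
  have p: "deg E p \<ge> 2" by (rule nonleaf_nbr[OF assms(1-3)])
  have "tleaves ?E \<subseteq> tleaves E - {u} \<union> {e}"
    using one p assms(8) ue uc by (auto simp: tleaves_def d split: if_splits)
  then show "opt ?E" "tleaves ?E = tleaves E - {u} \<union> {e}" using opt_replace[OF assms(1) E' _ assms(2)] by blast+
qed

text \<open>
  If \<open>w\<close> were adjacent to \<open>c\<close>, then \<open>K\<^sub>1\<^sub>,\<^sub>4\<close>-freeness at \<open>c\<close> makes two further tree neighbours of \<open>c\<close> adjacent.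
  Moving the edges at \<open>c\<close> one by one reduces its degree to 2, and then \<open>c\<close> can be turned into a leaf.
\<close>

lemma no_leaf_across:
  assumes "opt E" "u \<in> tleaves E" "w \<in> tleaves E" "(u, p) \<in> A" "(e, c) \<in> E" "p \<in> side E e c" "u \<in> side E c e"
    and "deg E e = 2" "deg E c \<ge> 3" "w \<in> side E e c"
  shows "(w, c) \<notin> A"
  using assms
proof (induction "deg E c" arbitrary: E rule: less_induct)
  case less
  note opt = less.prems(1) and ul = less.prems(2) and wl = less.prems(3) and up = less.prems(4)
    and ec = less.prems(5) and ps = less.prems(6) and us = less.prems(7) and e2 = less.prems(8)
    and c3 = less.prems(9) and ws = less.prems(10)
  interpret utree V E by (rule opt_utree[OF opt])
  show ?case
  proof
    assume wc: "(w, c) \<in> A"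
    have uw: "u \<noteq> w" using not_both[OF ec] us ws by blast
    have one: "deg E u = 1" "deg E w = 1" using ul wl by (auto simp: tleaves_def)
    have we: "w \<noteq> e" using one e2 by auto
    have cs: "c \<notin> side E e c" by (rule not_self_side[OF ec])
    have ew: "(e, w) \<notin> A"
      using leaves_indep[OF cut_before_branch(1)[OF opt ul up ec ps us _ c3], of e w]
        cut_before_branch(2)[OF opt ul up ec ps us _ c3] e2 wl we uw by auto
    have uV: "u \<in> V" using up A_sub by auto
    have cV: "c \<in> V" using E_verts ec by blast
    have "u \<noteq> c" using one c3 by auto
    then obtain d0 where d0: "(d0, c) \<in> E" "u \<in> side E d0 c" using obtain_dir[OF cV uV] by blast
    have d0e: "d0 \<noteq> e" using d0 us not_both[OF ec] by blast
    obtain d1 where d1': "(c, d1) \<in> E" "d1 \<noteq> e" "d1 \<noteq> d0" using deg_ge_3_other[OF c3] by metis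
    have d1: "(d1, c) \<in> E" using d1' E_sym by blast
    have sub: "side E e c \<subseteq> side E c d" if "(d, c) \<in> E" "d \<noteq> e" for d
      using nbr_side_disj[OF ec that(1)] that by blast
    have dw: "(d, w) \<notin> A" if d: "(d, c) \<in> E" "d \<noteq> e" for d
    proof
      assume "(d, w) \<in> A"
      then have "(w, d) \<in> A" by (rule A_sym)
      moreover have "w \<in> side E c d" using sub[OF d] ws by blast
      ultimately show False using swap(1)[OF opt wl _ E_sym[OF d(1)]] c3 by fastforce
    qed
    have ed: "(e, d) \<notin> A" if d: "(d, c) \<in> E" "d \<noteq> e" for d
    proof
      assume a: "(e, d) \<in> A"
      have "e \<in> side E c d" using sub[OF d] side_self[of e E c] by blast
      moreover have "e \<noteq> c" using E_irrefl ec by blast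
      ultimately have s: "opt (exch E c d e d)" "tleaves (exch E c d e d) = tleaves E"
        "deg (exch E c d e d) e = 3"
        using slide[OF opt E_sym[OF d(1)] c3 _ _ a] e2 by auto
      have "(e, c) \<in> exch E c d e d" using ec d \<open>e \<noteq> c\<close> by (simp add: exch_def)
      moreover have "w \<in> side (exch E c d e d) e c" using side_exch_mono[of c E e c d e d] cs ws by blast
      ultimately show False using swap(1)[OF s(1) _ wc] s wl by fastforce
    qed
    have "w \<noteq> d" if "(d, c) \<in> E" "d \<noteq> e" for d
      using dir_unique[OF that(1) ec, of d] ws that side_self[of d E c] by blast
    then have "distinct [w, e, d0, d1]" using we d0e d0 d1 d1' by auto
    moreover have "(c, w) \<in> A" "(c, e) \<in> A" "(c, d0) \<in> A" "(c, d1) \<in> A"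
      using wc opt_A[OF opt] ec d0 d1 A_sym by blast+
    ultimately have dd: "(d0, d1) \<in> A"
      using K14[of c w e d0 d1] ew ed[OF d0(1) d0e] ed[OF d1 d1'(2)] dw[OF d0(1) d0e] dw[OF d1 d1'(2)] A_sym
      by blast
    have d0s: "d0 \<in> side E c d1" using nbr_side_disj[OF d0(1) d1] d1'(3) side_self[of d0 E c] by blast
    have d0c: "d0 \<noteq> c" using E_irrefl d0 by blast
    note s = slide[OF opt d1'(1) c3 d0s d0c dd]
    let ?E = "exch E c d1 d0 d1"
    interpret E': utree V ?E by (rule opt_utree[OF s(1)])
    have notin: "d \<notin> side E e c" if "(d, c) \<in> E" "d \<noteq> e" for d
      using dir_unique[OF that(1) ec, of d] that side_self[of d E c] by blast
    have eq: "side ?E e c = side E e c"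
      by (rule side_exch_eq) (use cs notin[OF d0(1) d0e] notin[OF d1 d1'(2)] in auto)
    have ecE: "(e, c) \<in> ?E" using ec d1' E_irrefl[OF ec] by (simp add: exch_def)
    have usE: "u \<in> side ?E c e"
      using E'.side_compl[OF ecE uV] eq us not_both[OF ec] by blast
    have degc: "deg ?E c = deg E c - 1" using s(4)[of c] d0c by simp
    have dege: "deg ?E e = 2" using s(4)[of e] d0e e2 E_irrefl[OF ec] by simp
    show False
    proof (cases "deg E c \<ge> 4")
      case True
      have "(w, c) \<notin> A"
        by (rule less.hyps[of ?E]) (use s(1,2) ul wl up ecE eq ps usE dege degc True ws in auto)
      then show False using wc by simp
    next
      case False
      \<comment> \<open>Now \<open>d0\<close> is a branch vertex preceded by \<open>c\<close> of
        degree 2. Cutting \<open>c d0\<close> and joining \<open>p\<close> to \<open>u\<close> makes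
        \<open>c\<close> a leaf, adjacent to the leaf \<open>w\<close>.\<close>
      then have c2: "deg ?E c = 2" using degc c3 by simp
      have d03: "deg ?E d0 \<ge> 3" using s(3) s(4)[of d0] d0c by simp
      have d0cE: "(c, d0) \<in> ?E" using d0 E_sym d1' d0c by (simp add: exch_def)
      have psE: "p \<in> side ?E c d0"
        using E'.nbr_side_disj[OF ecE E'.E_sym[OF d0cE]] d0e eq ps by blast
      have "c \<notin> side E d0 c" by (rule not_self_side[OF d0(1)])
      then have u2: "u \<in> side ?E d0 c" using side_exch_mono[of c E d0 c d1 d0 d1] d0(2) by blast
      have "u \<in> tleaves ?E" "w \<in> tleaves ?E" using s(2) ul wl by auto
      note t = cut_before_branch[OF s(1) this(1) up d0cE psE u2 _ d03]
      have "w \<noteq> c" using one c3 by auto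
      then show False using leaves_indep[OF t(1), of w c] t(2) c2 uw wl s(2) wc by auto
    qed
  qed
qed

text \<open>Each of these arcs compensates for one branch vertex that is adjacent to three leaves.\<close>

definition slack :: "('a \<times> 'a) set \<Rightarrow> ('a \<times> 'a) set" where
  "slack E = {(e, c). (e, c) \<in> E \<and> deg E e = 2 \<and> (\<forall>u\<in>tleaves E. (u, e) \<notin> A)
    \<and> (\<forall>u\<in>tleaves E \<inter> side E e c. (u, c) \<notin> A)}"

section \<open>Branch vertices adjacent to three leaves\<close>

definition lnbrs :: "('a \<times> 'a) set \<Rightarrow> 'a \<Rightarrow> 'a set" where
  "lnbrs E p = {u \<in> tleaves E. (u, p) \<in> A}"

lemma fin_lnbrs: "opt E \<Longrightarrow> finite (lnbrs E p)"
  using opt_fin by (simp add: lnbrs_def)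

lemma card_lnbrs:
  assumes "opt E" shows "card (lnbrs E p) \<le> 3"
proof (rule ccontr)
  assume "\<not> ?thesis"
  then have "4 \<le> card (lnbrs E p)" by simp
  then obtain T where T: "T \<subseteq> lnbrs E p" "card T = 4" by (rule obtain_subset_with_card_n)
  then obtain a b c d where t: "T = {a, b, c, d}" "distinct [a, b, c, d]"
    by (auto simp: card_Suc_eq numeral_eq_Suc)
  have l: "x \<in> tleaves E \<and> (p, x) \<in> A" if "x \<in> T" for x using that T A_sym by (auto simp: lnbrs_def)
  have "(x, y) \<notin> A" if "x \<in> T" "y \<in> T" for x y
    using leaves_indep[OF assms] l that A_irrefl by blast
  then show False using K14[of p a b c d] l t by auto
qed

text \<open>A tree neighbour \<open>r\<close> of \<open>p\<close> in any other direction would form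
  a K_{1,4} with the three leaves: were a leaf \<open>x\<close> among them adjacent to
  \<open>r\<close>, then \<open>p\<close> would be the neighbour of \<open>r\<close> towards
  \<open>x\<close>, and \<open>swap\<close> would bound its degree by 2.\<close>

lemma triple_deg:
  assumes "opt E" "card (lnbrs E p) = 3" "deg E p \<ge> 3" "\<And>u. u \<in> lnbrs E p \<Longrightarrow> (f u, p) \<in> E \<and> u \<in> side E (f u) p"
  shows "E `` {p} \<subseteq> f ` lnbrs E p"
proof (rule ccontr)
  interpret utree V E by (rule opt_utree[OF assms(1)])
  assume "\<not> ?thesis"
  then obtain r where r: "(p, r) \<in> E" "r \<notin> f ` lnbrs E p" by auto
  obtain a b c where t: "lnbrs E p = {a, b, c}" "distinct [a, b, c]"
    using assms(2) by (auto simp: card_Suc_eq numeral_eq_Suc)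
  have l: "x \<in> tleaves E \<and> (p, x) \<in> A \<and> (x, p) \<in> A" if "x \<in> lnbrs E p" for x using that A_sym by (auto simp: lnbrs_def)
  have nr: "x \<noteq> r \<and> (x, r) \<notin> A" if x: "x \<in> lnbrs E p" for x
  proof -
    have fx: "(f x, p) \<in> E" "x \<in> side E (f x) p" "f x \<noteq> r" using assms(4)[OF x] r x by auto
    have "x \<in> side E p r" using nbr_side_disj[OF fx(1) E_sym[OF r(1)] fx(3)] fx by blast
    then have "(x, r) \<notin> A" using swap(1)[OF assms(1) _ _ r(1)] l[OF x] assms(3) by fastforce
    moreover have "x \<noteq> r" using dir_unique[OF fx(1) E_sym[OF r(1)], of x] fx by auto
    ultimately show ?thesis by blast
  qed
  have "(x, y) \<notin> A" if "x \<in> lnbrs E p" "y \<in> lnbrs E p" for x y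
    using leaves_indep[OF assms(1)] l that A_irrefl by blast
  then show False using K14[of p a b c r] l nr t opt_A[OF assms(1) r(1)] by auto
qed

text \<open>\<open>c\<close> is the first branch vertex met from \<open>p\<close> in the direction
  of one of its leaf neighbours, and \<open>e\<close> precedes it. \<open>cut_before_branch\<close>
  keeps leaves away from \<open>e\<close>, and \<open>no_leaf_across\<close> those behind
  \<open>e\<close> away from \<open>c\<close>. The last conjuncts allow \<open>p\<close> to be
  recovered from the arc.\<close>

lemma triple_slack:
  assumes "opt E" "card (lnbrs E p) = 3" "deg E p \<ge> 3"
  shows "\<exists>e c q. (e, c) \<in> slack E \<and> (q, p) \<in> E \<and> e \<in> side E q p \<and> p \<in> side E e c
    \<and> (\<forall>x\<in>side E e c \<inter> side E q p. deg E x = 2)"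
proof -
  interpret utree V E by (rule opt_utree[OF assms(1)])
  have fin: "finite (lnbrs E p)" by (rule fin_lnbrs[OF assms(1)])
  have pV: "p \<in> V" using deg_pos_in_V assms(3) by simp
  have "\<exists>q. (q, p) \<in> E \<and> u \<in> side E q p" if u: "u \<in> lnbrs E p" for u
  proof -
    have "u \<in> V" "u \<noteq> p" using u A_sub A_irrefl by (auto simp: lnbrs_def)
    then show ?thesis using obtain_dir[OF pV] by metis
  qed
  then obtain f where f: "\<And>u. u \<in> lnbrs E p \<Longrightarrow> (f u, p) \<in> E \<and> u \<in> side E (f u) p" by metis
  have nb: "E `` {p} \<subseteq> f ` lnbrs E p" by (rule triple_deg[OF assms f])
  \<comment> \<open>Otherwise the tree would consist of \<open>p\<close> and three pendant paths and
    have only three leaves, against \<open>L4\<close>.\<close>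
  have "\<exists>u\<in>lnbrs E p. \<exists>x\<in>side E (f u) p. deg E x \<ge> 3"
  proof (rule ccontr)
    assume "\<not> ?thesis"
    then have nb': "\<forall>x\<in>side E (f u) p. deg E x \<le> 2" if "u \<in> lnbrs E p" for u using that by force
    have "tleaves E \<subseteq> lnbrs E p"
    proof
      fix w assume w: "w \<in> tleaves E"
      then have "w \<in> V" "w \<noteq> p" using deg_pos_in_V assms(3) by (auto simp: tleaves_def)
      then obtain m where m: "(m, p) \<in> E" "w \<in> side E m p" using obtain_dir[OF pV] by metis
      then obtain u where u: "u \<in> lnbrs E p" "m = f u" using nb E_sym by blast
      obtain l where "tleaves E \<inter> side E (f u) p = {last l}"
        using pendant_list[of "f u" p] nb'[OF u(1)] f[OF u(1)] by blast
      moreover have "u \<in> tleaves E" using u(1) by (simp add: lnbrs_def)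
      moreover have "w \<in> tleaves E \<inter> side E (f u) p" "u \<in> tleaves E \<inter> side E (f u) p"
        using f[OF u(1)] w m u calculation(2) by auto
      ultimately have "w = u" by simp
      then show "w \<in> lnbrs E p" using u by simp
    qed
    then have "L \<le> 3" using card_mono[OF fin] assms(2) opt_card[OF assms(1)] by fastforce
    then show False using L4 by simp
  qed
  then obtain u where u: "u \<in> lnbrs E p" and br: "\<exists>x\<in>side E (f u) p. deg E x \<ge> 3" by blast
  define q where "q = f u"
  have ul: "u \<in> tleaves E" and up: "(u, p) \<in> A" using u by (auto simp: lnbrs_def)
  have qp: "(q, p) \<in> E" and uq: "u \<in> side E q p" using f[OF u] by (auto simp: q_def)
  from nearest[OF qp] br obtain c e where c3: "deg E c \<ge> 3" and ec: "(e, c) \<in> E" and pe: "p \<in> side E e c"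
    and cq: "c \<in> side E q p" and two: "\<forall>x \<in> side E q p - side E c e. deg E x = 2"
    by (auto simp: q_def)
  have "deg E q \<le> 2" by (rule swap(1)[OF assms(1) ul up qp uq])
  then have cne: "c \<noteq> q" using c3 by auto
  have "e \<noteq> p"
  proof
    assume "e = p"
    then show False using dir_unique[OF E_sym[OF ec] , of q c] qp cq cne by simp
  qed
  then have es: "e \<in> side E q p" using side_step'[OF qp cq E_sym[OF ec]] by blast
  have e2: "deg E e = 2" using two es not_self_side[OF E_sym[OF ec]] by blast
  have one: "deg E u = 1" using ul by (simp add: tleaves_def)
  have uc: "u \<in> side E c e"
  proof (rule ccontr)
    assume "u \<notin> side E c e"
    then have "deg E u = 2" using two uq by blast
    then show False using one by simp
  qed
  have ue: "(u, e) \<notin> A" using swap(1)[OF assms(1) ul _ E_sym[OF ec] uc] c3 by fastforce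
  have "(w, e) \<notin> A" if "w \<in> tleaves E" for w
  proof (cases "w = u")
    case False
    note t = cut_before_branch[OF assms(1) ul up ec pe uc _ c3]
    have "w \<noteq> e" using that e2 by (auto simp: tleaves_def)
    then show ?thesis using leaves_indep[OF t(1), of w e] t(2) that False e2 by auto
  qed (use ue in simp)
  moreover have "(w, c) \<notin> A" if "w \<in> tleaves E \<inter> side E e c" for w
    using no_leaf_across[OF assms(1) ul _ up ec pe uc e2 c3] that by blast
  ultimately have "(e, c) \<in> slack E" using ec e2 by (auto simp: slack_def)
  moreover have "\<forall>x\<in>side E e c \<inter> side E q p. deg E x = 2" using two not_both[OF ec] by blast
  ultimately show ?thesis using qp es pe by blast
qed

text \<open>A slack arc determines its \<open>p\<close>: going back from the arc, \<open>p\<close>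
  ends a stretch of vertices of degree 2. Of two candidates neither can lie in the stretch of the
  other, so \<open>beyond_antisym\<close> identifies them.\<close>

lemma card_triples:
  assumes "opt E"
  shows "card {p \<in> V. card (lnbrs E p) = 3 \<and> deg E p \<ge> 3} \<le> card (slack E)"
proof -
  interpret utree V E by (rule opt_utree[OF assms(1)])
  let ?T = "{p \<in> V. card (lnbrs E p) = 3 \<and> deg E p \<ge> 3}"
  define R where "R p z \<longleftrightarrow> z \<in> slack E \<and> p \<in> side E (fst z) (snd z) \<and>
    (\<exists>q. (q, p) \<in> E \<and> fst z \<in> side E q p \<and> (\<forall>x\<in>side E (fst z) (snd z) \<inter> side E q p. deg E x = 2))" for p z
  have "\<forall>p\<in>?T. \<exists>z. R p z"
  proof
    fix p assume "p \<in> ?T"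
    then have p: "card (lnbrs E p) = 3" "deg E p \<ge> 3" by auto
    from triple_slack[OF assms p] obtain e c q where "(e, c) \<in> slack E" "(q, p) \<in> E" "e \<in> side E q p"
      "p \<in> side E e c" "\<forall>x\<in>side E e c \<inter> side E q p. deg E x = 2" by blast
    then have "R p (e, c)" unfolding R_def fst_conv snd_conv by blast
    then show "\<exists>z. R p z" by blast
  qed
  from bchoice[OF this] obtain g where g: "\<And>p. p \<in> ?T \<Longrightarrow> R p (g p)" by blast
  have "inj_on g ?T"
  proof (rule inj_onI)
    fix x y assume x: "x \<in> ?T" and y: "y \<in> ?T" and eq: "g x = g y"
    obtain q where q: "(q, x) \<in> E" "fst (g x) \<in> side E q x"
      "\<forall>z\<in>side E (fst (g x)) (snd (g x)) \<inter> side E q x. deg E z = 2"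
      using g[OF x] unfolding R_def by blast
    obtain q' where q': "(q', y) \<in> E" "fst (g x) \<in> side E q' y"
      "\<forall>z\<in>side E (fst (g x)) (snd (g x)) \<inter> side E q' y. deg E z = 2"
      using g[OF y] unfolding R_def eq by blast
    have s: "x \<in> side E (fst (g x)) (snd (g x))" "y \<in> side E (fst (g x)) (snd (g x))"
      using g[OF x] g[OF y] unfolding R_def eq by blast+
    have d: "deg E x \<noteq> 2" "deg E y \<noteq> 2" using x y by auto
    have "y \<notin> side E q x" using s q(3) d by blast
    moreover have "x \<notin> side E q' y" using s q'(3) d by blast
    ultimately show "x = y" by (rule beyond_antisym[OF q(1) q'(1) q(2) q'(2)])
  qed
  moreover have "g ` ?T \<subseteq> slack E" using g unfolding R_def by blast
  moreover have "finite (slack E)"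
    by (rule finite_subset[of _ E]) (use E_sub finV in \<open>auto simp: slack_def intro: finite_subset[of E "V \<times> V"]\<close>)
  ultimately show ?thesis by (rule card_inj_on_le)
qed


section \<open>Double counting of leaf neighbours along tree arcs\<close>

definition arc_leaf :: "('a \<times> 'a) set \<Rightarrow> 'a \<Rightarrow> 'a \<Rightarrow> nat" where
  "arc_leaf E v n = (if \<exists>u\<in>tleaves E \<inter> side E v n. (u, n) \<in> A then 1 else 0)"

text \<open>Sort the leaf neighbours of \<open>n\<close> by the tree neighbour of \<open>n\<close>
  towards them; by \<open>one_leaf_per_side\<close> every class has at most one element, so the 0/1
  value of \<open>arc_leaf\<close> counts it exactly.\<close>

lemma card_lnbrs_arcs:
  assumes "opt E" "n \<in> V"
  shows "card (lnbrs E n) = (\<Sum>v\<in>E `` {n}. arc_leaf E v n)"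
proof -
  interpret utree V E by (rule opt_utree[OF assms(1)])
  let ?S = "\<lambda>v. {u \<in> tleaves E \<inter> side E v n. (u, n) \<in> A}"
  have "lnbrs E n = (\<Union>v\<in>E `` {n}. ?S v)"
  proof
    show "lnbrs E n \<subseteq> (\<Union>v\<in>E `` {n}. ?S v)"
    proof
      fix u assume u: "u \<in> lnbrs E n"
      then have "u \<in> V" "u \<noteq> n" using A_sub A_irrefl by (auto simp: lnbrs_def)
      then obtain m where "(m, n) \<in> E" "u \<in> side E m n" using obtain_dir[OF assms(2)] by metis
      then have "m \<in> E `` {n}" "u \<in> ?S m" using u E_sym by (auto simp: lnbrs_def)
      then show "u \<in> (\<Union>v\<in>E `` {n}. ?S v)" by blast
    qed
  qed (auto simp: lnbrs_def)
  moreover have "card (\<Union>v\<in>E `` {n}. ?S v) = (\<Sum>v\<in>E `` {n}. card (?S v))"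
  proof (rule card_UN_disjoint)
    show "\<forall>v\<in>E `` {n}. \<forall>w\<in>E `` {n}. v \<noteq> w \<longrightarrow> ?S v \<inter> ?S w = {}"
      using dir_unique[OF E_sym E_sym] by blast
  qed (use opt_fin[OF assms(1)] in auto)
  moreover have "card (?S v) = arc_leaf E v n" if v: "v \<in> E `` {n}" for v
  proof (cases "\<exists>u. u \<in> ?S v")
    case True
    then obtain u where u: "u \<in> ?S v" by blast
    have vn: "(v, n) \<in> E" using v E_sym by blast
    have "w = u" if "w \<in> ?S v" for w using one_leaf_per_side[OF assms(1) vn, of w u] u that by blast
    then have "?S v = {u}" using u by blast
    then have "card (?S v) = 1" by simp
    then show ?thesis using u by (auto simp: arc_leaf_def)
  next
    case False
    then have "?S v = {}" by blast
    moreover have "arc_leaf E v n = 0" using False by (auto simp: arc_leaf_def)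
    ultimately show ?thesis by (simp only: card.empty)
  qed
  ultimately show ?thesis by simp
qed

text \<open>A leaf has no leaf neighbours and a single arc. At a branch vertex \<open>swap\<close>
  makes all arcs contribute 0, leaving at most three leaf neighbours. At a vertex of degree 2 the
  contributions exclude one another, as the case distinction shows.\<close>

lemma local_count:
  assumes "opt E" "v \<in> V"
  shows "(\<Sum>n\<in>E `` {v}. arc_leaf E v n) + card (lnbrs E v) + card (slack E `` {v})
    \<le> (if v \<in> tleaves E then 1 else 2) + (if card (lnbrs E v) = 3 \<and> deg E v \<ge> 3 then 1 else 0)"
proof -
  interpret utree V E by (rule opt_utree[OF assms(1)])
  let ?F = "\<Sum>n\<in>E `` {v}. arc_leaf E v n"
  let ?d = "card (lnbrs E v)"
  have sl: "slack E `` {v} \<subseteq> E `` {v}" by (auto simp: slack_def)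
  have le1: "arc_leaf E x n \<le> 1" for x n by (simp add: arc_leaf_def)
  have "deg E v = 1 \<or> deg E v = 2 \<or> deg E v \<ge> 3" using deg_pos[OF assms] by linarith
  then consider "deg E v = 1" | "deg E v = 2" | "deg E v \<ge> 3" by blast
  then show ?thesis
  proof cases
    case 1
    then have "v \<in> tleaves E" by (simp add: tleaves_def)
    then have "lnbrs E v = {}" using leaves_indep[OF assms(1)] A_irrefl unfolding lnbrs_def by blast
    moreover have "slack E `` {v} = {}" using 1 by (auto simp: slack_def)
    moreover have "?F \<le> (\<Sum>n\<in>E `` {v}. 1)" by (rule sum_mono) (rule le1)
    ultimately show ?thesis using 1 \<open>v \<in> tleaves E\<close> by (simp add: deg_def)
  next
    case 3
    have "arc_leaf E v n = 0" if "n \<in> E `` {v}" for n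
      using swap(1)[OF assms(1), of _ n v] that 3 by (fastforce simp: arc_leaf_def)
    then have "?F = 0" by simp
    moreover have "slack E `` {v} = {}" using 3 by (auto simp: slack_def)
    moreover have "v \<notin> tleaves E" using 3 by (auto simp: tleaves_def)
    ultimately show ?thesis using card_lnbrs[OF assms(1), of v] 3 by auto
  next
    case 2
    then have nl: "v \<notin> tleaves E" by (simp add: tleaves_def)
    have two: "card (E `` {v}) = 2" using 2 by (simp add: deg_def)
    have dle: "?d \<le> 2"
    proof -
      have "?d = (\<Sum>n\<in>E `` {v}. arc_leaf E n v)" by (rule card_lnbrs_arcs[OF assms])
      also have "\<dots> \<le> (\<Sum>n\<in>E `` {v}. 1)" by (rule sum_mono) (rule le1)
      finally show ?thesis using two by simp
    qed
    show ?thesis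
    proof (cases "lnbrs E v = {}")
      case True
      have "E `` {v} \<inter> {n. (v, n) \<in> slack E} = slack E `` {v}" using sl by blast
      then have "card (slack E `` {v}) = (\<Sum>n\<in>E `` {v}. if n \<in> slack E `` {v} then 1 else 0)"
        by (simp add: sum.If_cases)
      then have "?F + card (slack E `` {v}) = (\<Sum>n\<in>E `` {v}. arc_leaf E v n + (if n \<in> slack E `` {v} then 1 else 0))"
        by (simp add: sum.distrib)
      \<comment> \<open>A slack arc \<open>vn\<close> has no leaf behind \<open>v\<close> that is
        adjacent to \<open>n\<close>, so no arc is counted twice.\<close>
      also have "\<dots> \<le> (\<Sum>n\<in>E `` {v}. 1)"
        by (rule sum_mono) (auto simp: arc_leaf_def slack_def)
      finally show ?thesis using two True nl by simp
    next
      case False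
      then obtain w where w: "w \<in> tleaves E" "(w, v) \<in> A" by (auto simp: lnbrs_def)
      then have sl0: "slack E `` {v} = {}" by (auto simp: slack_def)
      have only: "w' = u" if "n \<in> E `` {v}" "u \<in> tleaves E" "u \<in> side E v n" "(u, n) \<in> A" "w' \<in> lnbrs E v" for n u w'
        using swap_indep[OF assms(1) that(2,4) _ that(3), of w'] that(1,5) A_sym unfolding lnbrs_def by blast
      show ?thesis
      proof (cases "?F = 0")
        case True
        then show ?thesis using dle sl0 nl by simp
      next
        case F0: False
        then obtain n where n: "n \<in> E `` {v}" "arc_leaf E v n \<noteq> 0" by (meson sum.neutral)
        then obtain u where u: "u \<in> tleaves E" "u \<in> side E v n" "(u, n) \<in> A"
          by (auto simp: arc_leaf_def split: if_splits)
        have "lnbrs E v \<subseteq> {u}" using only[OF n(1) u] by blast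
        then have d1: "?d \<le> 1" using card_mono[of "{u}" "lnbrs E v"] by simp
        have wu: "w = u" using only[OF n(1) u] w by (simp add: lnbrs_def)
        \<comment> \<open>A second contributing arc would be due to the same leaf \<open>u\<close>.
          Then \<open>u\<close> would lie behind neither neighbour of \<open>v\<close>, so
          \<open>u = v\<close>.\<close>
        have "arc_leaf E v m = 0" if m: "m \<in> E `` {v}" "m \<noteq> n" for m
        proof (rule ccontr)
          assume "arc_leaf E v m \<noteq> 0"
          then obtain u' where u': "u' \<in> tleaves E" "u' \<in> side E v m" "(u', m) \<in> A"
            by (auto simp: arc_leaf_def split: if_splits)
          have "u' = u" using only[OF m(1) u', of w] w wu by (simp add: lnbrs_def)
          have vm: "(v, m) \<in> E" "(v, n) \<in> E" using m n by auto
          have nb: "E `` {v} = {m, n}" using deg_le_2_nbr[of v m n] 2 vm m by simp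
          have "u \<noteq> v" using u nl by blast
          moreover have "u \<in> V" using u A_sub by blast
          ultimately have "u \<in> side E m v \<or> u \<in> side E n v" using V_split[OF assms(2)] nb by auto
          then show False using not_both[OF vm(1)] not_both[OF vm(2)] u u' \<open>u' = u\<close> by blast
        qed
        then have "?F = arc_leaf E v n + (\<Sum>m\<in>E `` {v} - {n}. arc_leaf E v m)"
          using n(1) by (intro sum.remove) auto
        also have "\<dots> \<le> 1" using le1[of v n] \<open>\<And>m. m \<in> E `` {v} \<Longrightarrow> m \<noteq> n \<Longrightarrow> arc_leaf E v m = 0\<close> by simp
        finally show ?thesis using d1 sl0 nl by simp
      qed
    qed
  qed
qed

theorem sum_degree_leaves:
  assumes "opt E"
  shows "2 * (\<Sum>u\<in>tleaves E. card (A `` {u})) + L \<le> 2 * card V"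
proof -
  interpret utree V E by (rule opt_utree[OF assms(1)])
  let ?T = "{p \<in> V. card (lnbrs E p) = 3 \<and> deg E p \<ge> 3}"
  let ?d = "\<lambda>v. card (lnbrs E v)" and ?F = "\<lambda>v. \<Sum>n\<in>E `` {v}. arc_leaf E v n"
  have lV: "tleaves E \<subseteq> V" using deg_pos_in_V by (auto simp: tleaves_def)
  have "(\<Sum>u\<in>tleaves E. card (A `` {u})) = (\<Sum>u\<in>tleaves E. \<Sum>v | v \<in> V \<and> (u, v) \<in> A. 1)"
  proof (rule sum.cong)
    fix u assume "u \<in> tleaves E"
    have "A `` {u} = {v \<in> V. (u, v) \<in> A}" using A_sub by auto
    then show "card (A `` {u}) = (\<Sum>v | v \<in> V \<and> (u, v) \<in> A. 1)" by simp
  qed simp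
  also have "\<dots> = (\<Sum>v\<in>V. \<Sum>u | u \<in> tleaves E \<and> (u, v) \<in> A. 1)"
    by (rule sum.swap_restrict) (use opt_fin[OF assms] finV in auto)
  finally have D: "(\<Sum>u\<in>tleaves E. card (A `` {u})) = (\<Sum>v\<in>V. ?d v)" by (simp add: lnbrs_def)
  \<comment> \<open>Every leaf neighbour of \<open>v\<close> belongs to an arc into
    \<open>v\<close>. Regrouping these arcs by their tails shows that both terms of
    \<open>local_count\<close> sum to the degree sum of the leaves; hence the factor 2.\<close>
  have "(\<Sum>v\<in>V. ?d v) = (\<Sum>v\<in>V. \<Sum>n | n \<in> V \<and> (v, n) \<in> E. arc_leaf E n v)"
  proof (rule sum.cong)
    fix v assume v: "v \<in> V"
    have "E `` {v} = {n \<in> V. (v, n) \<in> E}" using E_sub by auto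
    then show "?d v = (\<Sum>n | n \<in> V \<and> (v, n) \<in> E. arc_leaf E n v)" using card_lnbrs_arcs[OF assms v] by simp
  qed simp
  also have "\<dots> = (\<Sum>n\<in>V. \<Sum>v | v \<in> V \<and> (v, n) \<in> E. arc_leaf E n v)"
    by (rule sum.swap_restrict) (use finV in auto)
  also have "\<dots> = (\<Sum>n\<in>V. ?F n)"
  proof (rule sum.cong)
    fix n assume "n \<in> V"
    have "E `` {n} = {v \<in> V. (v, n) \<in> E}" using E_sub E_sym by blast
    then show "(\<Sum>v | v \<in> V \<and> (v, n) \<in> E. arc_leaf E n v) = ?F n" by simp
  qed simp
  finally have DF: "(\<Sum>v\<in>V. ?d v) = (\<Sum>v\<in>V. ?F v)" .
  have S: "(\<Sum>v\<in>V. card (slack E `` {v})) = card (slack E)"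
  proof -
    have "slack E = Sigma V (\<lambda>v. slack E `` {v})" using E_verts by (auto simp: slack_def)
    moreover have "finite (slack E `` {v})" for v
      by (rule finite_subset[of _ "E `` {v}"]) (auto simp: slack_def)
    ultimately show ?thesis using card_SigmaI[OF finV, of "\<lambda>v. slack E `` {v}"] by simp
  qed
  have "(\<Sum>v\<in>V. ?F v + ?d v + card (slack E `` {v}))
    \<le> (\<Sum>v\<in>V. (if v \<in> tleaves E then 1 else 2) + (if card (lnbrs E v) = 3 \<and> deg E v \<ge> 3 then 1 else 0))"
    by (rule sum_mono) (rule local_count[OF assms])
  also have "\<dots> = (\<Sum>v\<in>V. if v \<in> tleaves E then 1 else 2) + card ?T"
    using finV by (simp add: sum.distrib sum.If_cases Int_def conj_commute)
  finally have 1: "2 * (\<Sum>v\<in>V. ?d v) + card (slack E) \<le> (\<Sum>v\<in>V. if v \<in> tleaves E then 1 else 2) + card ?T"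
    using DF S by (simp add: sum.distrib)
  have "(\<Sum>v\<in>V. if v \<in> tleaves E then 1 else (2::nat)) + L = 2 * card V"
  proof -
    have "(\<Sum>v\<in>V. (if v \<in> tleaves E then 1 else (2::nat))) + (\<Sum>v\<in>V. if v \<in> tleaves E then 1 else 0) = (\<Sum>v\<in>V. 2)"
      unfolding sum.distrib[symmetric] by (rule sum.cong) auto
    moreover have "(\<Sum>v\<in>V. if v \<in> tleaves E then 1 else (0::nat)) = L"
      using finV lV opt_card[OF assms] by (simp add: sum.If_cases Int_absorb1 Int_commute)
    ultimately show ?thesis by simp
  qed
  then show ?thesis using 1 card_triples[OF assms] D by simp
qed

end

section \<open>Stem leaves and inner stem vertices\<close>

text \<open>
  \<open>cav E w a b\<close>: there is a path from \<open>a\<close> to \<open>b\<close> avoiding \<open>w\<close>. In terms of the reducible stem,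
  \<open>core\<close> consists of its vertices of degree at least 2 and \<open>ends\<close> of the remaining ones.
\<close>

definition cav :: "('a \<times> 'a) set \<Rightarrow> 'a \<Rightarrow> 'a \<Rightarrow> 'a \<Rightarrow> bool" where
  "cav E w a b \<longleftrightarrow> (a, b) \<in> (E \<inter> (- {w}) \<times> (- {w}))\<^sup>*"

definition core :: "('a \<times> 'a) set \<Rightarrow> 'a set" where
  "core E = {w. \<exists>a b. deg E a \<ge> 3 \<and> deg E b \<ge> 3 \<and> a \<noteq> w \<and> b \<noteq> w \<and> \<not> cav E w a b}"

definition ends :: "('a \<times> 'a) set \<Rightarrow> 'a set" where
  "ends E = {v. deg E v \<ge> 3 \<and> v \<notin> core E}"

text \<open>If \<open>v\<close> is a branch vertex, \<open>side E m v\<close> is then the vertex set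
  of a leaf-branch path that ends just before \<open>v\<close>.\<close>

definition pend :: "('a \<times> 'a) set \<Rightarrow> 'a \<Rightarrow> 'a \<Rightarrow> bool" where
  "pend E m v \<longleftrightarrow> (m, v) \<in> E \<and> (\<forall>x\<in>side E m v. deg E x \<le> 2)"

definition arm :: "('a \<times> 'a) set \<Rightarrow> 'a \<Rightarrow> 'a set" where
  "arm E x = {x} \<union> (\<Union>m\<in>{m. pend E m x}. side E m x)"

lemma cav_refl [simp]: "cav E w a a"
  by (simp add: cav_def)

lemma cav_trans: "cav E w a b \<Longrightarrow> cav E w b c \<Longrightarrow> cav E w a c"
  unfolding cav_def by (rule rtrancl_trans)

lemma cav_edge: "(a, b) \<in> E \<Longrightarrow> a \<noteq> w \<Longrightarrow> b \<noteq> w \<Longrightarrow> cav E w a b"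
  unfolding cav_def by (rule r_into_rtrancl) simp

section \<open>Separation by a vertex and its behaviour under exchanges\<close>

context utree begin

lemma cav_sym: "cav E w a b \<Longrightarrow> cav E w b a"
proof -
  have "sym (E \<inter> (- {w}) \<times> (- {w}))" using symE by (auto simp: sym_def)
  then have "sym ((E \<inter> (- {w}) \<times> (- {w}))\<^sup>*)" by (rule sym_rtrancl)
  then show "cav E w a b \<Longrightarrow> cav E w b a" unfolding cav_def by (rule symD)
qed

lemma cav_within:
  assumes "x \<in> side E p q" "y \<in> side E p q" "w \<notin> side E p q"
  shows "cav E w x y"
proof -
  have "cav E w p z" if "z \<in> side E p q" for z
    using that
  proof (induct rule: side_induct)
    case (step x y)
    have "cav E w x y" by (rule cav_edge) (use step assms(3) in auto)
    then show ?case using cav_trans step(2) by metis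
  qed simp
  then show ?thesis using assms cav_sym cav_trans by metis
qed

lemma cav_side:
  assumes "(m, w) \<in> E" "a \<in> side E m w"
  shows "cav E w a b \<longleftrightarrow> b \<in> side E m w"
proof
  assume "b \<in> side E m w"
  then show "cav E w a b" using cav_within[OF assms(2)] not_self_side[OF assms(1)] by blast
next
  assume "cav E w a b"
  then have "(a, b) \<in> (E \<inter> (- {w}) \<times> (- {w}))\<^sup>*" by (simp add: cav_def)
  then show "b \<in> side E m w"
  proof (induction rule: rtrancl_induct)
    case (step y z)
    then show ?case using side_step'[OF assms(1), of y z] by simp
  qed (rule assms(2))
qed

lemma coreI:
  assumes "(m, w) \<in> E" "a \<in> side E m w" "b \<notin> side E m w" "b \<noteq> w" "deg E a \<ge> 3" "deg E b \<ge> 3"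
  shows "w \<in> core E"
proof -
  have "a \<noteq> w" using assms(1,2) not_self_side by blast
  then show ?thesis using assms cav_side[OF assms(1,2), of b] unfolding core_def by blast
qed

lemma core_in_V:
  assumes "w \<in> core E" shows "w \<in> V"
proof (rule ccontr)
  assume w: "w \<notin> V"
  obtain a b where ab: "deg E a \<ge> 3" "deg E b \<ge> 3" "\<not> cav E w a b" using assms by (auto simp: core_def)
  have "a \<in> V" "b \<in> V" using ab deg_pos_in_V by auto
  then have "(a, b) \<in> E\<^sup>*" by (rule conn)
  moreover have "E \<inter> (- {w}) \<times> (- {w}) = E" using w E_sub by auto
  ultimately show False using ab(3) by (simp add: cav_def)
qed

lemma core_other_branch:
  assumes "w \<in> core E"
  obtains m a where "(m, w) \<in> E" "m \<noteq> n" "a \<in> side E m w" "deg E a \<ge> 3"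
proof -
  obtain a b where ab: "deg E a \<ge> 3" "deg E b \<ge> 3" "\<not> cav E w a b" "a \<noteq> w" "b \<noteq> w"
    using assms by (auto simp: core_def)
  have V: "a \<in> V" "b \<in> V" using ab deg_pos_in_V by auto
  obtain ma where ma: "(ma, w) \<in> E" "a \<in> side E ma w" using obtain_dir[OF core_in_V[OF assms] V(1) ab(4)] .
  obtain mb where mb: "(mb, w) \<in> E" "b \<in> side E mb w" using obtain_dir[OF core_in_V[OF assms] V(2) ab(5)] .
  have "ma \<noteq> mb" using cav_side[OF ma, of b] mb ab(3) by blast
  then consider "ma \<noteq> n" | "mb \<noteq> n" by blast
  then show ?thesis by cases (use that ma mb ab in blast)+
qed

lemma core_deg: "w \<in> core E \<Longrightarrow> deg E w \<ge> 2"
proof -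
  assume w: "w \<in> core E"
  obtain m where m: "(m, w) \<in> E" using core_other_branch[OF w] by metis
  obtain n where n: "(n, w) \<in> E" "n \<noteq> m" using core_other_branch[OF w, of m] by metis
  have "{m, n} \<subseteq> E `` {w}" using m n E_sym by blast
  then have "card {m, n} \<le> card (E `` {w})" by (intro card_mono) auto
  then show ?thesis using n by (simp add: deg_def)
qed

text \<open>Away from \<open>w\<close> there is a further branch vertex behind \<open>v\<close>, and
  it can replace \<open>v\<close> as a witness. So in the definition of \<open>core\<close> an inner
  stem vertex may serve in place of one of the two branch vertices.\<close>

lemma core_between:
  assumes "v \<in> core E" "w \<noteq> v" "w \<in> V" "deg E b \<ge> 3" "b \<noteq> w" "\<not> cav E w v b"
  shows "w \<in> core E"
proof -
  have vV: "v \<in> V" by (rule core_in_V[OF assms(1)])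
  obtain n where n: "(n, v) \<in> E" "w \<in> side E n v" using obtain_dir[OF vV assms(3,2)] .
  obtain m a where m: "(m, v) \<in> E" "m \<noteq> n" "a \<in> side E m v" "deg E a \<ge> 3"
    using core_other_branch[OF assms(1)] .
  have wm: "w \<notin> side E m v" using dir_unique[OF m(1) n(1)] m(2) n(2) by blast
  have "m \<noteq> w" using wm by auto
  then have "cav E w v m" using m(1) assms(2) E_sym by (intro cav_edge) auto
  moreover have "cav E w m a" by (rule cav_within[OF side_self m(3) wm])
  ultimately have va: "cav E w v a" by (rule cav_trans)
  obtain r where r: "(r, w) \<in> E" "v \<in> side E r w"
    using obtain_dir[OF assms(3) vV assms(2)[symmetric]] .
  have "a \<in> side E r w" using cav_side[OF r, of a] va by blast
  moreover have "b \<notin> side E r w" using cav_side[OF r, of b] assms(6) by blast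
  ultimately show ?thesis using coreI[OF r(1) _ _ assms(5) m(4) assms(4)] by blast
qed

text \<open>A walk that leaves the side of \<open>q\<close> does so at \<open>q\<close> and returns
  at \<open>q\<close>, so the excursion can be cut out. The invariant keeps \<open>q\<close> in mind
  during an excursion.\<close>

lemma cav_restrict:
  assumes pq: "(p, q) \<in> E" and "a \<in> side E q p" "b \<in> side E q p"
  shows "cav E w a b \<longleftrightarrow> cav (E \<inter> side E q p \<times> side E q p) w a b"
proof
  let ?S = "side E q p" and ?R = "(E \<inter> side E q p \<times> side E q p) \<inter> (- {w}) \<times> (- {w})"
  assume "cav E w a b"
  then have "(a, b) \<in> (E \<inter> (- {w}) \<times> (- {w}))\<^sup>*" by (simp add: cav_def)
  then have "(b \<in> ?S \<longrightarrow> (a, b) \<in> ?R\<^sup>*) \<and> (b \<in> side E p q \<longrightarrow> (a, q) \<in> ?R\<^sup>*)"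
  proof (induction rule: rtrancl_induct)
    case base
    then show ?case using assms not_both[OF pq] by blast
  next
    case (step y z)
    then have yz: "(y, z) \<in> E" "y \<noteq> w" "z \<noteq> w" by auto
    have "y \<in> ?S \<or> y \<in> side E p q" "z \<in> ?S \<or> z \<in> side E p q"
      using side_compl[OF pq] E_verts yz(1) by blast+
    then consider "y \<in> ?S" "z \<in> ?S" | "y \<in> ?S" "z \<in> side E p q" | "y \<in> side E p q" "z \<in> ?S"
      | "y \<in> side E p q" "z \<in> side E p q" by blast
    then show ?case
    proof cases
      case 1
      then have "(y, z) \<in> ?R" using yz by blast
      then show ?thesis using 1 step.IH rtrancl_into_rtrancl[of a y ?R z] not_both[OF pq] by blast
    next
      case 2
      then have "y = q" using cross[OF E_sym[OF pq] 2 yz(1)] by blast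
      then show ?thesis using 2 step.IH not_both[OF pq] by blast
    next
      case 3
      then have "z = q" using cross[OF pq 3 yz(1)] by blast
      then show ?thesis using 3 step.IH not_both[OF pq] by blast
    next
      case 4
      then show ?thesis using step.IH not_both[OF pq] by blast
    qed
  qed
  then show "cav (E \<inter> ?S \<times> ?S) w a b" using assms by (simp add: cav_def)
next
  assume "cav (E \<inter> side E q p \<times> side E q p) w a b"
  then show "cav E w a b"
    unfolding cav_def by (rule rtrancl_mono[THEN subsetD, rotated]) blast
qed

lemma cav_exch:
  assumes pq: "(p, q) \<in> E" and c: "c \<in> side E p q" and d: "d \<in> side E q p"
    and a: "a \<in> side E q p" and b: "b \<in> side E q p"
  shows "cav (exch E p q c d) w a b \<longleftrightarrow> cav E w a b"
proof -
  let ?E = "exch E p q c d" and ?S = "side E q p"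
  interpret E': utree V ?E by (rule utree.intro[OF tree_exch[OF pq c d]])
  have S: "side ?E d c = ?S"
    using exch_side_new[OF E_sym[OF pq] d c] exch_sym[of E p q c d] by simp
  have cdE: "(c, d) \<in> ?E" by (simp add: exch_def)
  have "p \<notin> ?S" "c \<notin> ?S" using not_both[OF pq] c side_self[of p E q] by blast+
  then have "?E \<inter> ?S \<times> ?S = E \<inter> ?S \<times> ?S" by (auto simp: exch_def)
  then show ?thesis using E'.cav_restrict[OF cdE, of a b w] cav_restrict[OF pq a b, of w] a b S by simp
qed

text \<open>A vertex \<open>w\<close> on the side of \<open>a\<close> cannot separate new branch
  vertices, since all of them except \<open>c\<close> lie together behind \<open>d\<close>. For
  \<open>w\<close> on the side of \<open>b\<close>, the branch vertex \<open>c\<close> can be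
  replaced by \<open>d\<close>, and within that side separation is the same in both trees. If
  \<open>d\<close> was no branch vertex, \<open>core_between\<close> still admits it.\<close>

lemma core_exch:
  assumes ab: "(a, b) \<in> E" and c: "c \<in> side E a b" and d: "d \<in> side E b a"
    and M: "\<And>x. deg (exch E a b c d) x \<ge> 3 \<Longrightarrow> x \<in> side E a b \<Longrightarrow> x = c"
    and S: "\<And>x. deg (exch E a b c d) x \<ge> 3 \<Longrightarrow> x \<in> side E b a \<Longrightarrow> deg E x \<ge> 3 \<or> x = d"
    and alt: "d \<in> core E \<or> (\<forall>x. deg (exch E a b c d) x \<ge> 3 \<longrightarrow> x \<in> side E b a \<and> deg E x \<ge> 3)"
  shows "core (exch E a b c d) \<subseteq> core E"
proof
  let ?E = "exch E a b c d" and ?M = "side E a b" and ?S = "side E b a"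
  fix w assume w: "w \<in> core ?E"
  interpret E': utree V ?E by (rule utree.intro[OF tree_exch[OF ab c d]])
  have wV: "w \<in> V" by (rule E'.core_in_V[OF w])
  obtain x y where xy: "deg ?E x \<ge> 3" "deg ?E y \<ge> 3" "x \<noteq> w" "y \<noteq> w" "\<not> cav ?E w x y"
    using w by (auto simp: core_def)
  have MS: "z \<in> ?M \<or> z \<in> ?S" if "z \<in> V" for z using side_compl[OF ab that] by blast
  have xV: "x \<in> V" "y \<in> V" using xy E'.deg_pos_in_V by auto
  have cdE: "(c, d) \<in> ?E" by (simp add: exch_def)
  have dcE: "(d, c) \<in> ?E" by (simp add: exch_def)
  have newS: "side ?E d c = ?S"
    using exch_side_new[OF E_sym[OF ab] d c] exch_sym[of E a b c d] by simp
  show "w \<in> core E"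
  proof (cases "w \<in> ?M")
    case True
    then have wS: "w \<notin> side ?E d c" using newS not_both[OF ab] by blast
    have S': "z = c \<or> z \<in> side ?E d c" if "deg ?E z \<ge> 3" "z \<in> V" for z
      using MS[OF that(2)] M[OF that(1)] newS by blast
    have "cav ?E w d z" if z: "z = c \<or> z \<in> side ?E d c" "z \<noteq> w" for z
    proof (cases "z = c")
      case True
      then show ?thesis using dcE wS z by (auto intro: cav_edge)
    next
      case False
      then show ?thesis using z E'.cav_within[OF side_self _ wS] by blast
    qed
    then have "cav ?E w x y" using S' xy xV E'.cav_sym cav_trans by metis
    then show ?thesis using xy by blast
  next
    case False
    then have wS: "w \<in> ?S" using MS wV by blast
    show ?thesis
    proof (cases "w = d \<and> d \<in> core E")
      case False
      \<comment> \<open>Each branch vertex of the new tree is traded for a vertex on the side of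
        \<open>b\<close> that \<open>w\<close> does not separate from it. Only \<open>c\<close> has
        to move, namely to \<open>d\<close>.\<close>
      have key: "\<exists>z'. z' \<in> ?S \<and> z' \<noteq> w \<and> (deg E z' \<ge> 3 \<or> z' = d \<and> d \<in> core E) \<and> cav ?E w z z'"
        if z: "deg ?E z \<ge> 3" "z \<in> V" "z \<noteq> w" for z
      proof (cases "z \<in> ?S")
        case True
        then have "deg E z \<ge> 3 \<or> z = d \<and> d \<in> core E" using S[OF z(1) True] alt z(1) by blast
        then show ?thesis using True z by (intro exI[of _ z]) simp
      next
        case zS: False
        then have "z = c" using MS[OF z(2)] M[OF z(1)] by blast
        moreover have dc: "d \<in> core E" using alt z(1) zS by blast
        moreover have "d \<noteq> w" using False dc by blast
        ultimately show ?thesis using cdE z d by (intro exI[of _ d]) (auto intro: cav_edge)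
      qed
      obtain x' where x': "x' \<in> ?S" "x' \<noteq> w" "deg E x' \<ge> 3 \<or> x' = d \<and> d \<in> core E" "cav ?E w x x'"
        using key[OF xy(1) xV(1) xy(3)] by blast
      obtain y' where y': "y' \<in> ?S" "y' \<noteq> w" "deg E y' \<ge> 3 \<or> y' = d \<and> d \<in> core E" "cav ?E w y y'"
        using key[OF xy(2) xV(2) xy(4)] by blast
      have "\<not> cav ?E w x' y'" using xy(5) x'(4) y'(4) cav_trans E'.cav_sym by metis
      then have nc: "\<not> cav E w x' y'" using cav_exch[OF ab c d x'(1) y'(1)] by blast
      consider "deg E x' \<ge> 3" "deg E y' \<ge> 3" | "x' = d" "d \<in> core E" "deg E y' \<ge> 3"
        | "y' = d" "d \<in> core E" "deg E x' \<ge> 3" | "x' = y'" using x'(3) y'(3) by blast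
      then show ?thesis
      proof cases
        case 1
        then show ?thesis using nc x'(2) y'(2) unfolding core_def by blast
      next
        case 2
        then show ?thesis using core_between[OF 2(2) _ wV 2(3) y'(2)] nc x'(2) by blast
      next
        case 3
        have "\<not> cav E w y' x'" using nc cav_sym by blast
        then show ?thesis using core_between[OF 3(2) _ wV 3(3) x'(2)] 3(1) y'(2) by blast
      next
        case 4
        then show ?thesis using nc by simp
      qed
    qed blast
  qed
qed

section \<open>Pendant paths and stem leaves\<close>

lemma pend_not_core:
  assumes "pend E m b" "v \<in> side E m b" shows "v \<notin> core E"
proof
  assume "v \<in> core E"
  then obtain x y where xy: "deg E x \<ge> 3" "deg E y \<ge> 3" "\<not> cav E v x y" by (auto simp: core_def)
  have mb: "(m, b) \<in> E" using assms by (simp add: pend_def)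
  have "z \<in> side E b m" if "deg E z \<ge> 3" for z
  proof -
    have "z \<in> V" using deg_pos_in_V that by simp
    moreover have "z \<notin> side E m b" using assms(1) that unfolding pend_def by fastforce
    ultimately show ?thesis using side_compl[OF mb] by blast
  qed
  moreover have "v \<notin> side E b m" using not_both[OF mb] assms(2) by blast
  ultimately show False using cav_within xy by blast
qed

text \<open>All branch vertices lie in one direction from \<open>v\<close>, as \<open>v\<close>
  separates no two of them. Walk in that direction to the first one; nothing of degree 3 is left
  behind it.\<close>

lemma noncore_in_pend:
  assumes "v \<in> V" "v \<notin> core E" "deg E v \<le> 2" "deg E a \<ge> 3"
  shows "\<exists>m b. pend E m b \<and> deg E b \<ge> 3 \<and> v \<in> side E m b"
proof -
  have "a \<in> V" "a \<noteq> v" using assms(3,4) deg_pos_in_V by auto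
  then obtain n where n: "(n, v) \<in> E" "a \<in> side E n v" using obtain_dir[OF assms(1)] by metis
  from nearest[OF n(1)] n(2) assms(4) obtain b m where b: "deg E b \<ge> 3" "(m, b) \<in> E" "v \<in> side E m b"
    "\<forall>z \<in> side E n v - side E b m. deg E z = 2" by blast
  have "deg E z \<le> 2" if z: "z \<in> side E m b" for z
  proof (rule ccontr)
    assume "\<not> deg E z \<le> 2"
    then have z3: "deg E z \<ge> 3" by simp
    have "z \<notin> side E b m" using not_both[OF b(2)] z by blast
    then have "z \<notin> side E n v" using b(4) z3 by force
    moreover have "z \<noteq> v" using z3 assms(3) by auto
    ultimately show False using coreI[OF n _ _ assms(4) z3] assms(2) by blast
  qed
  then show ?thesis using b by (auto simp: pend_def)
qed

lemma ends_pend: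
  assumes "v \<in> ends E" "(n, v) \<in> E" "\<not> pend E n v" "(m, v) \<in> E" "m \<noteq> n"
  shows "pend E m v"
proof (rule ccontr)
  assume "\<not> pend E m v"
  then obtain a where a: "a \<in> side E m v" "deg E a \<ge> 3" using assms(4) unfolding pend_def by force
  obtain b where b: "b \<in> side E n v" "deg E b \<ge> 3" using assms(2,3) unfolding pend_def by force
  have "b \<notin> side E m v" using dir_unique[OF assms(4,2)] b assms(5) by blast
  moreover have "b \<noteq> v" using b not_self_side[OF assms(2)] by blast
  ultimately show False using coreI[OF assms(4) a(1) _ _ a(2) b(2)] assms(1) by (auto simp: ends_def)
qed

lemma branch_not_in_pend: "pend E m v \<Longrightarrow> deg E x \<ge> 3 \<Longrightarrow> x \<notin> side E m v"
  unfolding pend_def by fastforce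

lemma pend_disjoint:
  assumes "pend E m v" "pend E n w" "deg E v \<ge> 3" "deg E w \<ge> 3" "u \<in> side E m v" "u \<in> side E n w"
  shows "m = n \<and> v = w"
proof -
  have mn: "(m, v) \<in> E" "(n, w) \<in> E" using assms by (auto simp: pend_def)
  have "v = w" using beyond_antisym[OF mn assms(5,6)] branch_not_in_pend assms by blast
  then show ?thesis using dir_unique[OF mn(1), of n u] mn assms by blast
qed

definition pends :: "'a \<Rightarrow> 'a set" where
  "pends v = {m. pend E m v}"

lemma pends_sub: "pends v \<subseteq> E `` {v}"
  using E_sym by (auto simp: pends_def pend_def)

lemma fin_pends [simp]: "finite (pends v)"
  by (rule finite_subset[OF pends_sub]) simp

lemma ends_card_pends:
  assumes "v \<in> ends E" shows "deg E v \<le> card (pends v) + 1"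
proof (cases "\<exists>n. (n, v) \<in> E \<and> \<not> pend E n v")
  case True
  then obtain n where n: "(n, v) \<in> E" "\<not> pend E n v" by blast
  have "E `` {v} - {n} \<subseteq> pends v"
    using ends_pend[OF assms n] E_sym by (auto simp: pends_def)
  then have "card (E `` {v} - {n}) \<le> card (pends v)" by (intro card_mono) auto
  moreover have "card (E `` {v}) \<le> card (E `` {v} - {n}) + 1"
    using card_Suc_Diff1[of "E `` {v}" n] by (cases "n \<in> E `` {v}") auto
  ultimately show ?thesis by (simp add: deg_def)
next
  case False
  then have "E `` {v} \<subseteq> pends v" using E_sym by (auto simp: pends_def)
  then have "card (E `` {v}) \<le> card (pends v)" by (intro card_mono) auto
  then show ?thesis by (simp add: deg_def)
qed

lemma branches_fin: "finite {v. deg E v \<ge> 3}"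
  by (rule finite_subset[OF _ finV]) (use deg_pos_in_V in auto)

text \<open>Each pendant path contains a leaf, and different pendant paths are disjoint.\<close>

lemma sum_pends_le: "(\<Sum>v | deg E v \<ge> 3. card (pends v)) \<le> card (tleaves E)"
proof -
  let ?P = "Sigma {v. deg E v \<ge> 3} pends"
  have fl: "finite (tleaves E)"
    by (rule finite_subset[OF _ finV]) (use deg_pos_in_V in \<open>auto simp: tleaves_def\<close>)
  have "\<exists>u. u \<in> tleaves E \<and> u \<in> side E m v" if "m \<in> pends v" for m v
    using pendant_list[of m v] that by (auto simp: pends_def pend_def)
  then have "\<forall>z\<in>?P. \<exists>u. u \<in> tleaves E \<and> u \<in> side E (snd z) (fst z)" by auto
  from bchoice[OF this] obtain g where g': "\<forall>z\<in>?P. g z \<in> tleaves E \<and> g z \<in> side E (snd z) (fst z)" by (rule exE)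
  have g: "g z \<in> tleaves E \<and> g z \<in> side E (snd z) (fst z)" if "z \<in> ?P" for z by (rule bspec[OF g' that])
  have "inj_on g ?P"
  proof (rule inj_onI)
    fix y z assume y: "y \<in> ?P" and z: "z \<in> ?P" and eq: "g y = g z"
    have "pend E (snd y) (fst y)" "pend E (snd z) (fst z)" "deg E (fst y) \<ge> 3" "deg E (fst z) \<ge> 3"
      using y z by (auto simp: pends_def)
    then have "snd y = snd z \<and> fst y = fst z" using pend_disjoint g[OF y] g[OF z] eq by metis
    then show "y = z" by (simp add: prod_eq_iff)
  qed
  then have "card ?P \<le> card (tleaves E)" using card_inj_on_le[of g ?P "tleaves E"] g fl by blast
  then show ?thesis using card_SigmaI[OF branches_fin, of pends] by simp
qed

end

section \<open>The tight case: every spanning tree has more than k stem leaves\<close>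

locale many_ends = k14_graph +
  fixes k :: nat
  assumes k3: "k \<ge> 3" and many: "sptree E \<Longrightarrow> k + 1 \<le> card (ends E)"
begin

text \<open>A stem leaf has degree at least 3 and at most one non-pendant direction, hence two
  pendant paths. With at least \<open>k + 1\<close> stem leaves and at most \<open>2 * k + 2\<close>
  leaves, all these inequalities are equalities, and no pendant path is left for other branch
  vertices.\<close>

lemma ends_count:
  assumes "sptree E"
  shows "2 * card (ends E) \<le> card (tleaves E)"
    and "card (tleaves E) \<le> 2 * k + 2 \<Longrightarrow> card (ends E) = k + 1"
    and "card (tleaves E) \<le> 2 * k + 2 \<Longrightarrow> v \<in> ends E \<Longrightarrow> card (utree.pends E v) = 2"
    and "card (tleaves E) \<le> 2 * k + 2 \<Longrightarrow> deg E v \<ge> 3 \<Longrightarrow> v \<notin> ends E \<Longrightarrow> utree.pends E v = {}"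
proof -
  interpret utree V E by (rule sptree_utree[OF assms])
  let ?B = "{v. deg E v \<ge> 3}"
  have sub: "ends E \<subseteq> ?B" by (auto simp: ends_def)
  have fe: "finite (ends E)" by (rule finite_subset[OF sub branches_fin])
  have two: "2 \<le> card (pends v)" if "v \<in> ends E" for v
    using ends_card_pends[OF that] that by (simp add: ends_def)
  have split: "(\<Sum>v\<in>?B. card (pends v)) = (\<Sum>v\<in>ends E. card (pends v)) + (\<Sum>v\<in>?B - ends E. card (pends v))"
    by (subst sum.subset_diff[OF sub branches_fin]) simp
  have "(\<Sum>v\<in>ends E. 2) \<le> (\<Sum>v\<in>ends E. card (pends v))" by (rule sum_mono) (rule two)
  then have 1: "2 * card (ends E) \<le> (\<Sum>v\<in>ends E. card (pends v))" by simp
  then show "2 * card (ends E) \<le> card (tleaves E)" using split sum_pends_le by simp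
  have m: "k + 1 \<le> card (ends E)" by (rule many[OF assms])
  { assume le: "card (tleaves E) \<le> 2 * k + 2"
    show "card (ends E) = k + 1" using 1 split sum_pends_le m le by simp
    have eq: "(\<Sum>v\<in>ends E. card (pends v)) = 2 * card (ends E)" and z: "(\<Sum>v\<in>?B - ends E. card (pends v)) = 0"
      using 1 split sum_pends_le m le by auto
    { assume v: "v \<in> ends E"
      have "(\<Sum>v\<in>ends E. card (pends v)) = card (pends v) + (\<Sum>v\<in>ends E - {v}. card (pends v))"
        by (rule sum.remove[OF fe v])
      moreover have "(\<Sum>v\<in>ends E - {v}. 2) \<le> (\<Sum>v\<in>ends E - {v}. card (pends v))"
        by (rule sum_mono) (use two in auto)
      moreover have "card (ends E - {v}) = card (ends E) - 1" using v by simp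
      moreover have "card (ends E) \<ge> 1" using m by simp
      ultimately show "card (pends v) = 2" using eq two[OF v] by simp }
    { assume "deg E v \<ge> 3" "v \<notin> ends E"
      then have "card (pends v) = 0" using z branches_fin by simp
      then show "pends v = {}" by simp } }
qed

sublocale min_leaf_graph V A "2 * k + 2"
proof
  show "2 * k + 2 \<le> card (tleaves E)" if "sptree E" for E
    using ends_count(1)[OF that] many[OF that] by simp
  show "4 \<le> 2 * k + 2" using k3 by simp
qed

lemma card_ends: "opt E \<Longrightarrow> card (ends E) = k + 1"
  using ends_count(2)[OF opt_sptree] opt_card by simp

text \<open>The rigidity behind most contradictions below: in an \<open>opt\<close> tree no branch
  vertex with a pendant path can have degree 4 or lie in the core.\<close>

lemma pend_ends:
  assumes "opt E" "pend E m v" "deg E v \<ge> 3"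
  shows "v \<in> ends E" "deg E v = 3" "v \<notin> core E"
proof -
  interpret utree V E by (rule opt_utree[OF assms(1)])
  have le: "card (tleaves E) \<le> 2 * k + 2" using opt_card[OF assms(1)] by simp
  have "m \<in> pends v" using assms by (simp add: pends_def)
  then show v: "v \<in> ends E" using ends_count(4)[OF opt_sptree[OF assms(1)] le assms(3)] by blast
  show "deg E v = 3" using ends_count(3)[OF opt_sptree[OF assms(1)] le v] ends_card_pends[OF v] assms(3) by simp
  show "v \<notin> core E" using v by (simp add: ends_def)
qed

lemma ends_two:
  assumes "opt E" "v \<in> ends E"
  obtains m n where "m \<noteq> n" "pend E m v" "pend E n v" "{m. pend E m v} = {m, n}"
proof -
  interpret utree V E by (rule opt_utree[OF assms(1)])
  have "card (pends v) = 2" using ends_count(3)[OF opt_sptree[OF assms(1)] _ assms(2)] opt_card[OF assms(1)] by simp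
  then obtain m n where "pends v = {m, n}" "m \<noteq> n" by (auto simp: card_2_iff)
  then show ?thesis using that[of m n] unfolding pends_def by blast
qed

lemma ends_deg: "opt E \<Longrightarrow> v \<in> ends E \<Longrightarrow> deg E v = 3"
  using ends_two pend_ends(2) unfolding ends_def by (metis (no_types, lifting) mem_Collect_eq)

lemma other_end:
  assumes "opt E" "finite X" "card X \<le> k" obtains y where "y \<in> ends E" "y \<notin> X"
proof -
  have "\<not> ends E \<subseteq> X"
  proof
    assume "ends E \<subseteq> X"
    then have "card (ends E) \<le> card X" by (rule card_mono[OF assms(2)])
    then show False using card_ends[OF assms(1)] assms(3) by simp
  qed
  then show ?thesis using that by blast
qed

section \<open>Non-adjacency of leaves, arms and inner stem vertices\<close>

definition copt :: "('a \<times> 'a) set \<Rightarrow> bool" where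
  "copt E \<longleftrightarrow> opt E \<and> (\<forall>E'. opt E' \<longrightarrow> card (core E) \<le> card (core E'))"

lemma copt_opt: "copt E \<Longrightarrow> opt E"
  by (simp add: copt_def)

lemma fin_core: "opt E \<Longrightarrow> finite (core E)"
  using finite_subset[OF _ finV] utree.core_in_V[OF opt_utree] by blast

lemma copt_exch:
  assumes "copt E" "opt E'" "core E' \<subseteq> core E" shows "copt E'" "core E' = core E"
proof -
  have le: "card (core E) \<le> card (core E')" using assms(1,2) by (simp add: copt_def)
  show "core E' = core E" by (rule card_seteq[OF fin_core[OF copt_opt[OF assms(1)]] assms(3) le])
  then show "copt E'" using assms(1,2) by (simp add: copt_def)
qed

text \<open>The pendant path of \<open>u\<close> is cut off at \<open>b\<close> and attached to
  \<open>v\<close> by its other end. It becomes a pendant path of \<open>v\<close>, traversed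
  backwards, with \<open>m\<close> as its leaf.\<close>

lemma hang:
  assumes "opt E" "u \<in> tleaves E" "pend E m b" "u \<in> side E m b" "deg E b \<ge> 3" "v \<in> side E b m" "(u, v) \<in> A"
  shows "opt (exch E m b u v)"
    and "deg (exch E m b u v) x = deg E x - (if x = m \<or> x = b then 1 else 0) + (if x = u \<or> x = v then 1 else 0)"
    and "v \<noteq> b \<Longrightarrow> pend (exch E m b u v) u v" "deg E v \<ge> 2"
proof -
  interpret utree V E by (rule opt_utree[OF assms(1)])
  let ?E = "exch E m b u v"
  have mb: "(m, b) \<in> E" using assms by (simp add: pend_def)
  have d: "deg ?E x = deg E x - (if x = m \<or> x = b then 1 else 0) + (if x = u \<or> x = v then 1 else 0)" for x
    by (rule deg_exch[OF mb assms(4,6)])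
  then show "deg ?E x = deg E x - (if x = m \<or> x = b then 1 else 0) + (if x = u \<or> x = v then 1 else 0)" .
  have E': "sptree ?E" by (rule sptree_exch[OF opt_sptree[OF assms(1)] mb assms(4,6,7)])
  have one: "deg E u = 1" using assms by (simp add: tleaves_def)
  show v2: "deg E v \<ge> 2" by (rule nonleaf_nbr[OF assms(1,2,7)])
  have "v \<noteq> m" using assms(6) not_self_side[OF E_sym[OF mb]] by blast
  moreover have "u \<noteq> b" using one assms(5) by auto
  ultimately have "tleaves ?E \<subseteq> tleaves E - {u} \<union> {m}"
    using one v2 assms(5) by (auto simp: tleaves_def d split: if_splits)
  then show "opt ?E" by (rule opt_replace(1)[OF assms(1) E' _ assms(2)])
  have "side ?E u v = side E m b" by (rule exch_side_new[OF mb assms(4,6)])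
  moreover have "deg ?E x \<le> 2" if "x \<in> side E m b" for x
  proof -
    have "x \<noteq> v" using that not_both[OF mb] assms(6) by blast
    moreover have "deg E x \<le> 2" using assms(3) that by (simp add: pend_def)
    ultimately show ?thesis using one by (auto simp: d)
  qed
  ultimately show "pend ?E u v" unfolding pend_def by (simp add: exch_def)
qed

text \<open>Hanging the path of \<open>u\<close> on \<open>v\<close> makes \<open>v\<close> a branch
  vertex with a pendant path, so \<open>v\<close> leaves the core. Since \<open>v\<close> was in the
  core, \<open>core_exch\<close> adds nothing to it, and the core would shrink, against
  minimality.\<close>

lemma leaf_core:
  assumes "copt E" "u \<in> tleaves E" "v \<in> core E" shows "(u, v) \<notin> A"
proof
  assume uv: "(u, v) \<in> A"
  have opt: "opt E" by (rule copt_opt[OF assms(1)])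
  interpret utree V E by (rule opt_utree[OF opt])
  obtain b m where b: "deg E b \<ge> 3" "(m, b) \<in> E" "u \<in> side E m b" "\<And>x. x \<in> side E m b \<Longrightarrow> deg E x \<le> 2"
    using nearest_branch[OF opt assms(2)] by metis
  then have p: "pend E m b" by (simp add: pend_def)
  have vb: "v \<noteq> b" using pend_ends(3)[OF opt p b(1)] assms(3) by blast
  have vm: "v \<notin> side E m b" using pend_not_core[OF p] assms(3) by blast
  have v: "v \<in> side E b m" by (rule side_compl[OF b(2) core_in_V[OF assms(3)] vm])
  note h = hang[OF opt assms(2) p b(3,1) v uv]
  let ?E = "exch E m b u v"
  have "v \<noteq> m" using vm by auto
  then have "deg ?E v \<ge> 3" using h(2)[of v] h(4) vb by simp
  then have vc: "v \<notin> core ?E" using pend_ends(3)[OF h(1) h(3)[OF vb]] by blast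
  have one: "deg E u = 1" using assms by (simp add: tleaves_def)
  have "core ?E \<subseteq> core E"
  proof (rule core_exch[OF b(2,3) v])
    fix x assume x: "deg ?E x \<ge> 3"
    { assume xm: "x \<in> side E m b"
      then have "x \<noteq> v" using vm by blast
      then have False using h(2)[of x] x b(4)[OF xm] one by (auto split: if_splits)
      then show "x = u" ..
    next
      assume "x \<in> side E b m"
      show "deg E x \<ge> 3 \<or> x = v" using h(2)[of x] x one by (auto split: if_splits) }
  qed (use assms(3) in simp)
  then have "core ?E = core E" by (rule copt_exch(2)[OF assms(1) h(1)])
  then show False using vc assms(3) by simp
qed

lemma pend_exch:
  assumes "pend E m x" "a \<notin> side E m x" "b \<notin> side E m x" "c \<notin> side E m x" "d \<notin> side E m x"
    and "\<And>y. y \<noteq> c \<Longrightarrow> y \<noteq> d \<Longrightarrow> deg (exch E a b c d) y \<le> deg E y"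
  shows "pend (exch E a b c d) m x"
proof -
  have eq: "side (exch E a b c d) m x = side E m x" by (rule side_exch_eq) (use assms in auto)
  have "m \<in> side E m x" by simp
  then have "(m, x) \<in> exch E a b c d" using assms by (auto simp: exch_def pend_def)
  moreover have "deg (exch E a b c d) y \<le> 2" if "y \<in> side E m x" for y
  proof -
    have "y \<noteq> c" "y \<noteq> d" using that assms by blast+
    then have "deg (exch E a b c d) y \<le> deg E y" by (rule assms(6))
    also have "deg E y \<le> 2" using assms(1) that by (simp add: pend_def)
    finally show ?thesis .
  qed
  ultimately show ?thesis unfolding pend_def eq by blast
qed

text \<open>Hang the path of \<open>u\<close> on \<open>v\<close>. If \<open>v = x\<close>, then
  \<open>x\<close> gets degree 4. Otherwise \<open>v\<close> becomes a branch vertex, while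
  \<open>x\<close> keeps degree 3 and its other pendant path; so \<open>x\<close> is outside the
  core, although it separates \<open>v\<close> from the remaining stem leaves.\<close>

lemma leaf_far_arm:
  assumes "opt E" "u \<in> tleaves E" "pend E m b" "u \<in> side E m b" "deg E b \<ge> 3"
    and "x \<in> ends E" "x \<noteq> b" "v \<in> arm E x"
  shows "(u, v) \<notin> A"
proof
  assume uv: "(u, v) \<in> A"
  interpret utree V E by (rule opt_utree[OF assms(1)])
  have mb: "(m, b) \<in> E" using assms(3) by (simp add: pend_def)
  have x3: "deg E x = 3" by (rule ends_deg[OF assms(1,6)])
  have vV: "v \<in> V" using uv A_sub by blast
  have arm_dis: "z \<notin> side E m b" if "pend E n x" "z \<in> side E n x" for z n
    using pend_disjoint[OF assms(3) that(1) assms(5), of z] x3 that(2) assms(7) by auto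
  have "v \<notin> side E m b"
    using assms(8) arm_dis branch_not_in_pend[OF assms(3), of x] x3 by (auto simp: arm_def)
  then have v: "v \<in> side E b m" by (rule side_compl[OF mb vV])
  have vb: "v \<noteq> b" using assms(5,7,8) branch_not_in_pend by (auto simp: arm_def)
  have vm: "v \<noteq> m" using \<open>v \<notin> side E m b\<close> by auto
  note h = hang[OF assms(1-5) v uv]
  let ?E = "exch E m b u v"
  have one: "deg E u = 1" using assms(2) by (simp add: tleaves_def)
  have m2: "deg E m \<le> 2" using assms(3) side_self[of m E b] by (auto simp: pend_def)
  show False
  proof (cases "v = x")
    case True
    then have "deg ?E v = 4" using h(2)[of v] x3 vb vm by simp
    then show False using pend_ends(2)[OF h(1) h(3)[OF vb]] by simp
  next
    case False
    then obtain n where n: "pend E n x" "v \<in> side E n x" using assms(8) by (auto simp: arm_def)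
    obtain n2 where n2: "pend E n2 x" "n2 \<noteq> n" using ends_two[OF assms(1,6)] by metis
    have edges: "(n, x) \<in> E" "(n2, x) \<in> E" using n n2 by (auto simp: pend_def)
    have v2: "deg E v = 2" using h(4) n unfolding pend_def by fastforce
    have "pend ?E n2 x"
    proof (rule pend_exch[OF n2(1)])
      show "m \<notin> side E n2 x" using arm_dis[OF n2(1)] side_self[of m E b] by blast
      show "u \<notin> side E n2 x" using arm_dis[OF n2(1)] assms(4) by blast
      show "b \<notin> side E n2 x" using branch_not_in_pend[OF n2(1) assms(5)] .
      show "v \<notin> side E n2 x" using dir_unique[OF edges n(2)] n2(2) by blast
    qed (simp add: h(2))
    moreover have xm: "x \<noteq> m" "x \<noteq> u" using x3 m2 one by auto
    then have "deg ?E x = 3" using h(2)[of x] x3 assms(7) False by simp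
    ultimately have xc: "x \<notin> core ?E" using pend_ends(3)[OF h(1)] by simp
    \<comment> \<open>\<open>b\<close> has lost an edge, so a stem leaf different from
      \<open>x\<close> and \<open>b\<close> is taken, which is still a branch vertex.\<close>
    have "card {x, b} \<le> k" using k3 card_insert_le_m1[of 2 "{b}" x] by simp
    then obtain y where y: "y \<in> ends E" "y \<notin> {x, b}" using other_end[OF assms(1), of "{x, b}"] by blast
    have y3: "deg E y = 3" by (rule ends_deg[OF assms(1) y(1)])
    have ym: "y \<noteq> m" using y3 m2 by auto
    have "deg ?E y \<ge> 3" using h(2)[of y] y3 ym y by simp
    moreover have "deg ?E v \<ge> 3" using h(2)[of v] v2 vb vm by simp
    ultimately have "cav ?E x v y" using xc False y unfolding core_def by blast
    moreover have "y \<notin> side E m b" using branch_not_in_pend[OF assms(3)] y3 by simp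
    then have "y \<in> side E b m" using side_compl[OF mb, of y] deg_pos_in_V y3 by simp
    ultimately have "cav E x v y" using cav_exch[OF mb assms(4) v v] by blast
    then have "y \<in> side E n x" using cav_side[OF edges(1) n(2)] by blast
    then show False using branch_not_in_pend[OF n(1)] y3 by simp
  qed
qed

lemma arm_not_core:
  assumes "opt E" "x \<in> ends E" "v \<in> arm E x" shows "v \<notin> core E"
  using assms utree.pend_not_core[OF opt_utree[OF assms(1)]] by (auto simp: arm_def ends_def)

text \<open>Exchange \<open>wb\<close> for \<open>wv\<close>. By \<open>leaf_core\<close> the vertex
  \<open>v\<close> is no leaf, so the leaves stay the same. Then argue as in
  \<open>leaf_far_arm\<close>: either \<open>x\<close> gets degree 4, or it stays a stem leaf and
  yet separates the new branch vertex \<open>v\<close> from others.\<close>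

lemma core_far_arm:
  assumes "copt E" "(w, b) \<in> E" "w \<in> core E" "b \<in> core E" "deg E b \<ge> 3"
    and "x \<in> ends E" "x \<in> side E b w" "v \<in> arm E x"
  shows "(w, v) \<notin> A"
proof
  assume wv: "(w, v) \<in> A"
  have opt: "opt E" by (rule copt_opt[OF assms(1)])
  interpret utree V E by (rule opt_utree[OF opt])
  have x3: "deg E x = 3" by (rule ends_deg[OF opt assms(6)])
  have xc: "x \<notin> core E" using assms(6) by (simp add: ends_def)
  have wn: "w \<notin> side E m x" if "pend E m x" for m using pend_not_core[OF that] assms(3) by blast
  have bn: "b \<notin> side E m x" if "pend E m x" for m using pend_not_core[OF that] assms(4) by blast
  have bw: "(b, w) \<in> E" using assms(2) E_sym by blast
  have arm_in: "z \<in> side E b w" if p: "pend E m x" "z \<in> side E m x" for z m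
    using p(2)
  proof (induct rule: side_induct)
    case self
    have "(x, m) \<in> E" using p(1) E_sym by (simp add: pend_def)
    moreover have "m \<noteq> w" using wn[OF p(1)] by auto
    ultimately show ?case by (rule side_step'[OF bw assms(7)])
  next
    case (step y z)
    have "z \<noteq> w" using step(6) wn[OF p(1)] by blast
    then show ?case by (rule side_step'[OF bw step(2,3)])
  qed
  have v: "v \<in> side E b w" using assms(7,8) arm_in by (auto simp: arm_def)
  have vc: "v \<notin> core E" by (rule arm_not_core[OF opt assms(6,8)])
  have vb: "v \<noteq> b" "v \<noteq> w" "x \<noteq> b" "x \<noteq> w" using vc xc assms by auto
  have "v \<notin> tleaves E" using leaf_core[OF assms(1) _ assms(3)] wv A_sym by blast
  moreover have "deg E v \<ge> 1" using deg_pos[OF opt] wv A_sub by blast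
  ultimately have v2: "deg E v \<ge> 2" by (simp add: tleaves_def)
  let ?E = "exch E w b w v"
  have wb: "w \<noteq> b" using E_irrefl assms(2) by blast
  have w1: "deg E w \<ge> 1" using core_deg[OF assms(3)] by simp
  have d: "deg ?E y = deg E y - (if y = b then 1 else 0) + (if y = v then 1 else 0)" for y
    using deg_exch[OF assms(2) side_self v, of y] wb vb w1 by auto
  have E': "sptree ?E" by (rule sptree_exch[OF opt_sptree[OF opt] assms(2) side_self v wv])
  have "tleaves ?E \<subseteq> tleaves E" using v2 assms(5) vb by (auto simp: tleaves_def d split: if_splits)
  then have opt': "opt ?E" by (rule opt_same(1)[OF opt E'])
  have pe: "pend ?E m x" if "pend E m x" "v \<notin> side E m x" for m
    by (rule pend_exch[OF that(1)]) (use wn[OF that(1)] bn[OF that(1)] that in \<open>auto simp: d\<close>)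
  obtain m0 where m0: "pend E m0 x" using ends_two[OF opt assms(6)] by metis
  show False
  proof (cases "v = x")
    case True
    then have "v \<notin> side E m0 x" using m0 not_self_side by (auto simp: pend_def)
    moreover have "deg ?E x = 4" using d[of x] x3 True vb by simp
    ultimately show False using pend_ends(2)[OF opt' pe[OF m0]] by simp
  next
    case False
    then obtain n where n: "pend E n x" "v \<in> side E n x" using assms(8) by (auto simp: arm_def)
    obtain n2 where n2: "pend E n2 x" "n2 \<noteq> n" using ends_two[OF opt assms(6)] by metis
    have edges: "(n, x) \<in> E" "(n2, x) \<in> E" using n n2 by (auto simp: pend_def)
    have "v \<notin> side E n2 x" using dir_unique[OF edges n(2)] n2(2) by blast
    moreover have "deg ?E x = 3" using d[of x] x3 False vb by simp
    ultimately have xc': "x \<notin> core ?E" using pend_ends(3)[OF opt' pe[OF n2(1)]] by simp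
    have bV: "b \<in> V" "x \<in> V" using E_verts assms(2) edges by blast+
    obtain nx where nx: "(nx, b) \<in> E" "x \<in> side E nx b" using obtain_dir[OF bV vb(3)] .
    \<comment> \<open>\<open>b\<close> may have dropped to degree 2, so the separated branch vertex
      is sought behind a third neighbour of \<open>b\<close>. It exists because no pendant path
      starts at a branch vertex of the core.\<close>
    obtain n3 where n3: "(b, n3) \<in> E" "n3 \<noteq> w" "n3 \<noteq> nx" using deg_ge_3_other[OF assms(5)] by metis
    have n3b: "(n3, b) \<in> E" using n3 E_sym by blast
    have "\<not> pend E n3 b" using pend_ends(3)[OF opt _ assms(5)] assms(4) by blast
    then obtain a where a: "a \<in> side E n3 b" "deg E a \<ge> 3" using n3b unfolding pend_def by force
    have ab: "a \<noteq> b" using a(1) not_self_side[OF n3b] by blast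
    have ax: "a \<noteq> x" using dir_unique[OF n3b nx(1) a(1)] nx(2) n3(3) by blast
    have aS: "a \<in> side E b w" using nbr_side_disj[OF n3b assms(2) n3(2)] a(1) by blast
    have v2_: "deg ?E v \<ge> 3" using d[of v] v2 vb by simp
    have "deg ?E a \<ge> 3" using d[of a] a ab by simp
    then have "cav ?E x v a" using xc' False ax v2_ unfolding core_def by blast
    then have "cav E x v a" using cav_exch[OF assms(2) side_self v v aS] by blast
    then have "a \<in> side E n x" using cav_side[OF edges(1) n(2)] by blast
    then show False using branch_not_in_pend[OF n(1) a(2)] by blast
  qed
qed

text \<open>The branch vertex \<open>b\<close> can spare the edge \<open>xb\<close>. Replacing it by
  \<open>xy\<close> would give the stem leaf \<open>y\<close> degree 4.\<close>

lemma ends_indep: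
  assumes "opt E" "(x, b) \<in> E" "x \<in> ends E" "deg E b \<ge> 3" "y \<in> ends E" "y \<noteq> x" "y \<noteq> b"
  shows "(x, y) \<notin> A"
proof
  assume xy: "(x, y) \<in> A"
  interpret utree V E by (rule opt_utree[OF assms(1)])
  have bx: "(b, x) \<in> E" using assms(2) E_sym by blast
  have y3: "deg E y = 3" and x3: "deg E x = 3" using ends_deg[OF assms(1)] assms by auto
  have np: "\<not> pend E b x" using branch_not_in_pend assms(4) side_self[of b E x] by blast
  have "y \<notin> side E x b"
  proof
    assume "y \<in> side E x b"
    then obtain m where m: "m \<in> E `` {x} - {b}" "y \<in> side E m x" using side_split[OF assms(2)] assms(6) by blast
    then have "pend E m x" using ends_pend[OF assms(3) bx np, of m] E_sym by blast
    then show False using branch_not_in_pend m(2) y3 by simp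
  qed
  then have y: "y \<in> side E b x" using side_compl[OF assms(2)] deg_pos_in_V y3 by simp
  let ?E = "exch E x b x y"
  have xb: "x \<noteq> b" using E_irrefl assms(2) by blast
  have d: "deg ?E z = deg E z - (if z = b then 1 else 0) + (if z = y then 1 else 0)" for z
    using deg_exch[OF assms(2) side_self y, of z] xb assms(6) x3 by auto
  have E': "sptree ?E" by (rule sptree_exch[OF opt_sptree[OF assms(1)] assms(2) side_self y xy])
  have "tleaves ?E \<subseteq> tleaves E" using y3 assms(4,7) by (auto simp: tleaves_def d split: if_splits)
  then have opt': "opt ?E" by (rule opt_same(1)[OF assms(1) E'])
  obtain m where m: "pend E m y" using ends_two[OF assms(1,5)] by metis
  have "pend ?E m y"
    by (rule pend_exch[OF m]) (use branch_not_in_pend[OF m] x3 y3 assms(4) in \<open>auto simp: d\<close>)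
  moreover have "deg ?E y = 4" using d[of y] y3 assms(7) by simp
  ultimately show False using pend_ends(2)[OF opt', of m y] by simp
qed

section \<open>Choosing the inner stem vertex w\<close>

text \<open>No pendant path starts at \<open>b\<close>, so a branch vertex lies behind
  \<open>n\<close>. If \<open>n\<close> had degree at most 2 it would separate that vertex from
  \<open>b\<close>; so \<open>n\<close> is a stem leaf, and all its directions other than
  \<open>b\<close> are pendant.\<close>

lemma noncore_nbr:
  assumes "opt E" "b \<in> core E" "deg E b \<ge> 3" "(n, b) \<in> E" "n \<notin> core E"
  shows "n \<in> ends E" "\<And>y. y \<in> side E n b \<Longrightarrow> deg E y \<ge> 3 \<Longrightarrow> y = n"
proof -
  interpret utree V E by (rule opt_utree[OF assms(1)])
  have bn: "(b, n) \<in> E" using assms(4) E_sym by blast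
  have "\<not> pend E n b" using pend_ends(3)[OF assms(1) _ assms(3)] assms(2) by blast
  then obtain a where a: "a \<in> side E n b" "deg E a \<ge> 3" using assms(4) unfolding pend_def by force
  have "deg E n \<ge> 3"
  proof (rule ccontr)
    assume "\<not> deg E n \<ge> 3"
    then have "a \<noteq> n" using a by blast
    then obtain m where m: "m \<in> E `` {n} - {b}" "a \<in> side E m n" using side_split[OF assms(4)] a(1) by blast
    have mn: "(m, n) \<in> E" using m E_sym by blast
    have "b \<notin> side E m n" using dir_unique[OF mn bn, of b] m side_self[of b E n] by blast
    moreover have "b \<noteq> n" using E_irrefl bn by blast
    ultimately show False using coreI[OF mn m(2) _ _ a(2) assms(3)] assms(5) by blast
  qed
  then show n: "n \<in> ends E" using assms(5) by (simp add: ends_def)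
  have np: "\<not> pend E b n" using branch_not_in_pend assms(3) side_self[of b E n] by blast
  fix y assume y: "y \<in> side E n b" "deg E y \<ge> 3"
  show "y = n"
  proof (rule ccontr)
    assume "y \<noteq> n"
    then obtain m where m: "m \<in> E `` {n} - {b}" "y \<in> side E m n" using side_split[OF assms(4)] y(1) by blast
    then have "pend E m n" using ends_pend[OF n bn np, of m] E_sym by blast
    then show False using branch_not_in_pend m(2) y(2) by blast
  qed
qed

text \<open>By \<open>core_far_arm\<close>, \<open>w\<close> has no neighbours on the arms behind
  \<open>b\<close>. Only the stem leaves in \<open>side E w b\<close> matter, and there should be
  few of them.\<close>

definition good :: "('a \<times> 'a) set \<Rightarrow> 'a \<Rightarrow> 'a \<Rightarrow> bool" where
  "good E w b \<longleftrightarrow> copt E \<and> (w, b) \<in> E \<and> w \<in> core E \<and> b \<in> core E \<and> deg E b \<ge> 3"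

text \<open>Let \<open>b\<close> be the branch vertex nearest to a stem leaf \<open>x\<close> in its
  non-pendant direction. Were \<open>b\<close> a stem leaf too, these two would be the only ones. If
  no tree neighbour of \<open>b\<close> were in the core, all stem leaves would be neighbours of
  \<open>b\<close>; there are at least four, and \<open>ends_indep\<close> would yield a
  K_{1,4}.\<close>

lemma good_exists:
  assumes "copt E" shows "\<exists>w b. good E w b"
proof -
  have opt: "opt E" by (rule copt_opt[OF assms])
  interpret utree V E by (rule opt_utree[OF opt])
  obtain x where x: "x \<in> ends E" using other_end[OF opt, of "{}"] by auto
  obtain y where y: "y \<in> ends E" "y \<noteq> x" using other_end[OF opt, of "{x}"] k3 by auto
  have x3: "deg E x \<ge> 3" and y3: "deg E y \<ge> 3" using x y by (auto simp: ends_def)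
  obtain n where n: "(n, x) \<in> E" "y \<in> side E n x" using obtain_dir[of x y] deg_pos_in_V x3 y3 y by auto
  have np: "\<not> pend E n x" using branch_not_in_pend n y3 by blast
  from nearest[OF n(1)] n y3 obtain b m where b: "deg E b \<ge> 3" "(m, b) \<in> E" "x \<in> side E m b"
    "b \<in> side E n x" "\<forall>z \<in> side E n x - side E b m. deg E z = 2" by blast
  have np': "\<not> pend E m b" using branch_not_in_pend b(3) x3 by blast
  have bc: "b \<in> core E"
  proof (rule ccontr)
    assume "b \<notin> core E"
    then have be: "b \<in> ends E" using b by (simp add: ends_def)
    have "z \<in> {x, b}" if z: "z \<in> ends E" for z
    proof (rule ccontr)
      assume ne: "z \<notin> {x, b}"
      have z3: "deg E z \<ge> 3" using z by (simp add: ends_def)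
      have zV: "z \<in> V" "x \<in> V" "b \<in> V" using deg_pos_in_V z3 x3 b(1) by auto
      obtain r where r: "(r, x) \<in> E" "z \<in> side E r x" using obtain_dir[OF zV(2,1)] ne by blast
      have "r = n"
        using ends_pend[OF x n(1) np r(1)] branch_not_in_pend r(2) z3 by blast
      moreover have "deg E z \<noteq> 2" using z3 by simp
      ultimately have "z \<in> side E b m" using b(5) r(2) by blast
      then have "z \<notin> side E m b" using not_both[OF b(2)] by blast
      obtain s where s: "(s, b) \<in> E" "z \<in> side E s b" using obtain_dir[OF zV(3,1)] ne by blast
      have "s = m"
        using ends_pend[OF be b(2) np' s(1)] branch_not_in_pend s(2) z3 by blast
      then show False using s \<open>z \<notin> side E m b\<close> by blast
    qed
    then have "card (ends E) \<le> card {x, b}" by (intro card_mono) auto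
    also have "\<dots> \<le> 2" by (rule card_insert_le_m1) auto
    finally show False using card_ends[OF opt] k3 by simp
  qed
  show ?thesis
  proof (rule ccontr)
    assume ng: "\<not> ?thesis"
    then have nc: "n \<notin> core E" if "(n, b) \<in> E" for n
      using that assms bc b(1) unfolding good_def by blast
    have sub: "ends E \<subseteq> E `` {b}"
    proof
      fix z assume z: "z \<in> ends E"
      then have z3: "deg E z \<ge> 3" and zb: "z \<noteq> b" using bc by (auto simp: ends_def)
      obtain s where s: "(s, b) \<in> E" "z \<in> side E s b" using obtain_dir[of b z] deg_pos_in_V z3 b(1) zb by auto
      have "z = s" using noncore_nbr(2)[OF opt bc b(1) s(1) nc[OF s(1)] s(2) z3] .
      then show "z \<in> E `` {b}" using s E_sym by blast
    qed
    have "4 \<le> card (ends E)" using card_ends[OF opt] k3 by simp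
    then obtain T where T: "T \<subseteq> ends E" "card T = 4" by (rule obtain_subset_with_card_n)
    then obtain p q r s where t: "T = {p, q, r, s}" "distinct [p, q, r, s]"
      by (auto simp: card_Suc_eq numeral_eq_Suc)
    have l: "z \<in> ends E \<and> (z, b) \<in> E \<and> (b, z) \<in> A" if "z \<in> T" for z
      using that T sub opt_A[OF opt] E_sym by blast
    have "(z, z') \<notin> A" if "z \<in> T" "z' \<in> T" "z \<noteq> z'" for z z'
      using ends_indep[OF opt, of z b z'] l[OF that(1)] l[OF that(2)] that(3) b(1) bc by (auto simp: ends_def)
    then show False using K14[of b p q r s] l t by auto
  qed
qed

text \<open>
  Otherwise at least three stem leaves are adjacent, in the tree, to the first branch vertex \<open>b2\<close> behind
  \<open>w\<close>. By \<open>K\<^sub>1\<^sub>,\<^sub>4\<close>-freeness one of them can be moved from \<open>b2\<close> to the tree neighbour \<open>m2\<close>, which makes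
  \<open>side E b2 m2\<close> smaller.
\<close>

lemma good_few:
  assumes "good E w b" and min: "\<And>E' w' b'. good E' w' b' \<Longrightarrow> card (side E w b) \<le> card (side E' w' b')"
  shows "card (ends E \<inter> side E w b) \<le> 2"
proof -
  have copt: "copt E" and wb: "(w, b) \<in> E" and wc: "w \<in> core E" and bc: "b \<in> core E" and b3: "deg E b \<ge> 3"
    using assms(1) by (auto simp: good_def)
  have opt: "opt E" by (rule copt_opt[OF copt])
  interpret utree V E by (rule opt_utree[OF opt])
  obtain m a where m: "(m, w) \<in> E" "m \<noteq> b" "a \<in> side E m w" "deg E a \<ge> 3" by (rule core_other_branch[OF wc])
  have "a \<in> side E w b" using nbr_side_disj[OF m(1) E_sym[OF wb] m(2)] m(3) by blast
  then have ex: "\<exists>x\<in>side E w b. deg E x \<ge> 3" using m(4) by blast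
  from nearest[OF wb ex] obtain b2 m2 where b2: "deg E b2 \<ge> 3" "(m2, b2) \<in> E" "b \<in> side E m2 b2"
    "b2 \<in> side E w b" "side E b2 m2 \<subseteq> side E w b" "\<forall>x \<in> side E w b - side E b2 m2. deg E x = 2" by blast
  have np: "\<not> pend E m2 b2" using branch_not_in_pend b2(3) b3 by blast
  have fs: "finite (side E w b)" by (rule fin_side[OF wb])
  have dir: "\<exists>n. (n, b2) \<in> E \<and> n \<noteq> m2 \<and> y \<in> side E n b2" if y: "y \<in> ends E \<inter> side E w b" "y \<noteq> b2" for y
  proof -
    have "deg E y \<ge> 3" using y by (simp add: ends_def)
    then have "deg E y \<noteq> 2" by simp
    then have "y \<in> side E b2 m2" using b2(6) y by blast
    then obtain n where "n \<in> E `` {b2} - {m2}" "y \<in> side E n b2"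
      using side_split[OF E_sym[OF b2(2)]] y(2) by blast
    then show ?thesis using E_sym by blast
  qed
  show ?thesis
  proof (cases "b2 \<in> core E")
    case False
    then have be: "b2 \<in> ends E" using b2 by (simp add: ends_def)
    have "ends E \<inter> side E w b \<subseteq> {b2}"
    proof
      fix y assume y: "y \<in> ends E \<inter> side E w b"
      show "y \<in> {b2}"
      proof (rule ccontr)
        assume "y \<notin> {b2}"
        then obtain n where n: "(n, b2) \<in> E" "n \<noteq> m2" "y \<in> side E n b2" using dir[OF y] by blast
        have "pend E n b2" by (rule ends_pend[OF be b2(2) np n(1,2)])
        then show False using branch_not_in_pend n(3) y by (auto simp: ends_def)
      qed
    qed
    then have "card (ends E \<inter> side E w b) \<le> card {b2}" by (intro card_mono) auto
    then show ?thesis by simp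
  next
    case b2c: True
    \<comment> \<open>Otherwise \<open>(n, b2)\<close> would be a good pair with a smaller
      side.\<close>
    have inner: "n \<notin> core E" if n: "(n, b2) \<in> E" "n \<noteq> m2" for n
    proof
      assume "n \<in> core E"
      then have "good E n b2" using copt n b2c b2(1) by (simp add: good_def)
      moreover have "side E n b2 \<subset> side E b2 m2" by (rule card_side_less[OF E_sym[OF b2(2)] n])
      then have "card (side E n b2) < card (side E w b)" using b2(5) fs by (meson psubset_card_mono psubset_subset_trans)
      ultimately show False using min[of E n b2] by simp
    qed
    have sub: "ends E \<inter> side E w b \<subseteq> E `` {b2} - {m2}"
    proof
      fix y assume y: "y \<in> ends E \<inter> side E w b"
      then have y3: "deg E y \<ge> 3" "y \<noteq> b2" using b2c by (auto simp: ends_def)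
      obtain n where n: "(n, b2) \<in> E" "n \<noteq> m2" "y \<in> side E n b2" using dir[OF y y3(2)] by blast
      have "y = n" by (rule noncore_nbr(2)[OF opt b2c b2(1) n(1) inner[OF n(1,2)] n(3) y3(1)])
      then show "y \<in> E `` {b2} - {m2}" using n E_sym by blast
    qed
    show ?thesis
    proof (cases "card (E `` {b2} - {m2}) \<le> 2")
      case True
      have "card (ends E \<inter> side E w b) \<le> card (E `` {b2} - {m2})" by (rule card_mono[OF _ sub]) simp
      then show ?thesis using True by simp
    next
      case False
      then have "3 \<le> card (E `` {b2} - {m2})" by simp
      then obtain T where T: "T \<subseteq> E `` {b2} - {m2}" "card T = 3" by (rule obtain_subset_with_card_n)
      then obtain p q r where t: "T = {p, q, r}" "distinct [p, q, r]"
        by (auto simp: card_Suc_eq numeral_eq_Suc)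
      have l: "(z, b2) \<in> E \<and> (b2, z) \<in> E \<and> z \<noteq> m2 \<and> z \<in> ends E \<and> (b2, z) \<in> A" if "z \<in> T" for z
        using that T noncore_nbr(1)[OF opt b2c b2(1), of z] inner[of z] opt_A[OF opt] E_sym by blast
      have ind: "(z, z') \<notin> A" if "z \<in> T" "z' \<in> T" "z \<noteq> z'" for z z'
        using ends_indep[OF opt, of z b2 z'] l[OF that(1)] l[OF that(2)] that(3) b2(1) b2c by (auto simp: ends_def)
      have "(b2, m2) \<in> A" using b2(2) opt_A[OF opt] E_sym by blast
      then have "(m2, p) \<in> A \<or> (m2, q) \<in> A \<or> (m2, r) \<in> A"
        using K14[of b2 m2 p q r] l[of p] l[of q] l[of r] ind t by auto
      then obtain x where x: "x \<in> T" "(m2, x) \<in> A" using t by blast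
      have xb: "(x, b2) \<in> E" "(b2, x) \<in> E" "x \<noteq> m2" "x \<in> ends E" using l[OF x(1)] by blast+
      have m2s: "m2 \<in> side E b2 x" using nbr_side_disj[OF b2(2) xb(1)] xb(3) side_self[of m2 E b2] by blast
      have m2b2: "m2 \<noteq> b2" using E_irrefl b2(2) by blast
      note s = slide[OF opt xb(2) b2(1) m2s m2b2 x(2)]
      let ?E = "exch E b2 x m2 x"
      have E_eq: "?E = exch E x b2 x m2" by (rule exch_sym)
      have m2c: "m2 \<in> core E"
      proof (cases "m2 = b")
        case False
        then obtain r where r: "r \<in> E `` {m2} - {b2}" "b \<in> side E r m2"
          using side_split[OF b2(2)] b2(3) by auto
        have rm: "(r, m2) \<in> E" using r E_sym by blast
        have "b2 \<notin> side E r m2"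
          using dir_unique[OF rm E_sym[OF b2(2)], of b2] r side_self[of b2 E m2] by blast
        then show ?thesis using coreI[OF rm r(2) _ _ b3 b2(1)] m2b2 by blast
      qed (use bc in simp)
      have Mx: "y = x" if "y \<in> side E x b2" "deg E y \<ge> 3" for y
        by (rule noncore_nbr(2)[OF opt b2c b2(1) xb(1) inner[OF xb(1,3)] that])
      have m2n: "m2 \<notin> side E x b2" using m2s not_both[OF xb(1)] by blast
      \<comment> \<open>The exchange is read from the side of \<open>x\<close>: there
        \<open>x\<close> is the only branch vertex, and \<open>m2\<close>, to which it is attached,
        is in the core already.\<close>
      have "core ?E \<subseteq> core E"
        unfolding E_eq
      proof (rule core_exch[OF xb(1) side_self m2s])
        fix y assume y: "deg (exch E x b2 x m2) y \<ge> 3"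
        then have y': "deg E y \<ge> 3 \<or> y = m2" using s(4)[of y] by (auto simp: E_eq split: if_splits)
        then show "deg E y \<ge> 3 \<or> y = m2" .
        assume "y \<in> side E x b2"
        then show "y = x" using y' Mx m2n by blast
      qed (use m2c in simp)
      note c = copt_exch[OF copt s(1) this]
      have "deg ?E m2 \<ge> 3" using s(3) s(4)[of m2] m2b2 by simp
      moreover have "(b2, m2) \<in> ?E" using b2(2) E_sym xb(3) m2b2 by (simp add: exch_def)
      ultimately have "good ?E b2 m2" using c m2c b2c by (simp add: good_def)
      moreover have "card (side ?E b2 m2) < card (side E w b)"
      proof (rule psubset_card_mono[OF fs])
        have b2m: "(b2, m2) \<in> E" using b2(2) E_sym by blast
        have "side ?E b2 m2 \<subseteq> side E b2 m2 - side E x b2"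
        proof (rule side_subset)
          show "b2 \<in> side E b2 m2 - side E x b2" using not_self_side[OF xb(1)] by simp
          fix y z assume y: "y \<in> side E b2 m2 - side E x b2" and yz: "(y, z) \<in> ?E"
            and ne: "(y, z) \<noteq> (b2, m2)" "(y, z) \<noteq> (m2, b2)"
          have "y \<noteq> m2" using y not_self_side[OF b2(2)[THEN E_sym]] by blast
          moreover have "y \<noteq> x" using y by auto
          ultimately have yz': "(y, z) \<in> E" "(y, z) \<noteq> (b2, x)" "(y, z) \<noteq> (x, b2)" using yz by (auto simp: exch_def)
          have "z \<in> side E b2 m2" using side_step[OF _ yz'(1) ne] y by blast
          moreover have "z \<notin> side E x b2"
          proof
            assume z: "z \<in> side E x b2"
            have "y \<in> side E b2 x" using side_compl[OF xb(1)] y E_verts(1)[OF yz'(1)] by blast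
            then show False using cross[OF xb(2) _ z yz'(1)] yz'(2) by blast
          qed
          ultimately show "z \<in> side E b2 m2 - side E x b2" by blast
        qed
        moreover have "x \<in> side E b2 m2" using side_step'[OF b2m side_self xb(2,3)] .
        ultimately show "side ?E b2 m2 \<subset> side E w b" using b2(5) side_self[of x E b2] by blast
      qed
      ultimately show ?thesis using min[of ?E b2 m2] by simp
    qed
  qed
qed

lemma good_pair:
  assumes "opt E0"
  obtains E w b where "good E w b" "card (ends E \<inter> side E w b) \<le> 2"
proof -
  obtain E1 where E1: "opt E1" "\<And>E'. opt E' \<Longrightarrow> card (core E1) \<le> card (core E')"
    using ex_has_least_nat[of opt E0 "\<lambda>E. card (core E)"] assms by blast
  then have "copt E1" by (simp add: copt_def)
  then obtain w1 b1 where g: "good E1 w1 b1" using good_exists by blast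
  let ?P = "\<lambda>(E, w, b). good E w b" and ?f = "\<lambda>(E, w, b). card (side E w b)"
  obtain z where z: "?P z" "\<And>y. ?P y \<Longrightarrow> ?f z \<le> ?f y"
    using ex_has_least_nat[of ?P "(E1, w1, b1)" ?f] g by blast
  obtain E w b where "z = (E, w, b)" by (cases z)
  then have "good E w b" "\<And>E' w' b'. good E' w' b' \<Longrightarrow> card (side E w b) \<le> card (side E' w' b')"
    using z by auto
  then show ?thesis using good_few that by blast
qed

end

section \<open>Neighbours along an arm\<close>

text \<open>
  For position \<open>i\<close> on an arm, \<open>b i\<close> and \<open>c i\<close> will mean that it is adjacent to the last vertex of the arm
  and to \<open>w\<close>, respectively, and \<open>a i\<close> that position \<open>i + 1\<close> is adjacent to the first vertex of the arm.
\<close>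

lemma run_count:
  fixes a b c :: "nat \<Rightarrow> bool"
  assumes ab: "\<And>i. a i \<Longrightarrow> \<not> b i" and ac: "\<And>i. a i \<Longrightarrow> \<not> c i" and bc: "\<And>i. b i \<Longrightarrow> \<not> c (Suc i)"
    and crossing: "\<And>i j. c i \<Longrightarrow> i \<le> j \<Longrightarrow> (\<And>t. i \<le> t \<Longrightarrow> t \<le> j \<Longrightarrow> b t) \<Longrightarrow> \<not> a (Suc j)"
    and last: "\<And>i. Suc i = m \<Longrightarrow> \<not> b i"
  shows "(\<Sum>i<m. of_bool (a i) + of_bool (b i) + of_bool (c i)) \<le> m"
proof -
  \<comment> \<open>Only a position with both \<open>b\<close> and \<open>c\<close> counts 2. It
    opens a run, a debt of one that lasts while \<open>b\<close> holds. Within a run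
    \<open>bc\<close> and \<open>crossing\<close> exclude \<open>c\<close> and \<open>a\<close>, so
    the first position without \<open>b\<close> counts 0 and settles the debt; \<open>last\<close>
    ensures that this happens before \<open>m\<close>.\<close>
  define run where "run i \<longleftrightarrow> (\<exists>j<i. c j \<and> (\<forall>t. j \<le> t \<and> t < i \<longrightarrow> b t))" for i
  let ?f = "\<lambda>i. of_bool (a i) + of_bool (b i) + of_bool (c i) :: nat"
  have le: "(\<Sum>i<n. ?f i) \<le> n + of_bool (run n)" for n
  proof (induction n)
    case (Suc n)
    show ?case
    proof (cases "run n")
      case True
      then obtain j where j: "j < n" "c j" "\<And>t. j \<le> t \<Longrightarrow> t < n \<Longrightarrow> b t" by (auto simp: run_def)
      then obtain n' where n': "n = Suc n'" "j \<le> n'" by (cases n) auto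
      have "\<not> c n" using bc[of n'] j(3)[of n'] n' by simp
      moreover have "\<not> a n" using crossing[OF j(2) n'(2)] j(3) n' by simp
      moreover have "run (Suc n)" if "b n"
        unfolding run_def using j that by (intro exI[of _ j]) (auto simp: less_Suc_eq)
      ultimately show ?thesis using Suc.IH True by auto
    next
      case False
      have "run (Suc n)" if "b n" "c n"
        unfolding run_def using that by (intro exI[of _ n]) (auto simp: less_Suc_eq)
      then show ?thesis using Suc.IH False ab[of n] ac[of n] by auto
    qed
  qed simp
  have "\<not> run m"
  proof
    assume "run m"
    then obtain j where "j < m" "\<forall>t. j \<le> t \<and> t < m \<longrightarrow> b t" by (auto simp: run_def)
    then show False using last[of "m - 1"] by (cases m) auto
  qed
  then show ?thesis using le[of m] by simp
qed

lemma sum_of_bool_nth: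
  assumes "distinct p"
  shows "(\<Sum>i<length p. of_bool (P (p ! i))) = card {y \<in> set p. P y}"
proof -
  have "bij_betw (\<lambda>i. p ! i) {..<length p} (set p)" using bij_betw_nth[OF assms] by blast
  then have "(\<Sum>i<length p. of_bool (P (p ! i))) = (\<Sum>y\<in>set p. of_bool (P y) :: nat)"
    by (rule sum.reindex_bij_betw)
  also have "\<dots> = card {y \<in> set p. P y}" by (simp add: of_bool_def sum.If_cases Int_def)
  finally show ?thesis by simp
qed

text \<open>A form of an arm that is preserved by rotations: it makes no reference to pendant
  paths.\<close>

definition arm_list :: "('a \<times> 'a) set \<Rightarrow> 'a \<Rightarrow> 'a list \<Rightarrow> bool" where
  "arm_list E x p \<longleftrightarrow> distinct p \<and> successively (\<lambda>a b. (a, b) \<in> E) p \<and> x \<in> set p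
    \<and> hd p \<in> tleaves E \<and> last p \<in> tleaves E \<and> hd p \<noteq> last p \<and> (\<forall>z\<in>set p - {x}. deg E z \<le> 2)"

lemma arm_list_edge: "arm_list E x p \<Longrightarrow> Suc i < length p \<Longrightarrow> (p ! i, p ! Suc i) \<in> E"
  by (auto simp: arm_list_def successively_conv_nth)

lemma arm_list_nth_eq: "arm_list E x p \<Longrightarrow> i < length p \<Longrightarrow> j < length p \<Longrightarrow> p ! i = p ! j \<longleftrightarrow> i = j"
  by (simp add: arm_list_def nth_eq_iff_index_eq)

lemma arm_list_ne: "arm_list E x p \<Longrightarrow> p \<noteq> []"
  by (auto simp: arm_list_def)

lemma arm_list_hd: "arm_list E x p \<Longrightarrow> hd p = p ! 0" and arm_list_last: "arm_list E x p \<Longrightarrow> last p = p ! (length p - 1)"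
  using arm_list_ne[of E x p] by (auto simp: hd_conv_nth last_conv_nth)

context utree begin

lemma arm_list_rev:
  assumes "arm_list E x p" shows "arm_list E x (rev p)"
proof -
  have ne: "p \<noteq> []" using assms by (auto simp: arm_list_def)
  have "successively (\<lambda>a b. (a, b) \<in> E) (rev p)"
    unfolding successively_rev
    by (rule successively_mono[of "\<lambda>a b. (a, b) \<in> E"]) (use assms E_sym in \<open>auto simp: arm_list_def\<close>)
  then show ?thesis using assms ne by (auto simp: arm_list_def hd_rev last_rev)
qed

lemma arm_list_side:
  assumes "arm_list E x p" "Suc i < length p" "j \<le> i"
  shows "p ! j \<in> side E (p ! i) (p ! Suc i)"
  using assms(3)
proof (induction j rule: inc_induct)
  case (step n)
  have "(p ! Suc n, p ! n) \<in> E" using arm_list_edge[OF assms(1), of n] step assms(2) E_sym by simp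
  moreover have "p ! n \<noteq> p ! Suc i" using arm_list_nth_eq[OF assms(1), of n "Suc i"] step assms(2) by simp
  ultimately show ?case by (rule side_step'[OF arm_list_edge[OF assms(1,2)] step.IH])
qed simp

text \<open>Away from \<open>x\<close> all tree edges at a listed vertex run along the list, so an
  initial segment without \<open>x\<close> has no exit other than its last edge.\<close>

lemma arm_list_closed:
  assumes "arm_list E x p" "Suc i < length p" "x \<notin> set (take (Suc i) p)"
  shows "side E (p ! i) (p ! Suc i) \<subseteq> set (take (Suc i) p)"
proof -
  have Q: "set (take (Suc i) p) = (\<lambda>j. p ! j) ` {..i}"
    using nth_image[of "Suc i" p] assms(2) by (simp add: lessThan_Suc_atMost atLeast0LessThan)
  show ?thesis
  proof (rule side_subset)
    show "p ! i \<in> set (take (Suc i) p)" unfolding Q by simp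
    fix z y assume z: "z \<in> set (take (Suc i) p)" and zy: "(z, y) \<in> E" and ne: "(z, y) \<noteq> (p ! i, p ! Suc i)"
    obtain j where j: "j \<le> i" "z = p ! j" using z Q by auto
    have next_: "(z, p ! Suc j) \<in> E" using arm_list_edge[OF assms(1), of j] j assms(2) by simp
    have ok: "p ! Suc j \<in> set (take (Suc i) p)" if "y = p ! Suc j"
    proof -
      have "j \<noteq> i" using ne that j by auto
      then show ?thesis using j unfolding Q by auto
    qed
    show "y \<in> set (take (Suc i) p)"
    proof (cases j)
      case 0
      then have "deg E z = 1" using assms(1) j arm_list_hd[OF assms(1)] by (simp add: arm_list_def tleaves_def)
      then have "y = p ! Suc j" using deg_eq_1[OF next_] zy by auto
      then show ?thesis using ok by simp
    next
      case (Suc j')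
      have "z \<in> set p - {x}" using z assms(3) in_set_takeD by fastforce
      then have "deg E z \<le> 2" using assms(1) by (simp add: arm_list_def)
      moreover have "(z, p ! j') \<in> E" using arm_list_edge[OF assms(1), of j'] j Suc assms(2) E_sym by simp
      moreover have "p ! j' \<noteq> p ! Suc j" using arm_list_nth_eq[OF assms(1), of j' "Suc j"] Suc j assms(2) by simp
      ultimately have "E `` {z} = {p ! j', p ! Suc j}" using deg_le_2_nbr next_ by blast
      then have "y = p ! j' \<or> y = p ! Suc j" using zy by auto
      moreover have "p ! j' \<in> set (take (Suc i) p)" using Suc j unfolding Q by auto
      ultimately show ?thesis using ok by auto
    qed
  qed
qed

end

section \<open>Rotations of an arm\<close>

context many_ends begin

lemma arm_list_exists:
  assumes "opt E" "x \<in> ends E"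
  obtains p where "arm_list E x p" "set p = arm E x" "tleaves E \<inter> arm E x = {hd p, last p}"
proof -
  interpret utree V E by (rule opt_utree[OF assms(1)])
  obtain m n where mn: "m \<noteq> n" "pend E m x" "pend E n x" "{m. pend E m x} = {m, n}"
    by (rule ends_two[OF assms])
  have edges: "(m, x) \<in> E" "(n, x) \<in> E" using mn by (auto simp: pend_def)
  obtain l1 where l1: "l1 \<noteq> []" "hd l1 = m" "distinct l1" "set l1 = side E m x"
    "successively (\<lambda>x y. (x, y) \<in> E) l1" "tleaves E \<inter> side E m x = {last l1}"
    using pendant_list[OF edges(1)] mn(2) unfolding pend_def by blast
  obtain l2 where l2: "l2 \<noteq> []" "hd l2 = n" "distinct l2" "set l2 = side E n x"
    "successively (\<lambda>x y. (x, y) \<in> E) l2" "tleaves E \<inter> side E n x = {last l2}"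
    using pendant_list[OF edges(2)] mn(3) unfolding pend_def by blast
  let ?p = "rev l1 @ x # l2"
  have disj: "side E m x \<inter> side E n x = {}" using dir_unique[OF edges] mn(1) by blast
  have x: "x \<notin> side E m x" "x \<notin> side E n x" using not_self_side edges by auto
  have s: "set ?p = arm E x" using l1 l2 mn(4) by (auto simp: arm_def)
  have h: "hd ?p = last l1" "last ?p = last l2" using l1(1) l2(1) by (auto simp: hd_rev)
  have x3: "deg E x = 3" by (rule ends_deg[OF assms])
  have "successively (\<lambda>a b. (a, b) \<in> E) (rev l1)"
    unfolding successively_rev
    by (rule successively_mono[of "\<lambda>a b. (a, b) \<in> E"]) (use l1 E_sym in auto)
  then have succ: "successively (\<lambda>a b. (a, b) \<in> E) ?p"
    using l1 l2 edges E_sym by (auto simp: successively_append_iff successively_Cons last_rev)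
  have dist: "distinct ?p" using l1 l2 disj x by auto
  have lf: "last l1 \<in> tleaves E" "last l2 \<in> tleaves E" "last l1 \<in> side E m x" "last l2 \<in> side E n x"
    using l1(6) l2(6) by blast+
  have xl: "x \<notin> tleaves E" using x3 by (simp add: tleaves_def)
  have tl: "tleaves E \<inter> arm E x = {last l1, last l2}"
  proof -
    have "arm E x = {x} \<union> (side E m x \<union> side E n x)" using mn(4) by (simp add: arm_def)
    then have "tleaves E \<inter> arm E x = (tleaves E \<inter> side E m x) \<union> (tleaves E \<inter> side E n x)" using xl by auto
    then show ?thesis unfolding l1(6) l2(6) by auto
  qed
  have d: "deg E z \<le> 2" if "z \<in> set ?p - {x}" for z
    using that l1(4) l2(4) mn(2,3) unfolding pend_def by auto
  have "arm_list E x ?p" unfolding arm_list_def h using dist succ lf d disj by auto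
  then show ?thesis using that[of ?p] s tl h by simp
qed

text \<open>A Posa rotation: the initial segment is reversed and \<open>p ! i\<close> becomes the
  leaf. The segment without \<open>x\<close> is a whole side and holds no branch vertex of the new
  tree, so \<open>core_exch\<close> applies from that side and the tree stays optimal.\<close>

lemma rotate:
  assumes "copt E" "arm_list E x p" "Suc i < length p" "(hd p, p ! Suc i) \<in> A"
  defines "E' \<equiv> exch E (p ! i) (p ! Suc i) (hd p) (p ! Suc i)"
    and "p' \<equiv> rev (take (Suc i) p) @ drop (Suc i) p"
  shows "copt E'" "core E' = core E" "arm_list E' x p'" "tleaves E' = tleaves E - {hd p} \<union> {p ! i}"
proof -
  have opt: "opt E" by (rule copt_opt[OF assms(1)])
  interpret utree V E by (rule opt_utree[OF opt])
  let ?u = "hd p" and ?q = "p ! i" and ?v = "p ! Suc i"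
  have qv: "(?q, ?v) \<in> E" by (rule arm_list_edge[OF assms(2,3)])
  have vq: "(?v, ?q) \<in> E" by (rule E_sym[OF qv])
  have ul: "?u \<in> tleaves E" using assms(2) by (simp add: arm_list_def)
  have us: "?u \<in> side E ?q ?v" using arm_list_side[OF assms(2,3), of 0] arm_list_hd[OF assms(2)] by simp
  note s = swap[OF opt ul assms(4) qv us]
  show tl: "tleaves E' = tleaves E - {hd p} \<union> {p ! i}" using s(3) by (simp add: E'_def)
  have opt': "opt E'" using s(2) by (simp add: E'_def)
  have one: "deg E ?u = 1" using ul by (simp add: tleaves_def)
  have d0: "deg E' y = deg E y - (if y = ?q \<or> y = ?v then 1 else 0) + (if y = ?u \<or> y = ?v then 1 else 0)" for y
    unfolding E'_def by (rule deg_exch[OF qv us side_self])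
  have v1: "deg E ?v \<ge> 1" by (rule deg_ge_1[OF vq])
  have d: "deg E' y \<le> (if y = ?u then 2 else deg E y)" for y
    using d0[of y] one v1 by auto
  have d3: "deg E y \<ge> 3" if "deg E' y \<ge> 3" for y using d[of y] that by (auto split: if_splits)
  have len: "length p > 0" using assms(3) by linarith
  have eq: "E' = exch E ?v ?q ?v ?u" unfolding E'_def by (rule exch_sym)
  have branch_p: "y = x" if "y \<in> set p" "deg E y \<ge> 3" for y
  proof (rule ccontr)
    assume "y \<noteq> x"
    then have "deg E y \<le> 2" using that(1) assms(2) unfolding arm_list_def by blast
    then show False using that(2) by simp
  qed
  have "core E' \<subseteq> core E"
  proof (cases "x \<in> set (take (Suc i) p)")
    case False
    have no: "y \<notin> side E ?q ?v" if "deg E' y \<ge> 3" for y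
    proof
      assume "y \<in> side E ?q ?v"
      then have y: "y \<in> set (take (Suc i) p)" using arm_list_closed[OF assms(2,3) False] by blast
      then have "y \<in> set p" by (rule in_set_takeD)
      then show False using branch_p d3[OF that] y False by blast
    qed
    have "y \<in> side E ?v ?q" if "deg E' y \<ge> 3" for y
      using side_compl[OF qv _ no[OF that]] deg_pos_in_V[of y] d3[OF that] by simp
    then show ?thesis unfolding E'_def using no d3 unfolding E'_def
      by (intro core_exch[OF qv us side_self]) blast+
  next
    case True
    have "distinct p" using assms(2) by (simp add: arm_list_def)
    then have xd: "x \<notin> set (drop (Suc i) p)"
      using True set_take_disj_set_drop_if_distinct[of p "Suc i" "Suc i"] by auto
    define i' where "i' = length p - 2 - i"
    have i': "Suc i' < length p" "rev p ! i' = ?v" "rev p ! Suc i' = ?q" "take (Suc i') (rev p) = rev (drop (Suc i) p)"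
      using assms(3) by (auto simp: i'_def rev_nth take_rev Suc_diff_Suc numeral_2_eq_2)
    have cl: "side E ?v ?q \<subseteq> set (drop (Suc i) p)"
      using arm_list_closed[OF arm_list_rev[OF assms(2)], of i'] i' xd by simp
    have no: "y \<notin> side E ?v ?q" if "deg E' y \<ge> 3" for y
    proof
      assume "y \<in> side E ?v ?q"
      then have y: "y \<in> set (drop (Suc i) p)" using cl by blast
      then have "y \<in> set p" by (rule in_set_dropD)
      then show False using branch_p d3[OF that] y xd by blast
    qed
    have "y \<in> side E ?q ?v" if "deg E' y \<ge> 3" for y
      using side_compl[OF vq _ no[OF that]] deg_pos_in_V[of y] d3[OF that] by simp
    then show ?thesis unfolding eq using no d3 unfolding eq
      by (intro core_exch[OF vq side_self us]) blast+
  qed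
  then show "copt E'" "core E' = core E" using copt_exch[OF assms(1) opt'] by blast+
  have uE': "(?u, ?v) \<in> E'" by (simp add: E'_def exch_def)
  have symE': "(y, z) \<in> E' \<Longrightarrow> (z, y) \<in> E'" for y z
    by (rule utree.E_sym[OF opt_utree[OF opt']])
  have keep: "(p ! j, p ! Suc j) \<in> E'" if "Suc j < length p" "j \<noteq> i" for j
  proof -
    have "(p ! j, p ! Suc j) \<in> E" by (rule arm_list_edge[OF assms(2) that(1)])
    moreover have "p ! j \<noteq> p ! i" using arm_list_nth_eq[OF assms(2), of j i] that assms(3) by simp
    moreover have "\<not> (p ! j = p ! Suc i \<and> p ! Suc j = p ! i)"
      using arm_list_nth_eq[OF assms(2), of j "Suc i"] arm_list_nth_eq[OF assms(2), of "Suc j" i] that assms(3) by auto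
    ultimately show ?thesis unfolding E'_def exch_def by blast
  qed
  have s1: "successively (\<lambda>a b. (a, b) \<in> E') (rev (take (Suc i) p))"
    unfolding successively_rev by (rule iffD2[OF successively_conv_nth]) (use keep symE' assms(3) in auto)
  have s2: "successively (\<lambda>a b. (a, b) \<in> E') (drop (Suc i) p)"
    by (rule iffD2[OF successively_conv_nth]) (use keep assms(3) in auto)
  have h1: "hd (drop (Suc i) p) = ?v" using assms(3) by (simp add: hd_drop_conv_nth)
  have h2: "last (rev (take (Suc i) p)) = ?u" using len by (simp add: last_rev)
  have succ: "successively (\<lambda>a b. (a, b) \<in> E') p'"
    unfolding p'_def successively_append_iff using s1 s2 h1 h2 uE' by simp
  have perm: "set p' = set p" unfolding p'_def using set_append[of "take (Suc i) p" "drop (Suc i) p"] by simp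
  have "distinct (take (Suc i) p @ drop (Suc i) p)" using assms(2) by (simp add: arm_list_def)
  then have dist: "distinct p'" unfolding p'_def distinct_append by simp
  have hd': "hd p' = ?q"
  proof -
    have "take (Suc i) p \<noteq> []" using len by auto
    then have "hd p' = last (take (Suc i) p)" by (simp add: p'_def hd_rev)
    also have "\<dots> = ?q" using assms(3) by (simp add: take_Suc_conv_app_nth)
    finally show ?thesis .
  qed
  have last': "last p' = last p" using assms(3) by (simp add: p'_def)
  have lq: "last p \<noteq> ?q" using arm_list_nth_eq[OF assms(2), of "length p - 1" i] assms(3) arm_list_last[OF assms(2)] by auto
  have "last p \<in> tleaves E'" "?q \<in> tleaves E'" using tl assms(2) by (auto simp: arm_list_def)
  moreover have "\<forall>z\<in>set p' - {x}. deg E' z \<le> 2"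
  proof
    fix z assume "z \<in> set p' - {x}"
    then have "deg E z \<le> 2" using perm assms(2) by (simp add: arm_list_def)
    then show "deg E' z \<le> 2" using d[of z] by (auto split: if_splits)
  qed
  moreover have "x \<in> set p'" using perm assms(2) by (simp add: arm_list_def)
  ultimately show "arm_list E' x p'"
    unfolding arm_list_def hd' last' using dist succ lq by auto
qed

lemma rotate_last:
  assumes "copt E" "arm_list E x p" "Suc i < length p" "(last p, p ! i) \<in> A"
  obtains E' where "copt E'" "core E' = core E" "tleaves E' = tleaves E - {last p} \<union> {p ! Suc i}"
proof -
  interpret utree V E by (rule opt_utree[OF copt_opt[OF assms(1)]])
  define i' where "i' = length p - 2 - i"
  have i': "Suc i' < length (rev p)" "rev p ! i' = p ! Suc i" "rev p ! Suc i' = p ! i"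
    using assms(3) by (auto simp: i'_def rev_nth Suc_diff_Suc numeral_2_eq_2)
  have h: "hd (rev p) = last p" using assms(3) by (simp add: hd_rev)
  have "(hd (rev p), rev p ! Suc i') \<in> A" using assms(4) i' h by simp
  note r = rotate[OF assms(1) arm_list_rev[OF assms(2)] i'(1) this]
  show ?thesis using that[OF r(1,2)] r(4) i' h by simp
qed

text \<open>After the rotation \<open>p ! i\<close> is a leaf, hence adjacent neither to the leaf
  \<open>last p\<close> nor to a core vertex.\<close>

lemma arm_hd_facts:
  assumes "copt E" "arm_list E x p" "w \<in> core E" "Suc i < length p" "(hd p, p ! Suc i) \<in> A"
  shows "(p ! i, last p) \<notin> A" "(p ! i, w) \<notin> A"
proof -
  note r = rotate[OF assms(1,2,4,5)]
  have "last p \<noteq> p ! i" using arm_list_nth_eq[OF assms(2), of "length p - 1" i] assms(4) arm_list_last[OF assms(2)] by auto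
  then show "(p ! i, last p) \<notin> A"
    using leaves_indep[OF copt_opt[OF r(1)], of "p ! i" "last p"] r(4) assms(2) by (auto simp: arm_list_def)
  show "(p ! i, w) \<notin> A" using leaf_core[OF r(1), of "p ! i" w] r(2,4) assms(3) by simp
qed

lemma arm_last_fact:
  assumes "copt E" "arm_list E x p" "w \<in> core E" "Suc i < length p" "(last p, p ! i) \<in> A"
  shows "(p ! Suc i, w) \<notin> A"
proof -
  obtain E' where "copt E'" "core E' = core E" "tleaves E' = tleaves E - {last p} \<union> {p ! Suc i}"
    by (rule rotate_last[OF assms(1,2,4,5)])
  then show ?thesis using leaf_core[of E' "p ! Suc i" w] assms(3) by simp
qed

text \<open>Rotate at the head first; this reverses the run, so that \<open>p ! Suc i\<close> now
  precedes \<open>p ! i\<close>. If \<open>i < j\<close>, a rotation at the other end, using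
  \<open>p ! Suc i\<close>, makes \<open>p ! i\<close> a leaf, although it is adjacent to
  \<open>w\<close>. If \<open>i = j\<close>, a rotation using \<open>p ! i\<close> makes both its
  list neighbours leaves, and with \<open>last p\<close> and \<open>w\<close> they form a K_{1,4} at
  \<open>p ! i\<close>.\<close>

lemma arm_crossing:
  assumes "copt E" "arm_list E x p" "w \<in> core E" "w \<notin> set p" "(w, p ! i) \<in> A" "i \<le> j" "Suc (Suc j) < length p"
    and run: "\<And>t. i \<le> t \<Longrightarrow> t \<le> j \<Longrightarrow> (last p, p ! t) \<in> A"
  shows "(hd p, p ! Suc (Suc j)) \<notin> A"
proof
  assume a: "(hd p, p ! Suc (Suc j)) \<in> A"
  have opt: "opt E" by (rule copt_opt[OF assms(1)])
  interpret utree V E by (rule opt_utree[OF opt])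
  note r = rotate[OF assms(1,2,7) a]
  let ?E = "exch E (p ! Suc j) (p ! Suc (Suc j)) (hd p) (p ! Suc (Suc j))"
  let ?p = "rev (take (Suc (Suc j)) p) @ drop (Suc (Suc j)) p"
  have nth: "?p ! t = p ! (Suc j - t)" if "t \<le> Suc j" for t
    using that assms(7) by (simp add: nth_append rev_nth)
  have lp: "last ?p = last p" "length ?p = length p" using assms(7) by auto
  have wi: "(p ! i, w) \<in> A" by (rule A_sym[OF assms(5)])
  show False
  proof (cases "i < j")
    case True
    have "?p ! (j - i) = p ! Suc i" using nth[of "j - i"] True by (simp add: Suc_diff_le)
    then have b: "(last ?p, ?p ! (j - i)) \<in> A" using run[of "Suc i"] True lp by simp
    have l: "Suc (j - i) < length ?p" using assms(7) lp by simp
    obtain E2 where E2: "copt E2" "core E2 = core ?E" "tleaves E2 = tleaves ?E - {last ?p} \<union> {?p ! Suc (j - i)}"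
      by (rule rotate_last[OF r(1,3) l b])
    have "?p ! Suc (j - i) = p ! i" using nth[of "Suc (j - i)"] True by simp
    then show False using leaf_core[OF E2(1), of "p ! i" w] E2 r(2) assms(3) wi by simp
  next
    case False
    then have ij: "i = j" using assms(6) by simp
    have zi: "(last p, p ! i) \<in> A" using run[of i] ij by simp
    have "i \<noteq> 0"
    proof
      assume "i = 0"
      then have "p ! i \<in> tleaves E" using arm_list_hd[OF assms(2)] assms(2) by (simp add: arm_list_def)
      then show False using leaf_core[OF assms(1) _ assms(3)] wi by blast
    qed
    then obtain h where h: "i = Suc h" by (cases i) auto
    have p1: "?p ! 1 = p ! i" "?p ! Suc 1 = p ! h" using nth[of 1] nth[of 2] ij h by (auto simp: numeral_2_eq_2)
    have l: "Suc 1 < length ?p" using assms(7) lp h ij by simp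
    have b: "(last ?p, ?p ! 1) \<in> A" using zi p1 lp by simp
    obtain E2 where E2: "copt E2" "core E2 = core ?E" "tleaves E2 = tleaves ?E - {last ?p} \<union> {?p ! Suc 1}"
      by (rule rotate_last[OF r(1,3) l b])
    have neq: "p ! s \<noteq> p ! t" if "s \<noteq> t" "s < length p" "t < length p" for s t
      using arm_list_nth_eq[OF assms(2)] that by blast
    have lst: "last p = p ! (length p - 1)" by (rule arm_list_last[OF assms(2)])
    have ne: "p ! Suc i \<noteq> last p" "p ! h \<noteq> last p" "p ! h \<noteq> p ! Suc i"
      unfolding lst by (rule neq; use assms(7) ij h in simp)+
    have E2l: "p ! h \<in> tleaves E2" "p ! Suc i \<in> tleaves E2" using E2(3) p1 r(4) lp ne ij by auto
    have hi: "(p ! h, p ! Suc i) \<notin> A" by (rule leaves_indep[OF copt_opt[OF E2(1)] E2l ne(3)])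
    have wE2: "w \<in> core E2" using E2(2) r(2) assms(3) by simp
    have hw: "(p ! h, w) \<notin> A" "(p ! Suc i, w) \<notin> A" using leaf_core[OF E2(1) _ wE2] E2l by blast+
    have zw: "(last p, w) \<notin> A" using leaf_core[OF assms(1) _ assms(3)] assms(2) by (simp add: arm_list_def)
    have iz: "(p ! Suc i, last p) \<notin> A" using arm_hd_facts(1)[OF assms(1-3,7) a] ij by simp
    have hz: "(last p, p ! h) \<notin> A"
      using arm_last_fact[OF assms(1-3), of h] wi h assms(7) ij by auto
    have "(p ! h, p ! i) \<in> E" "(p ! i, p ! Suc i) \<in> E"
      using arm_list_edge[OF assms(2)] assms(7) ij h by auto
    then have e: "(p ! i, p ! h) \<in> A" "(p ! i, p ! Suc i) \<in> A" using opt_A[OF opt] E_sym by blast+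
    have "p ! h \<in> set p" "p ! Suc i \<in> set p" "last p \<in> set p" using assms(7) ij h by (auto intro: last_in_set)
    then have "distinct [p ! h, p ! Suc i, last p, w]" using ne assms(4) by auto
    then show False using K14[OF e A_sym[OF zi] wi] hi hw zw iz hz A_sym by blast
  qed
qed

section \<open>Adding up over the arms\<close>

lemma cover_arms:
  assumes "opt E" "v \<in> V" "v \<notin> core E"
  shows "\<exists>x\<in>ends E. v \<in> arm E x"
proof (cases "deg E v \<ge> 3")
  case True
  then show ?thesis using assms(3) by (intro bexI[of _ v]) (auto simp: ends_def arm_def)
next
  case False
  obtain a where "a \<in> ends E" using other_end[OF assms(1), of "{}"] by auto
  then have "deg E a \<ge> 3" by (simp add: ends_def)
  then obtain m b where mb: "pend E m b" "deg E b \<ge> 3" "v \<in> side E m b"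
    using utree.noncore_in_pend[OF opt_utree[OF assms(1)] assms(2,3), of a] False by auto
  then show ?thesis using pend_ends(1)[OF assms(1) mb(1,2)] by (auto simp: arm_def)
qed

lemma arms_disjoint:
  assumes "opt E" "x \<in> ends E" "y \<in> ends E" "x \<noteq> y" shows "arm E x \<inter> arm E y = {}"
proof (rule ccontr)
  interpret utree V E by (rule opt_utree[OF assms(1)])
  assume "\<not> ?thesis"
  then obtain v where v: "v \<in> arm E x" "v \<in> arm E y" by blast
  have d: "deg E x \<ge> 3" "deg E y \<ge> 3" using assms by (auto simp: ends_def)
  show False
    using v assms(4) branch_not_in_pend[of _ x y] branch_not_in_pend[of _ y x] d
      pend_disjoint[of _ x _ y v] by (auto simp: arm_def)
qed

lemma arm_sub_V: "opt E \<Longrightarrow> x \<in> ends E \<Longrightarrow> arm E x \<subseteq> V"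
proof -
  assume a: "opt E" "x \<in> ends E"
  interpret utree V E by (rule opt_utree[OF a(1)])
  have "x \<in> V" using a(2) deg_pos_in_V[of x] by (auto simp: ends_def)
  then show ?thesis using side_sub_V by (auto simp: arm_def pend_def)
qed

lemma leaf_nbrs_arm:
  assumes "copt E" "x \<in> ends E" "u \<in> tleaves E" "u \<in> arm E x"
  shows "A `` {u} \<subseteq> arm E x"
proof
  have opt: "opt E" by (rule copt_opt[OF assms(1)])
  have x3: "deg E x = 3" by (rule ends_deg[OF opt assms(2)])
  then have "u \<noteq> x" using assms(3) by (auto simp: tleaves_def)
  then obtain m where m: "pend E m x" "u \<in> side E m x" using assms(4) by (auto simp: arm_def)
  fix y assume "y \<in> A `` {u}"
  then have uy: "(u, y) \<in> A" by simp
  have "y \<notin> core E" using leaf_core[OF assms(1,3)] uy by blast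
  moreover have "y \<in> V" using uy A_sub by blast
  ultimately obtain x' where x': "x' \<in> ends E" "y \<in> arm E x'" using cover_arms[OF opt] by blast
  have "x' = x" using leaf_far_arm[OF opt assms(3) m _ x'(1) _ x'(2)] uy x3 by auto
  then show "y \<in> arm E x" using x' by simp
qed

text \<open>The first bound is \<open>run_count\<close> along the arm. The second omits
  \<open>w\<close> and saves one, since the last position contributes nothing.\<close>

lemma arm_count:
  assumes "copt E" "x \<in> ends E" "w \<in> core E"
  shows "(\<Sum>u\<in>tleaves E \<inter> arm E x. card (A `` {u})) + card (A `` {w} \<inter> arm E x) \<le> card (arm E x)"
    and "A `` {w} \<inter> arm E x = {} \<Longrightarrow> (\<Sum>u\<in>tleaves E \<inter> arm E x. card (A `` {u})) + 1 \<le> card (arm E x)"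
proof -
  have opt: "opt E" by (rule copt_opt[OF assms(1)])
  interpret utree V E by (rule opt_utree[OF opt])
  obtain p where p: "arm_list E x p" "set p = arm E x" "tleaves E \<inter> arm E x = {hd p, last p}"
    by (rule arm_list_exists[OF opt assms(2)])
  let ?u = "hd p" and ?z = "last p" and ?m = "length p"
  have ne: "?u \<noteq> ?z" and dist: "distinct p" and ul: "?u \<in> tleaves E" and zl: "?z \<in> tleaves E"
    using p(1) by (auto simp: arm_list_def)
  have hd0: "?u = p ! 0" and lst: "?z = p ! (?m - 1)" using arm_list_hd[OF p(1)] arm_list_last[OF p(1)] by auto
  have m2: "?m \<ge> 2"
  proof (rule ccontr)
    assume "\<not> ?thesis"
    then have "?m - 1 = 0" by simp
    then show False using ne hd0 lst by simp
  qed
  have card_arm: "card (arm E x) = ?m" using distinct_card[OF dist] p(2) by simp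
  \<comment> \<open>The shift by one makes \<open>a i\<close> and \<open>b i\<close> exclude each
    other. It loses nothing in the sum, as the first vertex is not adjacent to itself.\<close>
  define a where "a i \<longleftrightarrow> Suc i < ?m \<and> (?u, p ! Suc i) \<in> A" for i
  define b where "b i \<longleftrightarrow> i < ?m \<and> (?z, p ! i) \<in> A" for i
  define c where "c i \<longleftrightarrow> i < ?m \<and> (w, p ! i) \<in> A" for i
  have wp: "w \<notin> set p" using arm_not_core[OF opt assms(2)] assms(3) p(2) by blast
  have nb: "A `` {?u} = {y \<in> set p. (?u, y) \<in> A}" "A `` {?z} = {y \<in> set p. (?z, y) \<in> A}"
    using leaf_nbrs_arm[OF assms(1,2)] ul zl p(2,3) by blast+
  have suma: "(\<Sum>i<?m. of_bool (a i)) = card (A `` {?u})"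
  proof -
    obtain m' where m': "?m = Suc m'" using m2 by (cases ?m) auto
    have "(?u, p ! 0) \<notin> A" using A_irrefl hd0 by auto
    then have "(\<Sum>i<?m. of_bool (a i) :: nat) = (\<Sum>i<?m. of_bool ((?u, p ! i) \<in> A))"
      unfolding m' sum.lessThan_Suc_shift[of "\<lambda>i. of_bool ((?u, p ! i) \<in> A)"]
      by (simp add: a_def m')
    also have "\<dots> = card {y \<in> set p. (?u, y) \<in> A}" by (rule sum_of_bool_nth[OF dist])
    finally show ?thesis using nb by simp
  qed
  have sumb: "(\<Sum>i<?m. of_bool (b i)) = card (A `` {?z})"
    using sum_of_bool_nth[OF dist, of "\<lambda>y. (?z, y) \<in> A"] nb by (simp add: b_def)
  have "A `` {w} \<inter> arm E x = {y \<in> set p. (w, y) \<in> A}" using p(2) by blast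
  then have sumc: "(\<Sum>i<?m. of_bool (c i)) = card (A `` {w} \<inter> arm E x)"
    using sum_of_bool_nth[OF dist, of "\<lambda>y. (w, y) \<in> A"] by (simp add: c_def)
  have leaves_sum: "(\<Sum>u\<in>tleaves E \<inter> arm E x. card (A `` {u})) = card (A `` {?u}) + card (A `` {?z})"
    using p(3) ne by simp
  have ab: "\<not> b i" if "a i" for i
    using arm_hd_facts(1)[OF assms(1) p(1) assms(3), of i] that A_sym by (auto simp: a_def b_def)
  have lastb: "\<not> b i" if "Suc i = ?m" for i
  proof -
    have "p ! i = ?z" using lst that by (metis diff_Suc_1)
    then show ?thesis using A_irrefl[of ?z ?z] by (auto simp: b_def)
  qed
  have "(\<Sum>i<?m. of_bool (a i) + of_bool (b i) + of_bool (c i)) \<le> ?m"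
  proof (rule run_count)
    show "\<not> b i" if "a i" for i using ab[OF that] .
    show "\<not> c i" if "a i" for i
      using arm_hd_facts(2)[OF assms(1) p(1) assms(3), of i] that A_sym by (auto simp: a_def c_def)
    show "\<not> c (Suc i)" if "b i" for i
      using arm_last_fact[OF assms(1) p(1) assms(3), of i] that A_sym by (auto simp: b_def c_def)
    show "\<not> a (Suc j)" if "c i" "i \<le> j" "\<And>t. i \<le> t \<Longrightarrow> t \<le> j \<Longrightarrow> b t" for i j
      using arm_crossing[OF assms(1) p(1) assms(3) wp, of i j] that by (auto simp: a_def b_def c_def)
    show "\<not> b i" if "Suc i = ?m" for i by (rule lastb[OF that])
  qed
  then show "(\<Sum>u\<in>tleaves E \<inter> arm E x. card (A `` {u})) + card (A `` {w} \<inter> arm E x) \<le> card (arm E x)"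
    using suma sumb sumc leaves_sum card_arm by (simp add: sum.distrib)
  \<comment> \<open>At the last index \<open>a\<close> fails by its range and \<open>b\<close>
    because there are no loops.\<close>
  have "(\<Sum>i<?m. of_bool (a i) + of_bool (b i)) \<le> (\<Sum>i<?m. of_bool (Suc i < ?m) :: nat)"
  proof (rule sum_mono)
    fix i assume "i \<in> {..<?m}"
    then show "of_bool (a i) + of_bool (b i) \<le> (of_bool (Suc i < ?m) :: nat)"
      using ab[of i] lastb[of i] by (cases "Suc i = ?m") (auto simp: a_def)
  qed
  also have "\<dots> = ?m - 1"
  proof -
    have "{..<?m} \<inter> {i. Suc i < ?m} = {..<?m - 1}" by auto
    then show ?thesis by (simp add: of_bool_def sum.If_cases)
  qed
  finally show "(\<Sum>u\<in>tleaves E \<inter> arm E x. card (A `` {u})) + 1 \<le> card (arm E x)"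
    using suma sumb leaves_sum card_arm m2 by (simp add: sum.distrib)
qed

theorem small_degree_sum:
  assumes "opt E0"
  obtains U where "U \<subseteq> V" "\<forall>u\<in>U. \<forall>v\<in>U. (u, v) \<notin> A" "card U = 2 * k + 3" "(\<Sum>u\<in>U. card (A `` {u})) + k \<le> card V"
proof -
  obtain E w b where g: "good E w b" "card (ends E \<inter> side E w b) \<le> 2" by (rule good_pair[OF assms])
  then have copt: "copt E" and wb: "(w, b) \<in> E" and wc: "w \<in> core E" and bc: "b \<in> core E" and b3: "deg E b \<ge> 3"
    by (auto simp: good_def)
  have opt: "opt E" by (rule copt_opt[OF copt])
  interpret utree V E by (rule opt_utree[OF opt])
  have fe: "finite (ends E)" by (rule finite_subset[OF _ branches_fin]) (auto simp: ends_def)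
  have coreV: "core E \<subseteq> V" using core_in_V by blast
  have tlV: "tleaves E \<subseteq> V" using deg_pos_in_V by (auto simp: tleaves_def)
  have tlc: "tleaves E \<inter> core E = {}" using core_deg by (fastforce simp: tleaves_def)
  have fc: "finite (core E)" by (rule fin_core[OF opt])
  have fa: "finite (arm E x)" if "x \<in> ends E" for x using arm_sub_V[OF opt that] finV finite_subset by blast
  have Vsplit: "V = core E \<union> (\<Union>x\<in>ends E. arm E x)"
    using cover_arms[OF opt] coreV arm_sub_V[OF opt] by blast
  have dis: "\<forall>x\<in>ends E. \<forall>y\<in>ends E. x \<noteq> y \<longrightarrow> arm E x \<inter> arm E y = {}" using arms_disjoint[OF opt] by blast
  have coredis: "core E \<inter> (\<Union>x\<in>ends E. arm E x) = {}" using arm_not_core[OF opt] by blast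
  have cardV: "card V = card (core E) + (\<Sum>x\<in>ends E. card (arm E x))"
  proof -
    have "card V = card (core E) + card (\<Union>x\<in>ends E. arm E x)"
      by (subst Vsplit) (rule card_Un_disjoint[OF fc _ coredis], use fe fa in blast)
    also have "card (\<Union>x\<in>ends E. arm E x) = (\<Sum>x\<in>ends E. card (arm E x))"
      by (rule card_UN_disjoint[OF fe _ dis]) (use fa in blast)
    finally show ?thesis .
  qed
  have Lsum: "(\<Sum>u\<in>tleaves E. card (A `` {u})) = (\<Sum>x\<in>ends E. \<Sum>u\<in>tleaves E \<inter> arm E x. card (A `` {u}))"
  proof -
    have "tleaves E = (\<Union>x\<in>ends E. tleaves E \<inter> arm E x)" using tlV Vsplit tlc by blast
    then have "(\<Sum>u\<in>tleaves E. card (A `` {u})) = (\<Sum>u\<in>(\<Union>x\<in>ends E. tleaves E \<inter> arm E x). card (A `` {u}))" by simp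
    also have "\<dots> = (\<Sum>x\<in>ends E. \<Sum>u\<in>tleaves E \<inter> arm E x. card (A `` {u}))"
      by (rule sum.UNION_disjoint[OF fe]) (use fa dis in blast)+
    finally show ?thesis .
  qed
  have Aw: "A `` {w} \<subseteq> V" using A_sub by blast
  have Wsum: "card (A `` {w}) = card (A `` {w} \<inter> core E) + (\<Sum>x\<in>ends E. card (A `` {w} \<inter> arm E x))"
  proof -
    have fw: "finite (A `` {w})" using Aw finV finite_subset by blast
    have "A `` {w} = (A `` {w} \<inter> core E) \<union> (\<Union>x\<in>ends E. A `` {w} \<inter> arm E x)" using Aw Vsplit by blast
    then have "card (A `` {w}) = card ((A `` {w} \<inter> core E) \<union> (\<Union>x\<in>ends E. A `` {w} \<inter> arm E x))" by simp
    also have "\<dots> = card (A `` {w} \<inter> core E) + card (\<Union>x\<in>ends E. A `` {w} \<inter> arm E x)"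
      by (rule card_Un_disjoint) (use fw fe coredis in blast)+
    also have "card (\<Union>x\<in>ends E. A `` {w} \<inter> arm E x) = (\<Sum>x\<in>ends E. card (A `` {w} \<inter> arm E x))"
      by (rule card_UN_disjoint[OF fe]) (use fw dis in blast)+
    finally show ?thesis .
  qed
  have "card (A `` {w} \<inter> core E) < card (core E)"
    by (rule psubset_card_mono[OF fc]) (use wc A_irrefl in blast)
  then have Wcore: "card (A `` {w} \<inter> core E) + 1 \<le> card (core E)" by simp
  let ?i = "\<lambda>x. of_bool (x \<in> side E w b) :: nat"
  \<comment> \<open>Every arm saves one, except that arms of stem leaves in
    \<open>side E w b\<close>, where \<open>w\<close> may have neighbours, are credited with
    it.\<close>
  have each: "(\<Sum>u\<in>tleaves E \<inter> arm E x. card (A `` {u})) + card (A `` {w} \<inter> arm E x) + 1 \<le> card (arm E x) + ?i x"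
    if x: "x \<in> ends E" for x
  proof (cases "x \<in> side E w b")
    case True
    then show ?thesis using arm_count(1)[OF copt x wc] by simp
  next
    case False
    have "x \<in> V" using x deg_pos_in_V[of x] by (simp add: ends_def)
    then have xb: "x \<in> side E b w" using side_compl[OF wb _ False] by blast
    have "A `` {w} \<inter> arm E x = {}" using core_far_arm[OF copt wb wc bc b3 x xb] by blast
    then show ?thesis using arm_count(2)[OF copt x wc] False by simp
  qed
  have "(\<Sum>x\<in>ends E. (\<Sum>u\<in>tleaves E \<inter> arm E x. card (A `` {u})) + card (A `` {w} \<inter> arm E x) + 1)
    \<le> (\<Sum>x\<in>ends E. card (arm E x) + ?i x)" by (rule sum_mono) (rule each)
  moreover have "(\<Sum>x\<in>ends E. ?i x) = card (ends E \<inter> side E w b)"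
    using fe by (simp add: of_bool_def sum.If_cases Int_def)
  moreover have "(\<Sum>x\<in>ends E. 1) = k + 1" using card_ends[OF opt] by simp
  ultimately have "(\<Sum>x\<in>ends E. \<Sum>u\<in>tleaves E \<inter> arm E x. card (A `` {u}))
      + (\<Sum>x\<in>ends E. card (A `` {w} \<inter> arm E x)) + (k + 1)
    \<le> (\<Sum>x\<in>ends E. card (arm E x)) + card (ends E \<inter> side E w b)"
    unfolding sum.distrib by linarith
  \<comment> \<open>The arms save at least \<open>k + 1 - 2\<close>, and \<open>Wcore\<close> one
    more.\<close>
  then have tot: "(\<Sum>u\<in>tleaves E. card (A `` {u})) + card (A `` {w}) + k \<le> card V"
    using g(2) Lsum Wsum cardV Wcore by linarith
  have wl: "w \<notin> tleaves E" using wc tlc by blast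
  have ft: "finite (tleaves E)" by (rule opt_fin[OF opt])
  show ?thesis
  proof (rule that[of "insert w (tleaves E)"])
    show "insert w (tleaves E) \<subseteq> V" using tlV wc coreV by blast
    show "\<forall>u\<in>insert w (tleaves E). \<forall>v\<in>insert w (tleaves E). (u, v) \<notin> A"
      using leaves_indep[OF opt] leaf_core[OF copt _ wc] A_irrefl A_sym by blast
    show "card (insert w (tleaves E)) = 2 * k + 3" using wl ft opt_card[OF opt] by simp
    show "(\<Sum>u\<in>insert w (tleaves E). card (A `` {u})) + k \<le> card V" using wl ft tot by simp
  qed
qed

end

section \<open>Growing a largest subtree with few leaves\<close>

lemma tree_on_add_leaf:
  assumes "tree_on S E" "x \<in> S" "y \<notin> S"
  shows "tree_on (insert y S) (insert (x, y) (insert (y, x) E))"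
    and "deg (insert (x, y) (insert (y, x) E)) v = (if v = y then 1 else if v = x then Suc (deg E v) else deg E v)"
proof -
  interpret utree S E by (rule utree.intro[OF assms(1)])
  let ?E = "insert (x, y) (insert (y, x) E)"
  have yE: "(y, z) \<notin> E" "(z, y) \<notin> E" for z using E_sub assms(3) by auto
  have sub: "?E \<subseteq> insert y S \<times> insert y S" using E_sub assms by auto
  have sym: "sym ?E" using symE by (auto simp: sym_def)
  have symr: "sym (?E\<^sup>*)" by (rule sym_rtrancl[OF sym])
  have mono: "E\<^sup>* \<subseteq> ?E\<^sup>*" by (rule rtrancl_mono) auto
  have "(x, u) \<in> ?E\<^sup>*" if "u \<in> insert y S" for u
    using that conn[OF assms(2), of u] mono by auto
  then have conn': "insert y S \<times> insert y S \<subseteq> ?E\<^sup>*"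
    using symr by (auto intro: rtrancl_trans dest: symD)
  have "q \<notin> side ?E p q" if pq: "(p, q) \<in> ?E" for p q
  proof -
    consider "(p, q) = (x, y)" | "(p, q) = (y, x)" | "(p, q) \<in> E" using pq by auto
    then show ?thesis
    proof cases
      case 1
      have "side ?E x y \<subseteq> S" by (rule side_subset) (use assms(2) E_verts yE in auto)
      then show ?thesis using 1 assms(3) by auto
    next
      case 2
      have "side ?E y x \<subseteq> {y}" by (rule side_subset) (use yE in auto)
      then show ?thesis using 2 assms by auto
    next
      case 3
      \<comment> \<open>The new vertex \<open>y\<close> is a dead end, so nothing else can be added
        to a side.\<close>
      have "side ?E p q \<subseteq> side E p q \<union> {z. z = y \<and> x \<in> side E p q}"
      proof (rule side_subset)
        fix s t assume s: "s \<in> side E p q \<union> {z. z = y \<and> x \<in> side E p q}" and st: "(s, t) \<in> ?E"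
          and ne: "(s, t) \<noteq> (p, q)" "(s, t) \<noteq> (q, p)"
        have "y \<notin> side E p q" using side_sub_V[OF 3] assms(3) by blast
        then consider "s = x" "t = y" "x \<in> side E p q" | "s = y" "t = x" "x \<in> side E p q" | "s \<in> side E p q" "(s, t) \<in> E"
          using s st yE by auto
        then show "t \<in> side E p q \<union> {z. z = y \<and> x \<in> side E p q}"
          by cases (use side_step[OF _ _ ne] in auto)
      qed simp
      then show ?thesis using bridge[OF 3] 3 yE by auto
    qed
  qed
  then show "tree_on (insert y S) ?E" using finV sub sym conn' unfolding tree_on_def by auto
  have "?E `` {v} = (if v = y then {x} else if v = x then insert y (E `` {x}) else E `` {v})"
    using yE assms by auto
  then show "deg ?E v = (if v = y then 1 else if v = x then Suc (deg E v) else deg E v)"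
    using yE by (auto simp: deg_def)
qed

context k14_graph begin

text \<open>Let \<open>S\<close> be largest among the vertex sets that carry a subtree with at most
  \<open>L\<close> leaves. A tree on \<open>S\<close> with fewer than \<open>L\<close> leaves either
  spans or could be enlarged, so \<open>L\<close> is the minimum on \<open>S\<close> and
  \<open>sum_degree_leaves\<close> applies to the subgraph induced by \<open>S\<close>.\<close>

lemma few_leaves:
  assumes "V \<noteq> {}" "V \<times> V \<subseteq> A\<^sup>*" "L \<ge> 4"
    and deg_sum: "\<And>U. U \<subseteq> V \<Longrightarrow> \<forall>u\<in>U. \<forall>v\<in>U. (u, v) \<notin> A \<Longrightarrow> card U = L
      \<Longrightarrow> 2 * card V < 2 * (\<Sum>u\<in>U. card (A `` {u})) + L"
  shows "\<exists>E. sptree E \<and> card (tleaves E) < L"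
proof (rule ccontr)
  assume none: "\<not> ?thesis"
  define P where "P S \<longleftrightarrow> S \<subseteq> V \<and> (\<exists>E. tree_on S E \<and> E \<subseteq> A \<and> card (tleaves E) \<le> L)" for S
  obtain v where v: "v \<in> V" using assms(1) by blast
  have "tree_on {v} {}" by (auto simp: tree_on_def sym_def)
  moreover have "tleaves {} = ({} :: 'a set)" by (auto simp: tleaves_def deg_def)
  ultimately have Pv: "P {v}" unfolding P_def using v by (intro conjI exI[of _ "{}"]) auto
  have bound: "card S \<le> card V" if "P S" for S using that finV by (auto simp: P_def card_mono)
  obtain S where S: "P S" "\<And>S'. P S' \<Longrightarrow> card S' \<le> card S"
  proof -
    have "\<forall>S. P S \<longrightarrow> card S < Suc (card V)" using bound by (simp add: less_Suc_eq_le)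
    from ex_has_greatest_nat[OF Pv this] show ?thesis using that by blast
  qed
  have finS: "finite S" using S(1) finV finite_subset by (auto simp: P_def)
  have no_grow: "\<not> card (tleaves (insert (x, y) (insert (y, x) E))) \<le> L"
    if "tree_on S E" "E \<subseteq> A" "(x, y) \<in> A" "x \<in> S" "y \<notin> S" for E x y
  proof
    assume le: "card (tleaves (insert (x, y) (insert (y, x) E))) \<le> L"
    have "y \<in> V" using that A_sub by blast
    then have "P (insert y S)" unfolding P_def using S(1) that le A_sym tree_on_add_leaf(1)[OF that(1,4,5)]
      by (intro conjI exI[of _ "insert (x, y) (insert (y, x) E)"]) (auto simp: P_def)
    then show False using S(2)[of "insert y S"] that(5) finS by simp
  qed
  have fin_l: "finite (tleaves E)" if "tree_on S E" for E
    by (rule finite_subset[OF _ finS]) (use utree.deg_pos_in_V[OF utree.intro[OF that]] in \<open>auto simp: tleaves_def\<close>)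
  have min: "L \<le> card (tleaves E)" if E: "tree_on S E" "E \<subseteq> A" for E
  proof (rule ccontr)
    assume lt: "\<not> ?thesis"
    show False
    proof (cases "S = V")
      case True
      then show False using none E lt by (auto simp: sptree_def)
    next
      case False
      have "S \<noteq> {}" using S(2)[OF Pv] by auto
      then obtain s t where st: "s \<in> S" "t \<in> V" "t \<notin> S" using False S(1) by (auto simp: P_def)
      have "(s, t) \<in> A\<^sup>*" using st S(1) assms(2) by (auto simp: P_def)
      have "\<exists>x y. (x, y) \<in> A \<and> x \<in> S \<and> y \<notin> S"
      proof (rule ccontr)
        assume no: "\<not> ?thesis"
        from \<open>(s, t) \<in> A\<^sup>*\<close> have "t \<in> S" by (induction rule: rtrancl_induct) (use st no in auto)
        then show False using st by simp
      qed
      then obtain x y where xy: "(x, y) \<in> A" "x \<in> S" "y \<notin> S" by blast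
      show False
      \<comment> \<open>A single vertex is special: attaching another one creates two leaves at
        once.\<close>
      proof (cases "deg E x = 0")
        case True
        have "S = {x}"
        proof -
          interpret utree S E by (rule utree.intro[OF E(1)])
          have "E `` {x} = {}" using True by (simp add: deg_def)
          then show ?thesis using V_split[OF xy(2)] by auto
        qed
        then have "E = {}" using E(1) utree.E_irrefl[OF utree.intro[OF E(1)]] by (auto simp: tree_on_def)
        then have "deg E z = 0" for z by (simp add: deg_def)
        then have "tleaves (insert (x, y) (insert (y, x) E)) \<subseteq> {x, y}"
          by (auto simp: tleaves_def tree_on_add_leaf(2)[OF E(1) xy(2,3)] split: if_splits)
        then have "card (tleaves (insert (x, y) (insert (y, x) E))) \<le> card {x, y}" by (rule card_mono[rotated]) simp
        also have "\<dots> \<le> 2" by (rule card_insert_le_m1) auto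
        finally show False using no_grow[OF E xy] assms(3) by simp
      next
        case False
        then have "tleaves (insert (x, y) (insert (y, x) E)) \<subseteq> insert y (tleaves E)"
          by (auto simp: tleaves_def tree_on_add_leaf(2)[OF E(1) xy(2,3)] split: if_splits)
        then have "card (tleaves (insert (x, y) (insert (y, x) E))) \<le> card (insert y (tleaves E))"
          by (rule card_mono[rotated]) (use fin_l[OF E(1)] in simp)
        also have "\<dots> \<le> Suc (card (tleaves E))" by (rule card_insert_le_m1) auto
        finally show False using no_grow[OF E xy] lt by simp
      qed
    qed
  qed
  obtain E where E: "tree_on S E" "E \<subseteq> A" "card (tleaves E) \<le> L" using S(1) by (auto simp: P_def)
  let ?A = "A \<inter> S \<times> S"
  interpret G: k14_graph S ?A
  proof
    show "sym ?A" using symA by (auto simp: sym_def)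
    show "(a, b) \<in> ?A \<or> (a, c) \<in> ?A \<or> (a, d) \<in> ?A \<or> (b, c) \<in> ?A \<or> (b, d) \<in> ?A \<or> (c, d) \<in> ?A"
      if "(p, a) \<in> ?A" "(p, b) \<in> ?A" "(p, c) \<in> ?A" "(p, d) \<in> ?A" "distinct [a, b, c, d]" for p a b c d
      using K14[of p a b c d] that by blast
  qed (use finS A_irrefl in auto)
  interpret G: min_leaf_graph S ?A L
    by unfold_locales (use min assms(3) in \<open>auto simp: G.sptree_def\<close>)
  have ES: "E \<subseteq> S \<times> S" using E(1) by (simp add: tree_on_def)
  have opt: "G.opt E" using E ES min[OF E(1,2)] by (simp add: G.opt_def G.sptree_def)
  interpret utree S E by (rule utree.intro[OF E(1)])
  have lS: "tleaves E \<subseteq> S" using deg_pos_in_V by (auto simp: tleaves_def)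
  \<comment> \<open>A vertex attached to a leaf takes over its role without raising the number of
    leaves. By maximality the leaves have no neighbours outside \<open>S\<close>, so their degrees
    in the subgraph are their degrees in the graph.\<close>
  have nb: "A `` {u} \<subseteq> S" if u: "u \<in> tleaves E" for u
  proof
    fix y assume "y \<in> A `` {u}"
    then have uy: "(u, y) \<in> A" by simp
    show "y \<in> S"
    proof (rule ccontr)
      assume y: "y \<notin> S"
      have uS: "u \<in> S" using lS u by blast
      have "tleaves (insert (u, y) (insert (y, u) E)) \<subseteq> insert y (tleaves E - {u})"
        using u by (auto simp: tleaves_def tree_on_add_leaf(2)[OF E(1) uS y] split: if_splits)
      then have "card (tleaves (insert (u, y) (insert (y, u) E))) \<le> card (insert y (tleaves E - {u}))"
        by (rule card_mono[rotated]) (use fin_l[OF E(1)] in simp)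
      also have "\<dots> \<le> Suc (card (tleaves E - {u}))" by (rule card_insert_le_m1) auto
      also have "\<dots> = card (tleaves E)" using u fin_l[OF E(1)] by (rule card_Suc_Diff1[rotated])
      finally show False using no_grow[OF E(1,2) uy uS y] E(3) by simp
    qed
  qed
  have "(\<Sum>u\<in>tleaves E. card (?A `` {u})) = (\<Sum>u\<in>tleaves E. card (A `` {u}))"
  proof (rule sum.cong)
    fix u assume u: "u \<in> tleaves E"
    have "?A `` {u} = A `` {u}" using nb[OF u] lS u by auto
    then show "card (?A `` {u}) = card (A `` {u})" by simp
  qed simp
  then have "2 * (\<Sum>u\<in>tleaves E. card (A `` {u})) + L \<le> 2 * card S" using G.sum_degree_leaves[OF opt] by simp
  moreover have "card S \<le> card V" using bound[OF S(1)] .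
  moreover have "\<forall>u\<in>tleaves E. \<forall>v\<in>tleaves E. (u, v) \<notin> A"
    using G.leaves_indep[OF opt] lS A_irrefl by blast
  moreover have "tleaves E \<subseteq> V" using lS S(1) by (auto simp: P_def)
  moreover have "card (tleaves E) = L" using G.opt_card[OF opt] .
  ultimately show False using deg_sum[of "tleaves E"] by simp
qed

theorem few_ends:
  assumes "V \<noteq> {}" "V \<times> V \<subseteq> A\<^sup>*" "k \<ge> 3"
    and deg_sum: "\<And>U. U \<subseteq> V \<Longrightarrow> \<forall>u\<in>U. \<forall>v\<in>U. (u, v) \<notin> A \<Longrightarrow> card U = 2 * k + 3
      \<Longrightarrow> card V + 1 \<le> (\<Sum>u\<in>U. card (A `` {u})) + k"
  shows "\<exists>E. sptree E \<and> card (ends E) \<le> k"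
proof (rule ccontr)
  assume none: "\<not> ?thesis"
  interpret M: many_ends V A k
    by unfold_locales (use assms(3) none in \<open>auto simp: not_le\<close>)
  have "\<exists>E. sptree E \<and> card (tleaves E) < 2 * k + 3"
  proof (rule few_leaves[OF assms(1,2)])
    fix U assume "U \<subseteq> V" "\<forall>u\<in>U. \<forall>v\<in>U. (u, v) \<notin> A" "card U = 2 * k + 3"
    \<comment> \<open>Doubling the hypothesis and adding 3 leaves a surplus of 5.\<close>
    then show "2 * card V < 2 * (\<Sum>u\<in>U. card (A `` {u})) + (2 * k + 3)" using deg_sum[of U] by simp
  qed (use assms(3) in simp)
  then obtain E where E: "sptree E" "card (tleaves E) \<le> 2 * k + 2" by auto
  have "card (tleaves E) = 2 * k + 2" using M.L_min[OF E(1)] E(2) by (rule antisym[rotated])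
  then have "M.opt E" using E(1) unfolding M.opt_def by blast
  then obtain U where "U \<subseteq> V" "\<forall>u\<in>U. \<forall>v\<in>U. (u, v) \<notin> A" "card U = 2 * k + 3"
    "(\<Sum>u\<in>U. card (A `` {u})) + k \<le> card V" by (rule M.small_degree_sum)
  then show False using deg_sum[of U] by simp
qed

end

section \<open>Reducible stems of digraphs\<close>

lemma out_degree_with_proj: "out_degree (with_proj H) v = deg (parcs H) v"
proof -
  have "bij_betw snd (out_arcs (with_proj H) v) (parcs H `` {v})"
    by (rule bij_betw_byWitness[where f' = "\<lambda>w. (v, w)"]) (auto simp: out_arcs_def)
  then show ?thesis unfolding out_degree_def deg_def by (rule bij_betw_same_card)
qed

section \<open>Walks and paths of the digraph\<close>

lemma pcas_end: "pcas u p v \<Longrightarrow> v \<in> set (pawalk_verts u p)"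
  by (induction p arbitrary: u) auto

lemma pcas_start: "pcas u p v \<Longrightarrow> u \<in> set (pawalk_verts u p)"
  by (cases p) auto

lemma pcas_split:
  assumes "pcas u p v" "b \<in> set (pawalk_verts u p)"
  shows "\<exists>q r. p = q @ r \<and> pcas u q b \<and> pcas b r v \<and> set (pawalk_verts u q) \<subseteq> set (pawalk_verts u p)
    \<and> (distinct (pawalk_verts u p) \<longrightarrow> distinct (pawalk_verts u q))"
  using assms
proof (induction p arbitrary: u)
  case Nil
  then show ?case by auto
next
  case (Cons e p)
  show ?case
  proof (cases "b = u")
    case True
    then show ?thesis using Cons.prems by (intro exI[of _ "[]"] exI[of _ "e # p"]) auto
  next
    case False
    then have "pcas (snd e) p v" "b \<in> set (pawalk_verts (snd e) p)" "fst e = u" using Cons.prems by auto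
    from Cons.IH[OF this(1,2)] obtain q r where "p = q @ r" "pcas (snd e) q b" "pcas b r v"
      "set (pawalk_verts (snd e) q) \<subseteq> set (pawalk_verts (snd e) p)"
      "distinct (pawalk_verts (snd e) p) \<longrightarrow> distinct (pawalk_verts (snd e) q)" by blast
    then show ?thesis using \<open>fst e = u\<close> by (intro exI[of _ "e # q"] exI[of _ r]) auto
  qed
qed

lemma pcas_of_vertices:
  assumes "vs \<noteq> []" "successively (\<lambda>x y. (x, y) \<in> E) vs"
  shows "pcas (hd vs) (zip vs (tl vs)) (last vs) \<and> pawalk_verts (hd vs) (zip vs (tl vs)) = vs
    \<and> set (zip vs (tl vs)) \<subseteq> E"
  using assms by (induction vs rule: induct_list012) auto

context utree begin

abbreviation T where "T \<equiv> with_proj \<lparr>pverts = V, parcs = E\<rparr>"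

lemma apath_iff:
  "pre_digraph.apath T u p v \<longleftrightarrow> u \<in> V \<and> set p \<subseteq> E \<and> pcas u p v \<and> distinct (pawalk_verts u p)"
  by (auto simp: pre_digraph.apath_def pre_digraph.awalk_def cas_with_proj_eq awalk_verts_with_proj_eq)

lemma pcas_side:
  assumes "(n, u) \<in> E" "w \<in> side E n u" "pcas w p v" "set p \<subseteq> E" "u \<notin> set (pawalk_verts w p)"
  shows "v \<in> side E n u"
  using assms(2-)
proof (induction p arbitrary: w)
  case (Cons e p)
  have "snd e \<noteq> u" using Cons.prems pcas_start[of "snd e" p v] by auto
  moreover have "(w, snd e) \<in> E" using Cons.prems by auto
  ultimately have "snd e \<in> side E n u" using side_step'[OF assms(1) Cons.prems(1)] by blast
  then show ?case using Cons by auto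
qed auto

text \<open>The first arcs of both paths lead in the direction of \<open>v\<close>, which is unique.
  This gives the definite description in \<open>tree_path\<close> its value.\<close>

lemma apath_unique:
  assumes "set p \<subseteq> E" "pcas u p v" "distinct (pawalk_verts u p)"
    and "set q \<subseteq> E" "pcas u q v" "distinct (pawalk_verts u q)"
  shows "p = q"
  using assms
proof (induction p arbitrary: u q)
  case Nil
  then show ?case by (cases q) (auto dest: pcas_end)
next
  case (Cons e p)
  have "q \<noteq> []" using Cons.prems pcas_end[of "snd e" p v] by auto
  then obtain f q' where q: "q = f # q'" by (cases q) auto
  have "fst e = u" "fst f = u" using Cons.prems(2,5) unfolding q by simp_all
  then have e: "e = (u, snd e)" "f = (u, snd f)" by (metis prod.collapse)+
  have "e \<in> E" "f \<in> E" using Cons.prems(1,4) unfolding q by simp_all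
  then have E: "(snd e, u) \<in> E" "(snd f, u) \<in> E" using e E_sym by metis+
  have "v \<in> side E (snd e) u" by (rule pcas_side[OF E(1) side_self, of p]) (use Cons.prems in auto)
  moreover have "v \<in> side E (snd f) u" by (rule pcas_side[OF E(2) side_self, of q']) (use Cons.prems q in auto)
  ultimately have "snd e = snd f" by (rule dir_unique[OF E])
  then have "e = f" using e by simp
  moreover have "p = q'" by (rule Cons.IH[of "snd e" q']) (use Cons.prems q \<open>snd e = snd f\<close> in auto)
  ultimately show ?case using q by simp
qed

lemma tree_path_eq:
  assumes "u \<in> V" "set p \<subseteq> E" "pcas u p v" "distinct (pawalk_verts u p)"
  shows "tree_path T u v = p"
  unfolding tree_path_def
proof (rule the_equality)
  show "pre_digraph.apath T u p v" using assms by (simp add: apath_iff)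
  show "q = p" if "pre_digraph.apath T u q v" for q
    using that apath_unique[of q u v p] assms by (simp add: apath_iff)
qed

lemma pair_graph_T: "pair_graph \<lparr>pverts = V, parcs = E\<rparr>"
proof
  show "finite (parcs \<lparr>pverts = V, parcs = E\<rparr>)" using finite_subset[OF E_sub] finV by simp
  show "symmetric T" using symE by (simp add: symmetric_def)
qed (use E_sub finV E_irrefl in auto)

lemma rtrancl_on_V:
  assumes "u \<in> V" "v \<in> V" shows "(u, v) \<in> rtrancl_on V E"
  using conn[OF assms]
proof (induction rule: rtrancl_induct)
  case (step y z)
  then show ?case using E_verts rtrancl_on_into_rtrancl_on by metis
qed (use assms in simp)

lemma pcas_exists:
  assumes "u \<in> V" "v \<in> V"
  shows "\<exists>p. set p \<subseteq> E \<and> pcas u p v \<and> distinct (pawalk_verts u p)"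
proof -
  have wf: "wf_digraph T" using pair_graph.axioms(1)[OF pair_graph_T] unfolding wf_digraph_wp_iff
    by (simp add: pair_digraph_def pair_fin_digraph_def)
  have "u \<rightarrow>\<^sup>*\<^bsub>T\<^esub> v" using rtrancl_on_V[OF assms] by (simp add: reachable_def)
  then obtain p where "pre_digraph.apath T u p v" using iffD1[OF wf_digraph.reachable_apath[OF wf]] by blast
  then show ?thesis by (auto simp: apath_iff)
qed

text \<open>The path from \<open>x\<close> to any other branch vertex leaves the side of
  \<open>m\<close>, hence passes \<open>b\<close> and is strictly longer. So \<open>b\<close> is the
  only minimiser, whichever one \<open>arg_min_on\<close> picks.\<close>

lemma leaf_branch_path_eq:
  assumes "pend E m b" "deg E b \<ge> 3" "x \<in> tleaves E" "x \<in> side E m b"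
  shows "leaf_branch_path T x = side E m b"
proof -
  have mb: "(m, b) \<in> E" using assms(1) by (simp add: pend_def)
  obtain l where l: "l \<noteq> []" "hd l = m" "distinct l" "set l = side E m b"
    "successively (\<lambda>x y. (x, y) \<in> E) l" "tleaves E \<inter> side E m b = {last l}"
    using pendant_list[OF mb] assms(1) unfolding pend_def by blast
  have xl: "x = last l" using l(6) assms(3,4) by blast
  let ?vs = "rev l @ [b]" and ?p = "zip (rev l @ [b]) (tl (rev l @ [b]))"
  have hd_vs: "hd ?vs = x" using l(1) xl by (simp add: hd_rev)
  have "successively (\<lambda>x y. (x, y) \<in> E) (rev l)"
    unfolding successively_rev
    by (rule successively_mono[of "\<lambda>a b. (a, b) \<in> E"]) (use l E_sym in auto)
  then have succ: "successively (\<lambda>x y. (x, y) \<in> E) ?vs"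
    using mb l(1,2) by (simp add: successively_append_iff last_rev)
  have p: "pcas x ?p b" "pawalk_verts x ?p = ?vs" "set ?p \<subseteq> E"
    using pcas_of_vertices[OF _ succ] unfolding hd_vs by auto
  have bl: "b \<notin> side E m b" by (rule not_self_side[OF mb])
  then have dist: "distinct ?vs" using l by auto
  have xV: "x \<in> V" using assms(4) side_sub_V[OF mb] by blast
  have path: "tree_path T x b = ?p" by (rule tree_path_eq[OF xV p(3,1)]) (use p(2) dist in simp)
  let ?B = "branch_vertices T"
  have B: "?B = {v. deg E v \<ge> 3}"
    using deg_pos_in_V by (auto simp: branch_vertices_def out_degree_with_proj)
  have finB: "finite ?B" unfolding B by (rule branches_fin)
  have less: "length (tree_path T x b) < length (tree_path T x y)" if y: "y \<in> ?B" "y \<noteq> b" for y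
  proof -
    have y3: "deg E y \<ge> 3" using y B by simp
    then have yV: "y \<in> V" using deg_pos_in_V by simp
    obtain q where q: "set q \<subseteq> E" "pcas x q y" "distinct (pawalk_verts x q)" using pcas_exists[OF xV yV] by blast
    have "y \<notin> side E m b" using branch_not_in_pend[OF assms(1) y3] .
    then have "b \<in> set (pawalk_verts x q)" using pcas_side[OF mb assms(4) q(2,1)] by blast
    from pcas_split[OF q(2) this] q(3) obtain q1 q2 where s: "q = q1 @ q2" "pcas x q1 b" "pcas b q2 y"
      "distinct (pawalk_verts x q1)" by blast
    have "tree_path T x b = q1" by (rule tree_path_eq[OF xV _ s(2,4)]) (use s q in auto)
    moreover have "tree_path T x y = q" by (rule tree_path_eq[OF xV q])
    moreover have "q2 \<noteq> []" using s(3) y(2) by auto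
    ultimately show ?thesis using s(1) by simp
  qed
  have bB: "b \<in> ?B" using assms(2) B by simp
  have near: "nearest_branch_vertex T x = b"
  proof (rule ccontr)
    let ?f = "\<lambda>y. length (tree_path T x y)"
    assume "nearest_branch_vertex T x \<noteq> b"
    moreover have "nearest_branch_vertex T x \<in> ?B" unfolding nearest_branch_vertex_def
      by (rule arg_min_if_finite(1)[OF finB]) (use bB in blast)
    ultimately have "?f b < ?f (nearest_branch_vertex T x)" by (intro less)
    moreover have "\<not> (\<exists>y\<in>?B. ?f y < ?f (nearest_branch_vertex T x))" unfolding nearest_branch_vertex_def
      by (rule arg_min_if_finite(2)[OF finB]) (use bB in blast)
    ultimately show False using bB by blast
  qed
  have "leaf_branch_path T x = set ?vs - {b}"
    by (simp add: leaf_branch_path_def near path awalk_verts_with_proj_eq p(2))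
  then show ?thesis using l(4) bl by auto
qed

lemma leaves_T: "leaves T = tleaves E"
  using deg_pos_in_V by (auto simp: leaves_def tleaves_def out_degree_with_proj)

lemma leaf_in_pend:
  assumes "x \<in> tleaves E" "\<exists>v. deg E v \<ge> 3"
  obtains m b where "pend E m b" "deg E b \<ge> 3" "x \<in> side E m b"
proof -
  have x: "deg E x = 1" using assms(1) by (simp add: tleaves_def)
  then have "x \<in> V" "x \<notin> core E" using deg_pos_in_V core_deg[of x] by auto
  then show ?thesis using noncore_in_pend[of x] x assms(2) that by auto
qed

lemma stem_verts:
  assumes "\<exists>v. deg E v \<ge> 3"
  shows "V - (\<Union>x\<in>leaves T. leaf_branch_path T x) = V - (\<Union>(m, b)\<in>{(m, b). pend E m b \<and> deg E b \<ge> 3}. side E m b)"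
proof -
  have "(\<Union>x\<in>leaves T. leaf_branch_path T x) \<subseteq> (\<Union>(m, b)\<in>{(m, b). pend E m b \<and> deg E b \<ge> 3}. side E m b)"
  proof
    fix z assume "z \<in> (\<Union>x\<in>leaves T. leaf_branch_path T x)"
    then obtain x where x: "x \<in> tleaves E" "z \<in> leaf_branch_path T x" using leaves_T by auto
    obtain m b where mb: "pend E m b" "deg E b \<ge> 3" "x \<in> side E m b" by (rule leaf_in_pend[OF x(1) assms])
    then show "z \<in> (\<Union>(m, b)\<in>{(m, b). pend E m b \<and> deg E b \<ge> 3}. side E m b)"
      using x leaf_branch_path_eq[OF mb(1,2) x(1) mb(3)] by auto
  qed
  moreover have "side E m b \<subseteq> (\<Union>x\<in>leaves T. leaf_branch_path T x)" if mb: "pend E m b" "deg E b \<ge> 3" for m b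
  proof -
    obtain x where x: "x \<in> tleaves E" "x \<in> side E m b"
      using pendant_list[of m b] mb(1) unfolding pend_def by blast
    then show ?thesis using leaf_branch_path_eq[OF mb x] leaves_T by auto
  qed
  then have "(\<Union>(m, b)\<in>{(m, b). pend E m b \<and> deg E b \<ge> 3}. side E m b) \<subseteq> (\<Union>x\<in>leaves T. leaf_branch_path T x)"
    by (intro UN_least) (simp only: mem_Collect_eq split_beta)
  ultimately have "(\<Union>x\<in>leaves T. leaf_branch_path T x) = (\<Union>(m, b)\<in>{(m, b). pend E m b \<and> deg E b \<ge> 3}. side E m b)"
    by (rule subset_antisym)
  then show ?thesis by simp
qed

text \<open>A tree neighbour of a stem vertex \<open>v\<close> is missing from the stem only if a
  leaf-branch path starts there. So if \<open>v\<close> is a leaf of the stem, it has degree at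
  least 3: otherwise it would be a leaf of the tree and be deleted. It is not in the core, as a core
  vertex keeps its neighbours in two directions.\<close>

lemma leaves_reducible_stem:
  shows "leaves (reducible_stem T) \<subseteq> ends E"
proof (cases "\<exists>v. deg E v \<ge> 3")
  case False
  then have "branch_vertices T = {}" by (auto simp: branch_vertices_def out_degree_with_proj)
  then show ?thesis by (auto simp: leaves_def reducible_stem_def)
next
  case True
  let ?P = "\<Union>(m, b)\<in>{(m, b). pend E m b \<and> deg E b \<ge> 3}. side E m b"
  let ?R = "V - ?P"
  obtain v0 where "deg E v0 \<ge> 3" "v0 \<in> V" using True deg_pos_in_V by fastforce
  then have "v0 \<in> branch_vertices T" by (simp add: branch_vertices_def out_degree_with_proj)
  then have "branch_vertices T \<noteq> {}" by blast
  then have stem: "reducible_stem T = T \<restriction> ?R"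
    using stem_verts[OF True] by (simp add: reducible_stem_def)
  have od: "out_degree (T \<restriction> ?R) v = card (E `` {v} \<inter> ?R)" if "v \<in> ?R" for v
  proof -
    have "bij_betw snd (out_arcs (T \<restriction> ?R) v) (E `` {v} \<inter> ?R)"
      by (rule bij_betw_byWitness[where f' = "\<lambda>w. (v, w)"]) (use that in \<open>auto simp: out_arcs_def\<close>)
    then show ?thesis unfolding out_degree_def by (rule bij_betw_same_card)
  qed
  show ?thesis
  proof
    fix v assume "v \<in> leaves (reducible_stem T)"
    then have vR: "v \<in> ?R" and one: "card (E `` {v} \<inter> ?R) = 1"
      using od unfolding leaves_def stem by auto
    then have vV: "v \<in> V" by blast
    have out: "v = b \<and> n = m" if "(v, n) \<in> E" "pend E m b" "deg E b \<ge> 3" "n \<in> side E m b" for n m b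
    proof -
      have mb: "(m, b) \<in> E" using that by (simp add: pend_def)
      have "v \<notin> side E m b" using vR that(2,3) by auto
      then have "v \<in> side E b m" using side_compl[OF mb vV] by blast
      then show ?thesis using cross[OF E_sym[OF mb] _ that(4,1)] by blast
    qed
    have nbr_out: "pend E n v \<and> deg E v \<ge> 3" if n: "(v, n) \<in> E" "n \<notin> ?R" for n
    proof -
      have "n \<in> V" using E_verts n(1) by blast
      then obtain m b where mb: "pend E m b" "deg E b \<ge> 3" "n \<in> side E m b" using n(2) by auto
      then show ?thesis using out[OF n(1) mb] by simp
    qed
    have v3: "deg E v \<ge> 3"
    proof (rule ccontr)
      assume lt: "\<not> deg E v \<ge> 3"
      then have "E `` {v} \<subseteq> ?R" using nbr_out by blast
      then have "E `` {v} \<inter> ?R = E `` {v}" by blast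
      then have "v \<in> tleaves E" using one by (simp add: tleaves_def deg_def)
      then obtain m b where "pend E m b" "deg E b \<ge> 3" "v \<in> side E m b" using leaf_in_pend True by metis
      then show False using vR by auto
    qed
    have "v \<notin> core E"
    proof
      assume vc: "v \<in> core E"
      obtain m a where m: "(m, v) \<in> E" "a \<in> side E m v" "deg E a \<ge> 3" using core_other_branch[OF vc] by metis
      obtain n a' where n: "(n, v) \<in> E" "n \<noteq> m" "a' \<in> side E n v" "deg E a' \<ge> 3" by (rule core_other_branch[OF vc])
      have "m \<in> ?R" using nbr_out[OF E_sym[OF m(1)]] branch_not_in_pend m(2,3) by blast
      moreover have "n \<in> ?R" using nbr_out[OF E_sym[OF n(1)]] branch_not_in_pend n(3,4) by blast
      ultimately have "{m, n} \<subseteq> E `` {v} \<inter> ?R" using m(1) n(1) E_sym by blast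
      then have "card {m, n} \<le> card (E `` {v} \<inter> ?R)" by (intro card_mono) auto
      then show False using one n(2) by simp
    qed
    then show "v \<in> ends E" using v3 by (simp add: ends_def)
  qed
qed

lemma connected_T:
  assumes "V \<noteq> {}" shows "Digraph_Component.connected T"
proof -
  have eq: "mk_symmetric T = \<lparr>pverts = V, parcs = E\<rparr>"
    using E_sym by (fastforce simp: mk_symmetric_def)
  show ?thesis using assms rtrancl_on_V by (simp add: connected_def strongly_connected_def eq reachable_def)
qed

text \<open>For a cycle starting \<open>u\<close>, \<open>v\<close>, \<open>w\<close> of length at
  least 3, \<open>w\<close> differs from \<open>u\<close> and the rest of the cycle avoids
  \<open>v\<close>. It leads from \<open>w\<close> back to \<open>u\<close> without the edge
  \<open>vu\<close>, which then is no bridge.\<close>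

lemma no_cycle_T: "\<not> (\<exists>p. pre_digraph.cycle T p \<and> length p \<ge> 3)"
proof
  assume "\<exists>p. pre_digraph.cycle T p \<and> length p \<ge> 3"
  then obtain u p where p: "set p \<subseteq> E" "pcas u p u" "distinct (tl (pawalk_verts u p))" "length p \<ge> 3"
    by (auto simp: pre_digraph.cycle_def pre_digraph.awalk_def cas_with_proj_eq awalk_verts_with_proj_eq)
  then obtain e f q where efq: "p = e # f # q" "q \<noteq> []" by (cases p rule: list.exhaust; cases "tl p"; cases "tl (tl p)") auto
  define v w where "v = snd e" and "w = snd f"
  have e: "(u, v) \<in> E" and f: "(v, w) \<in> E" and q: "set q \<subseteq> E" "pcas w q u"
  proof -
    have "fst e = u" "fst f = v" "e \<in> E" "f \<in> E" using p(1,2) unfolding efq by (simp_all add: v_def)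
    then show "(u, v) \<in> E" "(v, w) \<in> E" unfolding v_def w_def by (metis prod.collapse)+
    show "set q \<subseteq> E" "pcas w q u" using p(1,2) unfolding efq by (simp_all add: w_def)
  qed
  have d: "v \<notin> set (pawalk_verts w q)" "distinct (pawalk_verts w q)"
    using p efq by (auto simp: v_def w_def)
  have "w \<noteq> u"
  proof
    assume "w = u"
    then show False using q(2) d(2) efq(2) by (cases q) (auto dest: pcas_end)
  qed
  then have "w \<in> side E v u" using side_step'[OF E_sym[OF e] side_self f] by blast
  have "(w, u) \<in> (E - {(v, u), (u, v)})\<^sup>*" using q d(1)
  proof (induction q arbitrary: w)
    case (Cons g q)
    have "(w, snd g) \<in> E - {(v, u), (u, v)}"
      using Cons.prems pcas_start[of "snd g" q u] by auto
    moreover have "(snd g, u) \<in> (E - {(v, u), (u, v)})\<^sup>*" using Cons by auto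
    ultimately show ?case by (rule converse_rtrancl_into_rtrancl)
  qed simp
  then have "u \<in> side E v u" using \<open>w \<in> side E v u\<close> rtrancl_trans[of v w] by (simp add: side_def)
  then show False using bridge[OF E_sym[OF e]] by blast
qed

lemma undirected_tree_T: "V \<noteq> {} \<Longrightarrow> undirected_tree T"
  using pair_graph.pair_graphD_graph[OF pair_graph_T] connected_T no_cycle_T by (simp add: undirected_tree_def)

end

section \<open>Transfer of the hypotheses and the conclusion\<close>

lemma k14_graph_of_K14_free:
  assumes "pair_graph G" "K14_free (with_proj G)"
  shows "k14_graph (pverts G) (parcs G)"
proof
  interpret pair_graph G by fact
  show "finite (pverts G)" by (rule pair_finite_verts)
  show sub: "parcs G \<subseteq> pverts G \<times> pverts G" using in_arcsD1 in_arcsD2 by auto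
  show sym: "sym (parcs G)" using pair_sym_arcs by (simp add: symmetric_def)
  show irr: "x \<noteq> y" if "(x, y) \<in> parcs G" for x y using pair_no_loops[OF that] by simp
  fix p a b c d
  assume e: "(p, a) \<in> parcs G" "(p, b) \<in> parcs G" "(p, c) \<in> parcs G" "(p, d) \<in> parcs G" and dist: "distinct [a, b, c, d]"
  show "(a, b) \<in> parcs G \<or> (a, c) \<in> parcs G \<or> (a, d) \<in> parcs G \<or> (b, c) \<in> parcs G \<or> (b, d) \<in> parcs G \<or> (c, d) \<in> parcs G"
  proof (rule ccontr)
    assume non: "\<not> ?thesis"
    let ?S = "{p, a, b, c, d}"
    let ?H = "\<lparr>pverts = ?S, parcs = parcs G \<inter> ?S \<times> ?S\<rparr>"
    have sy: "(y, x) \<in> parcs G" if "(x, y) \<in> parcs G" for x y using sym that by (auto dest: symD)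
    have ne: "p \<noteq> a" "p \<noteq> b" "p \<noteq> c" "p \<noteq> d" using irr e by blast+
    have nonsym: "(x, y) \<notin> parcs G" if "x \<in> {a, b, c, d}" "y \<in> {a, b, c, d}" for x y
      using that non sy irr by blast
    have pp: "(p, p) \<notin> parcs G" using irr by blast
    have star: "parcs G \<inter> ?S \<times> ?S = {p} \<times> {a, b, c, d} \<union> {a, b, c, d} \<times> {p}"
    proof
      show "parcs G \<inter> ?S \<times> ?S \<subseteq> {p} \<times> {a, b, c, d} \<union> {a, b, c, d} \<times> {p}"
        using nonsym pp by blast
      show "{p} \<times> {a, b, c, d} \<union> {a, b, c, d} \<times> {p} \<subseteq> parcs G \<inter> ?S \<times> ?S"
        using e sy by blast
    qed
    have "finite ?S" by simp
    moreover have "?S = {p} \<union> {a, b, c, d}" "{p} \<inter> {a, b, c, d} = {}" using ne by auto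
    moreover have "card {a, b, c, d} = 4" "card {p} = 1" using dist by auto
    ultimately have "K\<^bsub>1,4\<^esub> (with_proj ?H)"
      unfolding complete_bipartite_digraph_pair_def pair_pre_digraph.simps star by blast
    moreover have "induced_subgraph (with_proj ?H) (with_proj G)"
    proof -
      have "pair_wf_digraph ?H" by unfold_locales auto
      then have "wf_digraph (with_proj ?H)" by (simp only: wf_digraph_wp_iff)
      moreover have "pair_wf_digraph G" by unfold_locales
      then have "wf_digraph (with_proj G)" by (simp only: wf_digraph_wp_iff)
      moreover have "?S \<subseteq> pverts G" using e sub by auto
      ultimately have sg: "subgraph (with_proj ?H) (with_proj G)"
        unfolding subgraph_def using compatibleI_with_proj by simp
      have eq: "parcs G \<inter> S \<times> S = {z \<in> parcs G. fst z \<in> S \<and> snd z \<in> S}" for S by auto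
      show ?thesis unfolding induced_subgraph_def with_proj_simps pair_pre_digraph.simps
        by (rule conjI[OF sg eq])
    qed
    ultimately show False using assms(2) unfolding K14_free_def by blast
  qed
qed

lemma connected_rtrancl:
  assumes "pair_graph G" "Digraph_Component.connected (with_proj G)"
  shows "pverts G \<noteq> {}" "pverts G \<times> pverts G \<subseteq> (parcs G)\<^sup>*"
proof -
  interpret pair_graph G by fact
  have "sym (parcs G)" using pair_sym_arcs by (simp add: symmetric_def)
  then have "(\<Union>e\<in>parcs G. {(fst e, snd e), (snd e, fst e)}) = parcs G" by (auto dest: symD)
  then have eq: "mk_symmetric (with_proj G) = \<lparr>pverts = pverts G, parcs = parcs G\<rparr>"
    by (simp add: mk_symmetric_def)
  then have c: "pverts G \<noteq> {} \<and> (\<forall>u\<in>pverts G. \<forall>v\<in>pverts G. (u, v) \<in> rtrancl_on (pverts G) (parcs G))"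
    using assms(2) by (simp add: connected_def strongly_connected_def reachable_def)
  then show "pverts G \<noteq> {}" by blast
  have "(u, v) \<in> (parcs G)\<^sup>*" if "(u, v) \<in> rtrancl_on (pverts G) (parcs G)" for u v
    using that by (induction rule: rtrancl_on_induct) auto
  then show "pverts G \<times> pverts G \<subseteq> (parcs G)\<^sup>*" using c by auto
qed

theorem theorem1p8:
  fixes G :: "'a pair_pre_digraph" and k :: nat
  assumes "pair_graph G"
    and "Digraph_Component.connected (with_proj G)"
    and "K14_free (with_proj G)"
    and "k \<ge> 3"
    and "ereal_of_enat (sigma (2 * k + 3) (with_proj G)) \<ge> ereal (real (card (pverts G)) - real k + 1)"
  shows "\<exists>T :: 'a pair_pre_digraph.
           undirected_spanning_tree (with_proj T) (with_proj G) \<and>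
           card (leaves (reducible_stem (with_proj T))) \<le> k"
proof -
  interpret k14_graph "pverts G" "parcs G" by (rule k14_graph_of_K14_free[OF assms(1,3)])
  note gconn = connected_rtrancl[OF assms(1,2)]
  have "\<exists>E. sptree E \<and> card (ends E) \<le> k"
  proof (rule few_ends[OF gconn assms(4)])
    fix U assume U: "U \<subseteq> pverts G" "\<forall>u\<in>U. \<forall>v\<in>U. (u, v) \<notin> parcs G" "card U = 2 * k + 3"
    let ?s = "\<Sum>x\<in>U. out_degree (with_proj G) x"
    have s: "?s = (\<Sum>u\<in>U. card (parcs G `` {u}))" by (simp add: out_degree_with_proj deg_def)
    have "independent_set (with_proj G) U" using U by (simp add: independent_set_def)
    then have "sigma (2 * k + 3) (with_proj G) \<le> enat ?s"
      unfolding sigma_def using U(3) by (intro INF_lower) simp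
    then have "ereal_of_enat (sigma (2 * k + 3) (with_proj G)) \<le> ereal_of_enat (enat ?s)"
      by (simp only: ereal_of_enat_le_iff)
    then have "ereal (real (card (pverts G)) - real k + 1) \<le> ereal_of_enat (enat ?s)"
      using assms(5) by (rule order_trans[rotated])
    \<comment> \<open>The term \<open>k\<close> changes sides while still over the reals, where
      subtraction does not truncate.\<close>
    then have "real (card (pverts G)) - real k + 1 \<le> real ?s" by simp
    then have "real (card (pverts G) + 1) \<le> real (?s + k)" by simp
    then have "card (pverts G) + 1 \<le> ?s + k" by (simp only: of_nat_le_iff)
    then show "card (pverts G) + 1 \<le> (\<Sum>u\<in>U. card (parcs G `` {u})) + k" using s by simp
  qed
  then obtain E where E: "sptree E" "card (ends E) \<le> k" by blast
  interpret utree "pverts G" E by (rule sptree_utree[OF E(1)])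
  let ?T = "\<lparr>pverts = pverts G, parcs = E\<rparr>"
  have "spanning (with_proj ?T) (with_proj G)"
  proof -
    interpret G: pair_graph G by (rule assms(1))
    interpret T: pair_graph ?T by (rule pair_graph_T)
    have "wf_digraph (with_proj ?T)" "wf_digraph (with_proj G)" by unfold_locales
    moreover have "E \<subseteq> parcs G" using E(1) by (simp add: sptree_def)
    ultimately show ?thesis by (auto simp: spanning_def subgraph_def)
  qed
  then have "undirected_spanning_tree (with_proj ?T) (with_proj G)"
    using undirected_tree_T[OF gconn(1)] by (simp add: undirected_spanning_tree_def)
  moreover have "finite (ends E)"
    by (rule finite_subset[OF _ branches_fin]) (auto simp: ends_def)
  then have "card (leaves (reducible_stem (with_proj ?T))) \<le> card (ends E)"
    by (rule card_mono[OF _ leaves_reducible_stem])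
  then have "card (leaves (reducible_stem (with_proj ?T))) \<le> k" using E(2) by simp
  ultimately show ?thesis by blast
qed

end
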